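(* Let $\alpha\ge1$ and let $X_1,\dots,X_n$ be i.i.d. with probability density $f_0$ on $[0,1]$ such that $\log f_0\in\mathcal C^\alpha[0,1]$. Let $h_n=(n/\log n)^{-1/(2\alpha+1)}$ and $L_n=\lfloor\log_2(1/h_n)\rfloor$. Define the prior $\Pi$ on densities on $[0,1]$ as the law of $$f(x)=\exp\{T(x)-c(T)\},\qquad T(x)=\sum_{l=0}^{L_n}\sum_{k=0}^{2^l-1}\sigma_l\alpha_{lk}\psi_{lk}(x),\qquad c(T)=\log\int_0^1e^{T(x)}dx,$$ where the $\alpha_{lk}$ are i.i.d. with Lebesgue density $\varphi$ on $\mathbb{R}$ and $\sigma_l>0$, in one of the two cases: (a) (log-Lipschitz case) $\log\varphi$ is Lipschitz on $\mathbb{R}$ and $\sigma_l\ge2^{-l(\alpha+1/2)}$ for all $l$; (b) (Gaussian case) $\varphi(x)=e^{-x^2/2}/\sqrt{2\pi}$ and $\sigma_l=2^{-l(1/2+r)}$ for some fixed $0<r\le\alpha-1/4$. Assume moreover that for some $\nu>0$, $$E_{f_0}^n\,\Pi\big[f: h(f,f_0)>(\log n)^\nu n^{-\alpha/(2\alpha+1)}\mid X^{(n)}\big]\to0\quad(n\to\infty).$$ Let $\varepsilon^*_{n,\alpha}=(\log n/n)^{\alpha/(2\alpha+1)}$. If $\alpha>1$, then for every sequence $M_n\to\infty$, $$E_{f_0}^n\,\Pi\big[f:\|f-f_0\|_\infty>M_n\varepsilon^*_{n,\alpha}\mid X^{(n)}\big]\to0 .$$ If $\alpha=1$, there exists $\eta>0$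 such that the same holds with $\varepsilon^*_{n,\alpha}$ replaced by $(\log n)^\eta\varepsilon^*_{n,\alpha}$.
   Context: $\{\psi_{lk}: l\ge0,\ 0\le k\le2^l-1\}$ is the boundary-corrected (Cohen–Daubechies–Vial) wavelet orthonormal basis of $L^2[0,1]$, relabelled so levels start at $0$ and chosen sufficiently smooth (Hölder of order $S\ge\alpha$), with supports of diameter $\lesssim2^{-l}$, $\|\psi_{lk}\|_\infty\lesssim2^{l/2}$, $\|\sum_k|\psi_{lk}|\|_\infty\lesssim2^{l/2}$, and $\int_0^1\psi_{lk}=0$ for all $l$ beyond a fixed level. $\mathcal C^\alpha[0,1]$ is the Hölder space: functions with $\lceil\alpha\rceil-1$ continuous derivatives, the last one being Hölder continuous of exponent $\alpha-\lceil\alpha\rceil+1$ (so $\mathcal C^1$ is the Lipschitz functions). $h$ is the Hellinger distance, $h(f,g)^2=\int_0^1(\sqrt f-\sqrt g)^2$. The posterior is $\Pi(B\mid X^{(n)})=\int_B\prod_i f(X_i)\,d\Pi(f)/\int\prod_if(X_i)\,d\Pi(f)$, and $E^n_{f_0}$ is expectation under $X_1,\dots,X_n$ i.i.d. $f_0$. *)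

theory Defs
  imports "HOL-Probability.Probability"
begin

definition holder :: "real \<Rightarrow> (real \<Rightarrow> real) \<Rightarrow> bool" where
  "holder a g \<longleftrightarrow>
     (let m = nat (\<lceil>a\<rceil> - 1) in
      \<exists>D :: nat \<Rightarrow> real \<Rightarrow> real.
        (\<forall>x\<in>{0..1}. D 0 x = g x) \<and>
        (\<forall>j<m. \<forall>x\<in>{0..1}. (D j has_real_derivative D (Suc j) x) (at x within {0..1})) \<and>
        (\<exists>C. \<forall>x\<in>{0..1}. \<forall>y\<in>{0..1}. \<bar>D m x - D m y\<bar> \<le> C * \<bar>x - y\<bar> powr (a - real m)))"

text \<open>Properties of the (relabelled) boundary-corrected Cohen--Daubechies--Vial wavelet
  basis psi l k (l \<ge> 0, k < 2^l) of L^2[0,1] of regularity S.\<close>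
definition cdv_basis :: "(nat \<Rightarrow> nat \<Rightarrow> real \<Rightarrow> real) \<Rightarrow> real \<Rightarrow> bool" where
  "cdv_basis \<psi> S \<longleftrightarrow>
     (\<forall>l k. k < 2^l \<longrightarrow> holder S (\<psi> l k)) \<and>
     (\<forall>l k l' k'. k < 2^l \<longrightarrow> k' < 2^l' \<longrightarrow>
        (LINT x:{0..1}|lborel. \<psi> l k x * \<psi> l' k' x) = (if (l, k) = (l', k') then 1 else 0)) \<and>
     (\<forall>g. g \<in> borel_measurable lborel \<longrightarrow> set_integrable lborel {0..1} (\<lambda>x. (g x)\<^sup>2) \<longrightarrow>
        (\<forall>l k. k < 2^l \<longrightarrow> (LINT x:{0..1}|lborel. g x * \<psi> l k x) = 0) \<longrightarrow>
        (AE x in lborel. x \<in> {0..1} \<longrightarrow> g x = 0)) \<and>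
     (\<exists>C. \<forall>l k. k < 2^l \<longrightarrow>
        (\<exists>c. \<forall>x\<in>{0..1}. \<psi> l k x \<noteq> 0 \<longrightarrow> \<bar>x - c\<bar> \<le> C * 2 powr (- real l))) \<and>
     (\<exists>C. \<forall>l k x. k < 2^l \<longrightarrow> x \<in> {0..1} \<longrightarrow> \<bar>\<psi> l k x\<bar> \<le> C * 2 powr (real l / 2)) \<and>
     (\<exists>C. \<forall>l x. x \<in> {0..1} \<longrightarrow> (\<Sum>k<2^l. \<bar>\<psi> l k x\<bar>) \<le> C * 2 powr (real l / 2)) \<and>
     (\<exists>J. \<forall>l\<ge>J. \<forall>k<2^l. \<forall>j::nat. real j < S \<longrightarrow>
        (LINT x:{0..1}|lborel. x ^ j * \<psi> l k x) = 0)"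

definition idx :: "nat \<Rightarrow> (nat \<times> nat) set" where
  "idx L = {(l, k). l \<le> L \<and> k < 2^l}"

definition wT :: "(nat \<Rightarrow> nat \<Rightarrow> real \<Rightarrow> real) \<Rightarrow> (nat \<Rightarrow> real) \<Rightarrow> nat \<Rightarrow> (nat \<times> nat \<Rightarrow> real) \<Rightarrow> real \<Rightarrow> real" where
  "wT \<psi> \<sigma> L a x = (\<Sum>(l, k)\<in>idx L. \<sigma> l * a (l, k) * \<psi> l k x)"

definition expdens :: "(real \<Rightarrow> real) \<Rightarrow> real \<Rightarrow> real" where
  "expdens T x = exp (T x - ln (LINT y:{0..1}|lborel. exp (T y)))"

definition coef_prior :: "(real \<Rightarrow> real) \<Rightarrow> nat \<Rightarrow> (nat \<times> nat \<Rightarrow> real) measure" where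
  "coef_prior \<phi> L = PiM (idx L) (\<lambda>_. density lborel (\<lambda>x. ennreal (\<phi> x)))"

definition post :: "(nat \<Rightarrow> nat \<Rightarrow> real \<Rightarrow> real) \<Rightarrow> (nat \<Rightarrow> real) \<Rightarrow> (real \<Rightarrow> real) \<Rightarrow> nat
    \<Rightarrow> ((real \<Rightarrow> real) \<Rightarrow> bool) \<Rightarrow> nat \<Rightarrow> (nat \<Rightarrow> real) \<Rightarrow> real" where
  "post \<psi> \<sigma> \<phi> L P n xs =
     (let F = (\<lambda>a. expdens (wT \<psi> \<sigma> L a));
          lik = (\<lambda>a. \<Prod>i<n. F a (xs i))
      in enn2real (\<integral>\<^sup>+ a. ennreal (lik a) * indicator {a. P (F a)} a \<partial>coef_prior \<phi> L)
         / enn2real (\<integral>\<^sup>+ a. ennreal (lik a) \<partial>coef_prior \<phi> L))"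

definition sample :: "(real \<Rightarrow> real) \<Rightarrow> nat \<Rightarrow> (nat \<Rightarrow> real) measure" where
  "sample f0 n = PiM {..<n} (\<lambda>_. density lborel (\<lambda>x. ennreal (indicator {0..1} x * f0 x)))"

definition hn :: "real \<Rightarrow> nat \<Rightarrow> real" where
  "hn a n = (real n / ln (real n)) powr (- 1 / (2 * a + 1))"

definition Ln :: "real \<Rightarrow> nat \<Rightarrow> nat" where
  "Ln a n = nat \<lfloor>log 2 (1 / hn a n)\<rfloor>"

definition EP :: "(nat \<Rightarrow> nat \<Rightarrow> real \<Rightarrow> real) \<Rightarrow> (nat \<Rightarrow> real) \<Rightarrow> (real \<Rightarrow> real) \<Rightarrow> real
    \<Rightarrow> (real \<Rightarrow> real) \<Rightarrow> ((real \<Rightarrow> real) \<Rightarrow> bool) \<Rightarrow> nat \<Rightarrow> real" where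
  "EP \<psi> \<sigma> \<phi> a f0 P n = (\<integral> xs. post \<psi> \<sigma> \<phi> (Ln a n) P n xs \<partial>sample f0 n)"

definition hell :: "(real \<Rightarrow> real) \<Rightarrow> (real \<Rightarrow> real) \<Rightarrow> real" where
  "hell f g = sqrt (LINT x:{0..1}|lborel. (sqrt (f x) - sqrt (g x))\<^sup>2)"

definition supdist :: "(real \<Rightarrow> real) \<Rightarrow> (real \<Rightarrow> real) \<Rightarrow> real" where
  "supdist f g = (SUP x\<in>{0..1}. \<bar>f x - g x\<bar>)"

definition eps_star :: "real \<Rightarrow> nat \<Rightarrow> real" where
  "eps_star a n = (ln (real n) / real n) powr (a / (2 * a + 1))"

end

theory Submission
  imports Defs "HOL-Real_Asymp.Real_Asymp"
begin

text \<open>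
  Write \<open>V\<close> for the span of the wavelets up to level \<open>L\<close>. For \<open>v\<close> in \<open>V\<close>, translating the coefficients of \<open>T\<close>
  by those of \<open>v\<close> and comparing the likelihoods at the two points bounds the posterior exponential
  moment of \<open>n (\<integral>v f - \<integral>v f\<^sub>0)\<close> by \<open>exp (n \<integral>v\<^sup>2 f)\<close>, up to a factor for the prior and
  the exponential moment of the empirical process. No linearisation of the log-likelihood is involved, so
  the bound holds for every \<open>f\<close> in the support of the prior. In the Gaussian case the gradient of the
  log-prior is moved into the exponent.

  First, \<open>v\<close> runs through all sign combinations of wavelets. This bounds the \<open>\<ell>\<^sup>1\<close> norm of the
  coefficients of \<open>f - f\<^sub>0\<close> without a logarithmic loss. As \<open>g = log f\<close> lies in \<open>V\<close>, which contains the
  constants, and \<open>g\<^sub>0 = log f\<^sub>0\<close> lies in \<open>V\<close> up to a bias of order \<open>2\<^bsup>-L\<alpha>\<^esup>\<close>, monotonicity of the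
  exponential, \<open>\<integral>(f - f\<^sub>0)(g - g\<^sub>0) \<ge> c \<parallel>g - g\<^sub>0\<parallel>\<^sup>2\<close>, turns this into the rough bound
  \<open>\<parallel>g - g\<^sub>0\<parallel>\<^sub>\<infinity> \<le> 1\<close>. On that event \<open>\<integral>\<psi>\<^sup>2 f\<close> is bounded for every wavelet \<open>\<psi>\<close>, so that taking single
  wavelets for \<open>v\<close> bounds every coefficient of \<open>f - f\<^sub>0\<close> by a multiple of \<open>sqrt (log n / n)\<close>, and
  monotonicity yields the \<open>L\<^sup>2\<close> rate \<open>2\<^bsup>-L\<alpha>\<^esup>\<close> for \<open>D = g - g\<^sub>0\<close>.

  For the supremum norm, with \<open>P\<close> the projection onto \<open>V\<close> and \<open>R = exp D - 1 - D\<close>,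
  \<open>f\<^sub>0 P D = P (f - f\<^sub>0) - P (f\<^sub>0 R) - [P, f\<^sub>0] D\<close>. The first term is small by the coefficient
  bounds, the second is of order \<open>2\<^sup>L \<parallel>D\<parallel>\<^sub>2\<^sup>2\<close>, and the commutator maps \<open>L\<^sup>2\<close> boundedly to \<open>L\<^sup>\<infinity>\<close>
  because \<open>f\<^sub>0\<close> is Lipschitz and the wavelets are localised.
\<close>

section \<open>Products of Lebesgue densities\<close>

text \<open>Turns the law of the prior coefficients into a density with respect to a translation
  invariant measure. It suffices to compare the two measures on boxes, where Tonelli's theorem
  factorises the integral.\<close>

lemma PiM_density_lborel:
  fixes \<phi> :: "real \<Rightarrow> real"
  assumes I: "finite I" and [measurable]: "\<phi> \<in> borel_measurable lborel"
    and int: "(\<integral>\<^sup>+ x. ennreal (\<phi> x) \<partial>lborel) = 1"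
  shows "PiM I (\<lambda>_. density lborel (\<lambda>x. ennreal (\<phi> x)))
       = density (PiM I (\<lambda>_. lborel)) (\<lambda>a. \<Prod>i\<in>I. ennreal (\<phi> (a i)))"
proof -
  let ?M = "density lborel (\<lambda>x. ennreal (\<phi> x))"
  have "prob_space ?M"
    by (rule prob_spaceI) (simp add: emeasure_density int)
  then interpret M: product_prob_space "\<lambda>_. ?M" I
    by (simp add: product_prob_space_def product_sigma_finite_def product_prob_space_axioms_def
        prob_space_imp_sigma_finite)
  interpret B: product_sigma_finite "\<lambda>_. lborel :: real measure"
    by (simp add: product_sigma_finite_def sigma_finite_lborel)
  show ?thesis
  proof (rule M.PiM_eqI[symmetric, OF I])
    show "sets (density (PiM I (\<lambda>_. lborel)) (\<lambda>a. \<Prod>i\<in>I. ennreal (\<phi> (a i)))) = sets (PiM I (\<lambda>_. ?M))"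
      by (simp cong: sets_PiM_cong)
  next
    fix A :: "'a \<Rightarrow> real set" assume A: "\<And>i. i \<in> I \<Longrightarrow> A i \<in> sets ?M"
    then have Ab: "i \<in> I \<Longrightarrow> A i \<in> sets borel" for i by simp
    have "emeasure (density (PiM I (\<lambda>_. lborel)) (\<lambda>a. \<Prod>i\<in>I. ennreal (\<phi> (a i)))) (Pi\<^sub>E I A)
        = (\<integral>\<^sup>+a. (\<Prod>i\<in>I. ennreal (\<phi> (a i))) * indicator (Pi\<^sub>E I A) a \<partial>PiM I (\<lambda>_. lborel))"
      using Ab by (intro emeasure_density) (auto intro!: sets_PiM_I_finite I)
    also have "\<dots> = (\<integral>\<^sup>+a. (\<Prod>i\<in>I. ennreal (\<phi> (a i)) * indicator (A i) (a i)) \<partial>PiM I (\<lambda>_. lborel))"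
    proof (rule nn_integral_cong)
      \<comment> \<open>Points of the product space are extensional, so membership in the box is a
        condition on the coordinates in \<open>I\<close> only.\<close>
      fix a :: "'a \<Rightarrow> real" assume a: "a \<in> space (PiM I (\<lambda>_. lborel))"
      have "indicator (Pi\<^sub>E I A) a = (\<Prod>i\<in>I. indicator (A i) (a i) :: ennreal)"
        using a I by (auto simp: space_PiM indicator_def PiE_iff extensional_def prod_zero_iff)
      then show "(\<Prod>i\<in>I. ennreal (\<phi> (a i))) * indicator (Pi\<^sub>E I A) a
          = (\<Prod>i\<in>I. ennreal (\<phi> (a i)) * indicator (A i) (a i))"
        by (simp add: prod.distrib)
    qed
    also have "\<dots> = (\<Prod>i\<in>I. \<integral>\<^sup>+x. ennreal (\<phi> x) * indicator (A i) x \<partial>lborel)"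
      using Ab by (intro B.product_nn_integral_prod I) (measurable, auto)
    also have "\<dots> = (\<Prod>i\<in>I. emeasure ?M (A i))"
      using Ab by (intro prod.cong refl) (simp add: emeasure_density)
    finally show "emeasure (density (PiM I (\<lambda>_. lborel)) (\<lambda>a. \<Prod>i\<in>I. ennreal (\<phi> (a i)))) (Pi\<^sub>E I A)
        = (\<Prod>i\<in>I. emeasure ?M (A i))" .
  qed
qed

text \<open>Restricting the translated function to \<open>I\<close> keeps it extensional, hence
  inside the product space. Invariance is then checked on boxes, coordinate by coordinate.\<close>

lemma nn_integral_PiM_lborel_shift:
  fixes h :: "('i \<Rightarrow> real) \<Rightarrow> ennreal"
  assumes I: "finite I" and h[measurable]: "h \<in> borel_measurable (PiM I (\<lambda>_. lborel))"
  shows "(\<integral>\<^sup>+a. h (\<lambda>i\<in>I. t i + a i) \<partial>PiM I (\<lambda>_. lborel)) = (\<integral>\<^sup>+a. h a \<partial>PiM I (\<lambda>_. lborel))"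
proof -
  interpret B: product_sigma_finite "\<lambda>_. lborel :: real measure"
    by (simp add: product_sigma_finite_def sigma_finite_lborel)
  let ?P = "PiM I (\<lambda>_. lborel :: real measure)" and ?s = "\<lambda>a. \<lambda>i\<in>I. t i + a i"
  have s[measurable]: "?s \<in> measurable ?P ?P" by measurable
  have "distr ?P ?P ?s = ?P"
  proof (rule B.PiM_eqI[OF I])
    fix A :: "'i \<Rightarrow> real set" assume A: "\<And>i. i \<in> I \<Longrightarrow> A i \<in> sets lborel"
    have vim: "(\<lambda>x. t i + x) -` A i \<in> sets borel" if "i \<in> I" for i
      using A[OF that] by (auto intro!: measurable_sets_borel[of _ borel])
    have "emeasure (distr ?P ?P ?s) (Pi\<^sub>E I A) = emeasure ?P (?s -` Pi\<^sub>E I A \<inter> space ?P)"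
      using A by (intro emeasure_distr) (auto intro!: sets_PiM_I_finite I)
    also have "?s -` Pi\<^sub>E I A \<inter> space ?P = Pi\<^sub>E I (\<lambda>i. (\<lambda>x. t i + x) -` A i)"
      by (auto simp: space_PiM PiE_iff)
    also have "emeasure ?P \<dots> = (\<Prod>i\<in>I. emeasure lborel ((\<lambda>x. t i + x) -` A i))"
      using vim by (intro B.emeasure_PiM I) auto
    also have "\<dots> = (\<Prod>i\<in>I. emeasure lborel (A i))"
    proof (intro prod.cong refl)
      fix i assume "i \<in> I"
      then have "emeasure (distr lborel borel (\<lambda>x. t i + x)) (A i) = emeasure lborel ((\<lambda>x. t i + x) -` A i)"
        using A by (subst emeasure_distr) auto
      then show "emeasure lborel ((\<lambda>x. t i + x) -` A i) = emeasure lborel (A i)"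
        by (simp add: lborel_distr_plus)
    qed
    finally show "emeasure (distr ?P ?P ?s) (Pi\<^sub>E I A) = (\<Prod>i\<in>I. emeasure lborel (A i))" .
  qed simp
  then have "(\<integral>\<^sup>+a. h a \<partial>?P) = (\<integral>\<^sup>+a. h a \<partial>distr ?P ?P ?s)" by simp
  also have "\<dots> = (\<integral>\<^sup>+a. h (?s a) \<partial>?P)" by (rule nn_integral_distr) auto
  finally show ?thesis by simp
qed

section \<open>Continuous functions on the unit interval\<close>

text \<open>A constant of its own, so that for continuous integrands all integrability conditions
  reduce to continuity.\<close>

definition int01 :: "(real \<Rightarrow> real) \<Rightarrow> real" where
  "int01 h = (LINT x:{0..1}|lborel. h x)"

abbreviation cont01 :: "(real \<Rightarrow> real) \<Rightarrow> bool" where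
  "cont01 \<equiv> continuous_on {0..1}"

lemma set_integrable_cont01: "cont01 h \<Longrightarrow> set_integrable lborel {0..1} h"
  by (rule borel_integrable_atLeastAtMost')

lemma int01_cong: "(\<And>x. x \<in> {0..1} \<Longrightarrow> h x = k x) \<Longrightarrow> int01 h = int01 k"
  unfolding int01_def by (rule set_lebesgue_integral_cong) auto

lemma int01_add: "cont01 h \<Longrightarrow> cont01 k \<Longrightarrow> int01 (\<lambda>x. h x + k x) = int01 h + int01 k"
  unfolding int01_def by (intro set_integral_add set_integrable_cont01)

lemma int01_diff: "cont01 h \<Longrightarrow> cont01 k \<Longrightarrow> int01 (\<lambda>x. h x - k x) = int01 h - int01 k"
  unfolding int01_def by (intro set_integral_diff set_integrable_cont01)

lemma int01_cmult: "int01 (\<lambda>x. c * h x) = c * int01 h"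
  unfolding int01_def by simp

lemma int01_const [simp]: "int01 (\<lambda>x. c) = c"
  unfolding int01_def set_lebesgue_integral_def by simp

lemma int01_sum:
  "finite I \<Longrightarrow> (\<And>i. i \<in> I \<Longrightarrow> cont01 (h i)) \<Longrightarrow> int01 (\<lambda>x. \<Sum>i\<in>I. h i x) = (\<Sum>i\<in>I. int01 (h i))"
proof (induction I rule: finite_induct)
  case (insert i I)
  then have "int01 (\<lambda>x. h i x + (\<Sum>i\<in>I. h i x)) = int01 (h i) + int01 (\<lambda>x. \<Sum>i\<in>I. h i x)"
    by (intro int01_add continuous_intros) auto
  then show ?case using insert by simp
qed simp

lemma int01_mono:
  "cont01 h \<Longrightarrow> cont01 k \<Longrightarrow> (\<And>x. x \<in> {0..1} \<Longrightarrow> h x \<le> k x) \<Longrightarrow> int01 h \<le> int01 k"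
  unfolding int01_def by (intro set_integral_mono set_integrable_cont01)

lemma int01_nonneg: "(\<And>x. x \<in> {0..1} \<Longrightarrow> 0 \<le> h x) \<Longrightarrow> 0 \<le> int01 h"
  unfolding int01_def set_lebesgue_integral_def
  by (rule integral_nonneg_AE) (auto simp: indicator_def)

lemma nn_integral_int01:
  assumes h: "cont01 h" "\<And>x. x \<in> {0..1} \<Longrightarrow> 0 \<le> h x"
  shows "(\<integral>\<^sup>+x. ennreal (indicator {0..1} x *\<^sub>R h x) \<partial>lborel) = ennreal (int01 h)"
  unfolding int01_def set_lebesgue_integral_def
  using set_integrable_cont01[OF h(1)] h(2)
  by (intro nn_integral_eq_integral) (auto simp: set_integrable_def indicator_def)

lemma int01_abs: "cont01 h \<Longrightarrow> \<bar>int01 h\<bar> \<le> int01 (\<lambda>x. \<bar>h x\<bar>)"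
proof -
  assume h: "cont01 h"
  have "int01 h \<le> int01 (\<lambda>x. \<bar>h x\<bar>)"
    by (intro int01_mono continuous_intros h) auto
  moreover have "int01 (\<lambda>x. -1 * \<bar>h x\<bar>) \<le> int01 h"
    by (intro int01_mono continuous_intros h) auto
  ultimately show ?thesis unfolding int01_cmult by linarith
qed

lemma int01_abs_le:
  assumes "cont01 h" "cont01 k" "\<And>x. x \<in> {0..1} \<Longrightarrow> \<bar>h x\<bar> \<le> k x"
  shows "\<bar>int01 h\<bar> \<le> int01 k"
  using int01_abs[OF assms(1)] int01_mono[OF _ assms(2), of "\<lambda>x. \<bar>h x\<bar>"] assms
  by (force intro!: continuous_intros)

lemma int01_Cauchy_Schwarz:
  assumes h: "cont01 h" and k: "cont01 k"
  shows "\<bar>int01 (\<lambda>x. h x * k x)\<bar> \<le> sqrt (int01 (\<lambda>x. (h x)\<^sup>2)) * sqrt (int01 (\<lambda>x. (k x)\<^sup>2))"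
proof -
  let ?a = "int01 (\<lambda>x. (h x)\<^sup>2)" and ?b = "int01 (\<lambda>x. h x * k x)" and ?c = "int01 (\<lambda>x. (k x)\<^sup>2)"
  have a: "0 \<le> ?a" and c: "0 \<le> ?c" by (auto intro: int01_nonneg)
  have q: "0 \<le> ?a - 2 * t * ?b + t\<^sup>2 * ?c" for t
  proof -
    have "int01 (\<lambda>x. (h x - t * k x)\<^sup>2) = int01 (\<lambda>x. (h x)\<^sup>2 - (2 * t) * (h x * k x) + t\<^sup>2 * (k x)\<^sup>2)"
      by (rule int01_cong) (simp add: power2_eq_square algebra_simps)
    also have "\<dots> = ?a - 2 * t * ?b + t\<^sup>2 * ?c"
      using h k by (simp add: int01_add int01_diff int01_cmult continuous_intros)
    finally show ?thesis by (metis int01_nonneg zero_le_power2)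
  qed
  have "?b\<^sup>2 \<le> ?a * ?c"
  proof (cases "?c = 0")
    case True
    have "?b = 0"
    proof (rule ccontr)
      assume "?b \<noteq> 0"
      \<comment> \<open>With \<open>?c = 0\<close> the quadratic is affine in \<open>t\<close>; this
        choice of \<open>t\<close> gives it the value -1.\<close>
      then show False using q[of "(?a + 1) / (2 * ?b)"] True by simp
    qed
    then show ?thesis using True by simp
  next
    case False
    then have "0 \<le> ?a - ?b\<^sup>2 / ?c" using q[of "?b / ?c"] by (simp add: power2_eq_square field_simps)
    then show ?thesis using False c by (simp add: field_simps)
  qed
  then have "\<bar>?b\<bar> \<le> sqrt (?a * ?c)" by (intro real_le_rsqrt) simp
  then show ?thesis by (simp add: real_sqrt_mult)
qed

text \<open>Completeness of the basis holds up to null sets; for continuous functions the integral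
  of the square upgrades this to every point.\<close>

lemma cont01_AE_zero:
  assumes h: "cont01 h" and z: "AE x in lborel. x \<in> {0..1} \<longrightarrow> h x = 0" and x: "x \<in> {0..1}"
  shows "h x = 0"
proof -
  have "int01 (\<lambda>x. (h x)\<^sup>2) = 0"
    unfolding int01_def set_lebesgue_integral_def
    by (rule integral_eq_zero_AE) (use z in \<open>auto simp: indicator_def elim: eventually_mono\<close>)
  moreover have "set_integrable lborel {0..1} (\<lambda>x. (h x)\<^sup>2)"
    using h by (intro set_integrable_cont01 continuous_intros)
  ultimately have "integral {0..1} (\<lambda>x. (h x)\<^sup>2) = 0"
    by (simp add: int01_def set_borel_integral_eq_integral(2))
  then have "\<forall>x\<in>{0..1}. (h x)\<^sup>2 = 0"
    using h by (subst (asm) integral_eq_0_iff) (auto intro!: continuous_intros)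
  then show ?thesis using x by simp
qed

section \<open>Hoelder functions\<close>

lemma holderE:
  assumes "holder a g" "0 < a"
  obtains m D C where "real m < a" "a \<le> real m + 1" "0 \<le> C" "\<forall>x\<in>{0..1}. D 0 x = g x"
    "\<forall>j<m. \<forall>x\<in>{0..1}. (D j has_real_derivative D (Suc j) x) (at x within {0..1})"
    "\<forall>x\<in>{0..1}. \<forall>y\<in>{0..1}. \<bar>D m x - D m y\<bar> \<le> C * \<bar>x - y\<bar> powr (a - real m)"
proof -
  \<comment> \<open>The order of the last derivative in \<open>holder\<close>; as \<open>a\<close>
    is positive, the remaining exponent \<open>a - real m\<close> lies in (0, 1].\<close>
  define m where "m = nat (\<lceil>a\<rceil> - 1)"
  have m: "real m < a" "a \<le> real m + 1" using assms(2) unfolding m_def by linarith+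
  from assms(1) obtain D C where D: "\<forall>x\<in>{0..1}. D 0 x = g x"
    "\<forall>j<m. \<forall>x\<in>{0..1}. (D j has_real_derivative D (Suc j) x) (at x within {0..1})"
    "\<forall>x\<in>{0..1}. \<forall>y\<in>{0..1}. \<bar>D m x - D m y\<bar> \<le> C * \<bar>x - y\<bar> powr (a - real m)"
    unfolding holder_def Let_def m_def[symmetric] by blast
  \<comment> \<open>The constant in \<open>holder\<close> comes without a sign, hence the maximum
    with 0.\<close>
  have "\<bar>D m x - D m y\<bar> \<le> max C 0 * \<bar>x - y\<bar> powr (a - real m)" if "x \<in> {0..1}" "y \<in> {0..1}" for x y
  proof -
    have "\<bar>D m x - D m y\<bar> \<le> C * \<bar>x - y\<bar> powr (a - real m)" using D that by blast
    also have "\<dots> \<le> max C 0 * \<bar>x - y\<bar> powr (a - real m)" by (intro mult_right_mono) auto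
    finally show ?thesis .
  qed
  then show ?thesis using that[of m "max C 0" D] m D(1,2) by auto
qed

lemma cont01_of_Holder:
  assumes H: "\<forall>x\<in>{0..1}. \<forall>y\<in>{0..1}. \<bar>h x - h y\<bar> \<le> C * \<bar>x - y\<bar> powr c" and c: "0 < c"
  shows "cont01 h"
  unfolding continuous_on_def
proof
  fix x :: real assume x: "x \<in> {0..1}"
  have "((\<lambda>y. \<bar>y - x\<bar> powr c) \<longlongrightarrow> 0) (at x within {0..1})"
    by (rule tendsto_zero_powrI[where b = c]) (auto intro!: tendsto_eq_intros c)
  then have "((\<lambda>y. C * \<bar>y - x\<bar> powr c) \<longlongrightarrow> 0) (at x within {0..1})"
    by (rule tendsto_mult_right_zero)
  then have "((\<lambda>y. h y - h x) \<longlongrightarrow> 0) (at x within {0..1})"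
    by (rule Lim_null_comparison[rotated])
       (use H x in \<open>auto simp: eventually_at_filter intro!: always_eventually\<close>)
  then show "(h \<longlongrightarrow> h x) (at x within {0..1})" by (simp add: LIM_zero_iff)
qed

lemma holder_cont01:
  assumes "holder a g" "0 < a" shows "cont01 g"
proof -
  obtain m D C where D: "real m < a" "a \<le> real m + 1" "0 \<le> C" "\<forall>x\<in>{0..1}. D 0 x = g x"
    "\<forall>j<m. \<forall>x\<in>{0..1}. (D j has_real_derivative D (Suc j) x) (at x within {0..1})"
    "\<forall>x\<in>{0..1}. \<forall>y\<in>{0..1}. \<bar>D m x - D m y\<bar> \<le> C * \<bar>x - y\<bar> powr (a - real m)"
    using holderE[OF assms] by metis
  have "cont01 (D 0)"
  proof (cases m)
    case 0
    then show ?thesis using D(1,6) by (intro cont01_of_Holder[of _ C "a - real m"]) auto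
  next
    case (Suc m')
    then show ?thesis using D(5) by (intro DERIV_continuous_on[where D = "D 1"]) auto
  qed
  then show ?thesis using D(4) continuous_on_cong[of "{0..1}" "{0..1}" "D 0" g] by auto
qed

text \<open>For \<open>a = 1\<close> the Hoelder condition is the Lipschitz condition itself; for
  \<open>a > 1\<close> the first derivative is continuous on a compact interval, hence
  bounded.\<close>

lemma holder_Lipschitz:
  assumes "holder a g" "1 \<le> a"
  obtains K where "0 \<le> K" "\<And>x y. x \<in> {0..1} \<Longrightarrow> y \<in> {0..1} \<Longrightarrow> \<bar>g x - g y\<bar> \<le> K * \<bar>x - y\<bar>"
proof -
  have a: "0 < a" using assms by simp
  obtain m D C where D: "real m < a" "a \<le> real m + 1" "0 \<le> C" "\<forall>x\<in>{0..1}. D 0 x = g x"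
    "\<forall>j<m. \<forall>x\<in>{0..1}. (D j has_real_derivative D (Suc j) x) (at x within {0..1})"
    "\<forall>x\<in>{0..1}. \<forall>y\<in>{0..1}. \<bar>D m x - D m y\<bar> \<le> C * \<bar>x - y\<bar> powr (a - real m)"
    using holderE[OF assms(1) a] by metis
  show ?thesis
  proof (cases m)
    case 0
    then have "a = 1" using D(1,2) assms(2) by simp
    then show ?thesis using that[of C] D 0 by (simp add: powr_one_gt_zero_iff)
  next
    case (Suc m')
    \<comment> \<open>\<open>D 1\<close> is either the last derivative, which is Hoelder, or
      differentiable in turn.\<close>
    have "cont01 (D 1)"
    proof (cases m')
      case 0
      then show ?thesis using D(1,6) Suc by (intro cont01_of_Holder[of _ C "a - real m"]) auto
    next
      case (Suc m'')
      then show ?thesis using D(5) \<open>m = Suc m'\<close> by (intro DERIV_continuous_on[where D = "D 2"]) (auto simp: numeral_2_eq_2)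
    qed
    then have "compact (D 1 ` {0..1})" by (intro compact_continuous_image) auto
    then obtain B where B: "\<forall>y\<in>D 1 ` {0..1}. norm y \<le> B"
      using compact_imp_bounded bounded_iff by metis
    have B0: "0 \<le> B" using B by (metis atLeastAtMost_iff imageI norm_ge_zero order.trans order_refl zero_le_one)
    have "norm (D 0 x - D 0 y) \<le> B * norm (x - y)" if "x \<in> {0..1}" "y \<in> {0..1}" for x y
      by (rule field_differentiable_bound[of "{0..1}" "D 0" "D 1"]) (use D(5) B Suc that in auto)
    then show ?thesis using that[of B] D(4) B0 by simp
  qed
qed

text \<open>Induction on \<open>m\<close>, applied to the derivatives shifted by one: the error
  vanishes at \<open>x0\<close> and its derivative is the error for \<open>D 1\<close>, so the mean
  value inequality on the segment from \<open>x0\<close> to \<open>x\<close> raises the exponent by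
  one.\<close>

lemma Taylor_Holder:
  fixes D :: "nat \<Rightarrow> real \<Rightarrow> real"
  assumes "\<forall>j<m. \<forall>x\<in>{0..1}. (D j has_real_derivative D (Suc j) x) (at x within {0..1})"
    and "\<forall>x\<in>{0..1}. \<forall>y\<in>{0..1}. \<bar>D m x - D m y\<bar> \<le> C * \<bar>x - y\<bar> powr c"
    and "0 \<le> C" "0 \<le> c" "x0 \<in> {0..1}" "x \<in> {0..1}"
  shows "\<bar>D 0 x - (\<Sum>j\<le>m. D j x0 / fact j * (x - x0) ^ j)\<bar> \<le> C * \<bar>x - x0\<bar> powr (c + real m)"
  using assms
proof (induction m arbitrary: D x)
  case 0
  then show ?case by simp
next
  case (Suc m)
  let ?E = "\<lambda>y. D 0 y - (\<Sum>j\<le>Suc m. D j x0 / fact j * (y - x0) ^ j)"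
  let ?E' = "\<lambda>y. D 1 y - (\<Sum>j\<le>m. D (Suc j) x0 / fact j * (y - x0) ^ j)"
  let ?S = "closed_segment x0 x"
  have sub: "?S \<subseteq> {0..1}" using Suc.prems by (auto simp: closed_segment_eq_real_ivl split: if_splits)
  have IH: "\<bar>?E' y\<bar> \<le> C * \<bar>y - x0\<bar> powr (c + real m)" if "y \<in> {0..1}" for y
    using Suc.IH[of "\<lambda>j. D (Suc j)" y] Suc.prems that by auto
  \<comment> \<open>The constant term is split off so that differentiation lowers both the power and
    the factorial of every other term by one.\<close>
  have split: "(\<Sum>j\<le>Suc m. D j x0 / fact j * (y - x0) ^ j)
      = D 0 x0 + (\<Sum>j\<le>m. D (Suc j) x0 / fact (Suc j) * (y - x0) ^ Suc j)" for y
    by (subst sum.atMost_Suc_shift) simp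
  have der: "(?E has_real_derivative ?E' y) (at y within ?S)" if "y \<in> ?S" for y
  proof -
    have D0: "(D 0 has_real_derivative D 1 y) (at y within ?S)"
      using Suc.prems(1) sub that by (intro DERIV_subset[OF _ sub]) auto
    have pw: "((\<lambda>y. (y - x0) ^ Suc j) has_real_derivative real (Suc j) * (y - x0) ^ j) (at y within ?S)" for j
      by (auto intro!: derivative_eq_intros simp del: power_Suc)
    have "((\<lambda>y. D 0 y - (D 0 x0 + (\<Sum>j\<le>m. D (Suc j) x0 / fact (Suc j) * (y - x0) ^ Suc j))) has_real_derivative
        D 1 y - (0 + (\<Sum>j\<le>m. D (Suc j) x0 / fact (Suc j) * (real (Suc j) * (y - x0) ^ j)))) (at y within ?S)"
      by (intro DERIV_diff D0 DERIV_add DERIV_const DERIV_sum DERIV_cmult pw)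
    moreover have "(0 + (\<Sum>j\<le>m. D (Suc j) x0 / fact (Suc j) * (real (Suc j) * (y - x0) ^ j)))
        = (\<Sum>j\<le>m. D (Suc j) x0 / fact j * (y - x0) ^ j)"
      by (auto intro!: sum.cong simp del: of_nat_Suc simp: fact_Suc)
    ultimately show ?thesis unfolding split by simp
  qed
  have "norm (?E x - ?E x0) \<le> C * \<bar>x - x0\<bar> powr (c + real m) * norm (x - x0)"
  proof (rule field_differentiable_bound[of ?S ?E ?E'])
    fix y assume y: "y \<in> ?S"
    have "\<bar>y - x0\<bar> \<le> \<bar>x - x0\<bar>" using y by (auto simp: closed_segment_eq_real_ivl split: if_splits)
    then have "C * \<bar>y - x0\<bar> powr (c + real m) \<le> C * \<bar>x - x0\<bar> powr (c + real m)"
      using Suc.prems by (intro mult_left_mono powr_mono2) auto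
    then show "norm (?E' y) \<le> C * \<bar>x - x0\<bar> powr (c + real m)"
      using IH[of y] y sub by auto
  qed (use der ends_in_segment in \<open>blast intro: convex_closed_segment\<close>)+
  moreover have "?E x0 = 0" by (simp add: split)
  moreover have "\<bar>x - x0\<bar> powr (c + real m) * \<bar>x - x0\<bar> = \<bar>x - x0\<bar> powr (c + real (Suc m))"
    by (cases "x = x0") (auto simp: powr_add powr_realpow)
  ultimately show ?case by (simp add: mult.assoc)
qed

section \<open>Wavelet expansions\<close>

lemma finite_idx [simp]: "finite (idx L)"
proof -
  have "idx L \<subseteq> {..L} \<times> {..<2^L}"
    unfolding idx_def by (auto intro: less_le_trans power_increasing)
  then show ?thesis by (rule finite_subset) auto
qed

lemma sum_idx: "(\<Sum>i\<in>idx L. F i) = (\<Sum>l\<le>L. \<Sum>k<2^l. F (l, k))"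
proof -
  have "idx L = Sigma {..L} (\<lambda>l. {..<2^l})" unfolding idx_def by auto
  then show ?thesis by (simp add: sum.Sigma)
qed

lemma idxD: "i \<in> idx L \<Longrightarrow> snd i < 2 ^ fst i" "i \<in> idx L \<Longrightarrow> fst i \<le> L"
  unfolding idx_def by auto

lemma idx_mono: "L \<le> N \<Longrightarrow> idx L \<subseteq> idx N"
  unfolding idx_def by auto

lemma card_idx: "real (card (idx L)) \<le> 2 * 2 ^ L"
proof -
  have "real (card (idx L)) = (\<Sum>i\<in>idx L. 1)" by simp
  also have "\<dots> = (\<Sum>l\<le>L. 2 ^ l)" unfolding sum_idx by simp
  also have "\<dots> = 2 ^ Suc L - 1" by (induction L) auto
  finally show ?thesis by simp
qed

section \<open>Geometric sums over levels\<close>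

lemma sum_powr_half: "(\<Sum>l\<le>L. 2 powr (real l / 2)) \<le> 4 * 2 powr (real L / 2)"
proof (induction L)
  case (Suc L)
  define y where "y = 2 powr (real L / 2)"
  have y: "0 < y" unfolding y_def by simp
  have S: "2 powr (real (Suc L) / 2) = y * sqrt 2"
    unfolding y_def by (simp add: add_divide_distrib powr_add powr_half_sqrt)
  \<comment> \<open>The induction step \<open>4 * y + y * sqrt 2 \<le> 4 * (y * sqrt 2)\<close>
    amounts to this.\<close>
  have "4/3 \<le> sqrt 2" by (rule real_le_rsqrt) (simp add: power2_eq_square)
  then have "y * (4/3) \<le> y * sqrt 2" using y by (intro mult_left_mono) auto
  then show ?case using Suc unfolding y_def[symmetric] S sum.atMost_Suc by simp
qed simp

lemma sum_powr_neg_half: "(\<Sum>l\<le>L. 2 powr (- real l / 2)) \<le> 4"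
proof -
  \<comment> \<open>The subtracted multiple of the last term makes the bound inductive; the factor 3
    gives equality at level 0.\<close>
  have "(\<Sum>l\<le>L. 2 powr (- real l / 2)) \<le> 4 - 3 * 2 powr (- real L / 2)"
  proof (induction L)
    case (Suc L)
    define y where "y = 2 powr (- real (Suc L) / 2)"
    have y: "0 < y" unfolding y_def by simp
    have "- real L / 2 = - real (Suc L) / 2 + 1 / 2" by (simp add: field_simps)
    then have S: "2 powr (- real L / 2) = y * sqrt 2"
      unfolding y_def by (simp only: powr_add) (simp add: powr_half_sqrt)
    have "4/3 \<le> sqrt 2" by (rule real_le_rsqrt) (simp add: power2_eq_square)
    then have "y * (4/3) \<le> y * sqrt 2" using y by (intro mult_left_mono) auto
    then show ?case using Suc unfolding y_def[symmetric] S sum.atMost_Suc by simp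
  qed simp
  then show ?thesis using powr_gt_zero[of 2 "- real L / 2"] by linarith
qed

lemma sum_powr_tail:
  assumes a: "1 \<le> a" and "L \<le> N"
  shows "(\<Sum>l\<in>{L<..N}. 2 powr (- (real l * a))) \<le> 2 powr (- (real L * a))"
proof -
  \<comment> \<open>Subtracting the last term makes the bound inductive, since for
    \<open>a \<ge> 1\<close> each term is at most half of the one before.\<close>
  have "(\<Sum>l\<in>{L<..N}. 2 powr (- (real l * a))) \<le> 2 powr (- (real L * a)) - 2 powr (- (real N * a))"
    using assms(2)
  proof (induction N rule: dec_induct)
    case (step N)
    have ins: "{L<..Suc N} = insert (Suc N) {L<..N}" using step by auto
    have "2 powr (- (real (Suc N) * a)) = 2 powr (- (real N * a)) * 2 powr (- a)"
      by (simp add: powr_add[symmetric] algebra_simps)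
    also have "2 powr (- a) \<le> (2::real) powr (-1)" using a by (intro powr_mono) auto
    finally have "2 * 2 powr (- (real (Suc N) * a)) \<le> 2 powr (- (real N * a))"
      by (simp add: powr_minus mult_left_mono)
    then show ?case using step.IH unfolding ins by simp
  qed simp
  then show ?thesis using powr_gt_zero[of 2 "- (real N * a)"] by linarith
qed

text \<open>The basis in the form used for continuous functions: completeness is pointwise, supports
  are measured by their diameter, and a single constant \<open>Cw\<close> serves all three size
  bounds. As \<open>S \<ge> 1\<close>, wavelets beyond level \<open>J\<close> have at least mean
  zero.\<close>

locale wavelet_basis =
  fixes \<psi> :: "nat \<Rightarrow> nat \<Rightarrow> real \<Rightarrow> real" and S Cw :: real and J :: nat
  assumes S1: "1 \<le> S" and Cw1: "1 \<le> Cw"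
    and cont_psi: "k < 2 ^ l \<Longrightarrow> cont01 (\<psi> l k)"
    and ortho: "k < 2 ^ l \<Longrightarrow> k' < 2 ^ l' \<Longrightarrow>
      int01 (\<lambda>x. \<psi> l k x * \<psi> l' k' x) = (if (l, k) = (l', k') then 1 else 0)"
    and complete: "cont01 g \<Longrightarrow> (\<And>l k. k < 2 ^ l \<Longrightarrow> int01 (\<lambda>x. g x * \<psi> l k x) = 0) \<Longrightarrow>
      x \<in> {0..1} \<Longrightarrow> g x = 0"
    and supp: "k < 2 ^ l \<Longrightarrow> x \<in> {0..1} \<Longrightarrow> y \<in> {0..1} \<Longrightarrow> \<psi> l k x \<noteq> 0 \<Longrightarrow> \<psi> l k y \<noteq> 0 \<Longrightarrow>
      \<bar>x - y\<bar> \<le> Cw * 2 powr (- real l)"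
    and psi_bound: "k < 2 ^ l \<Longrightarrow> x \<in> {0..1} \<Longrightarrow> \<bar>\<psi> l k x\<bar> \<le> Cw * 2 powr (real l / 2)"
    and psi_sum_bound: "x \<in> {0..1} \<Longrightarrow> (\<Sum>k<2^l. \<bar>\<psi> l k x\<bar>) \<le> Cw * 2 powr (real l / 2)"
    and moments: "J \<le> l \<Longrightarrow> k < 2 ^ l \<Longrightarrow> real j < S \<Longrightarrow> int01 (\<lambda>x. x ^ j * \<psi> l k x) = 0"

lemma cdv_basis_wavelet_basis:
  assumes "cdv_basis \<psi> S" "1 \<le> S"
  obtains Cw J where "wavelet_basis \<psi> S Cw J"
proof -
  have H: "\<forall>l k. k < 2^l \<longrightarrow> holder S (\<psi> l k)"
    and O: "\<forall>l k l' k'. k < 2^l \<longrightarrow> k' < 2^l' \<longrightarrow>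
        (LINT x:{0..1}|lborel. \<psi> l k x * \<psi> l' k' x) = (if (l, k) = (l', k') then 1 else 0)"
    and cpl: "\<And>g. g \<in> borel_measurable lborel \<Longrightarrow> set_integrable lborel {0..1} (\<lambda>x. (g x)\<^sup>2) \<Longrightarrow>
        (\<forall>l k. k < 2^l \<longrightarrow> (LINT x:{0..1}|lborel. g x * \<psi> l k x) = 0) \<Longrightarrow>
        (AE x in lborel. x \<in> {0..1} \<longrightarrow> g x = 0)"
    using assms(1) unfolding cdv_basis_def by simp_all
  obtain C1 where C1: "\<forall>l k. k < 2^l \<longrightarrow>
        (\<exists>c. \<forall>x\<in>{0..1}. \<psi> l k x \<noteq> 0 \<longrightarrow> \<bar>x - c\<bar> \<le> C1 * 2 powr (- real l))"
    using assms(1) unfolding cdv_basis_def by metis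
  obtain C2 where C2: "\<forall>l k x. k < 2^l \<longrightarrow> x \<in> {0..1} \<longrightarrow> \<bar>\<psi> l k x\<bar> \<le> C2 * 2 powr (real l / 2)"
    using assms(1) unfolding cdv_basis_def by metis
  obtain C3 where C3: "\<forall>l x. x \<in> {0..1} \<longrightarrow> (\<Sum>k<2^l. \<bar>\<psi> l k x\<bar>) \<le> C3 * 2 powr (real l / 2)"
    using assms(1) unfolding cdv_basis_def by metis
  obtain J where J: "\<forall>l\<ge>J. \<forall>k<2^l. \<forall>j::nat. real j < S \<longrightarrow>
        (LINT x:{0..1}|lborel. x ^ j * \<psi> l k x) = 0"
    using assms(1) unfolding cdv_basis_def by metis
  \<comment> \<open>The factor 2 passes from the radius around a centre to the diameter of the
    support.\<close>
  define C where "C = Max {1, 2 * C1, C2, C3}"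
  have C: "1 \<le> C" "2 * C1 \<le> C" "C2 \<le> C" "C3 \<le> C" unfolding C_def by auto
  have "wavelet_basis \<psi> S C J"
  proof
    show "1 \<le> S" "1 \<le> C" using assms C by auto
    show "cont01 (\<psi> l k)" if "k < 2 ^ l" for l k
      using holder_cont01[of S "\<psi> l k"] H that assms by auto
    show "int01 (\<lambda>x. \<psi> l k x * \<psi> l' k' x) = (if (l, k) = (l', k') then 1 else 0)"
      if "k < 2 ^ l" "k' < 2 ^ l'" for k l k' l'
      using O that unfolding int01_def by auto
    show "int01 (\<lambda>x. x ^ j * \<psi> l k x) = 0" if "J \<le> l" "k < 2 ^ l" "real j < S" for l k j
      using J that unfolding int01_def by auto
    show "\<bar>x - y\<bar> \<le> C * 2 powr (- real l)"
      if "k < 2 ^ l" "x \<in> {0..1}" "y \<in> {0..1}" "\<psi> l k x \<noteq> 0" "\<psi> l k y \<noteq> 0" for k l x y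
    proof -
      obtain c where "\<forall>x\<in>{0..1}. \<psi> l k x \<noteq> 0 \<longrightarrow> \<bar>x - c\<bar> \<le> C1 * 2 powr (- real l)"
        using C1 \<open>k < 2 ^ l\<close> by blast
      then have "\<bar>x - c\<bar> \<le> C1 * 2 powr (- real l)" "\<bar>y - c\<bar> \<le> C1 * 2 powr (- real l)"
        using that by auto
      then have "\<bar>x - y\<bar> \<le> 2 * C1 * 2 powr (- real l)" by linarith
      also have "\<dots> \<le> C * 2 powr (- real l)" using C by (intro mult_right_mono) auto
      finally show ?thesis .
    qed
    show "\<bar>\<psi> l k x\<bar> \<le> C * 2 powr (real l / 2)" if "k < 2 ^ l" "x \<in> {0..1}" for k l x
    proof -
      have "\<bar>\<psi> l k x\<bar> \<le> C2 * 2 powr (real l / 2)" using C2 that by blast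
      also have "\<dots> \<le> C * 2 powr (real l / 2)" using C by (intro mult_right_mono) auto
      finally show ?thesis .
    qed
    show "(\<Sum>k<2^l. \<bar>\<psi> l k x\<bar>) \<le> C * 2 powr (real l / 2)" if "x \<in> {0..1}" for l x
    proof -
      have "(\<Sum>k<2^l. \<bar>\<psi> l k x\<bar>) \<le> C3 * 2 powr (real l / 2)" using C3 that by blast
      also have "\<dots> \<le> C * 2 powr (real l / 2)" using C by (intro mult_right_mono) auto
      finally show ?thesis .
    qed
    show "g x = 0" if g: "cont01 g" "\<And>l k. k < 2 ^ l \<Longrightarrow> int01 (\<lambda>x. g x * \<psi> l k x) = 0" and x: "x \<in> {0..1}" for g x
    proof -
      \<comment> \<open>\<open>cont01\<close> says nothing outside the unit interval, while
        completeness asks for measurability on the whole line; hence the cut-off.\<close>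
      let ?h = "\<lambda>x. indicator {0..1} x * g x"
      have "?h \<in> borel_measurable lborel"
        using borel_measurable_continuous_on_indicator[OF _ g(1)] by simp
      moreover have "set_integrable lborel {0..1} (\<lambda>x. (?h x)\<^sup>2)"
      proof (rule set_integrable_cont01)
        have "cont01 (\<lambda>x. (g x)\<^sup>2)" using g(1) by (intro continuous_intros)
        then show "cont01 (\<lambda>x. (?h x)\<^sup>2)"
          using continuous_on_cong[of "{0..1}" "{0..1}" "\<lambda>x. (?h x)\<^sup>2" "\<lambda>x. (g x)\<^sup>2"] by simp
      qed
      moreover have "(LINT x:{0..1}|lborel. ?h x * \<psi> l k x) = 0" if "k < 2^l" for l k
        using g(2)[OF that] int01_cong[of "\<lambda>x. ?h x * \<psi> l k x" "\<lambda>x. g x * \<psi> l k x"]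
        unfolding int01_def by simp
      ultimately have "AE x in lborel. x \<in> {0..1} \<longrightarrow> ?h x = 0" by (intro cpl) auto
      then have "AE x in lborel. x \<in> {0..1} \<longrightarrow> g x = 0" by (rule eventually_mono) auto
      then show ?thesis using cont01_AE_zero[OF g(1) _ x] by simp
    qed
  qed
  then show ?thesis by (rule that)
qed

section \<open>Coefficients, projections and the constant function\<close>

context wavelet_basis
begin

abbreviation W :: "nat \<times> nat \<Rightarrow> real \<Rightarrow> real" where
  "W i \<equiv> \<psi> (fst i) (snd i)"

definition cf :: "(real \<Rightarrow> real) \<Rightarrow> nat \<times> nat \<Rightarrow> real" where
  "cf h i = int01 (\<lambda>x. h x * W i x)"

lemma cont_W: "i \<in> idx L \<Longrightarrow> cont01 (W i)"
  by (simp add: cont_psi idxD)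

lemma cont_span: "cont01 (\<lambda>x. \<Sum>i\<in>idx L. c i * W i x)"
  by (intro continuous_intros cont_W)

lemma int01_span:
  assumes "cont01 h"
  shows "int01 (\<lambda>x. h x * (\<Sum>i\<in>idx L. c i * W i x)) = (\<Sum>i\<in>idx L. c i * cf h i)"
proof -
  have "int01 (\<lambda>x. h x * (\<Sum>i\<in>idx L. c i * W i x)) = int01 (\<lambda>x. \<Sum>i\<in>idx L. c i * (h x * W i x))"
    by (rule int01_cong) (simp add: sum_distrib_left mult.left_commute)
  also have "\<dots> = (\<Sum>i\<in>idx L. int01 (\<lambda>x. c i * (h x * W i x)))"
    by (intro int01_sum continuous_intros cont_W assms) auto
  finally show ?thesis by (simp add: int01_cmult cf_def)
qed

lemma int01_W_W:
  "i \<in> idx L \<Longrightarrow> j \<in> idx N \<Longrightarrow> int01 (\<lambda>x. W i x * W j x) = (if i = j then 1 else 0)"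
  by (subst ortho) (auto simp: idxD prod_eq_iff)

lemma cf_span:
  assumes "i \<in> idx L"
  shows "cf (\<lambda>x. \<Sum>j\<in>idx L. c j * W j x) i = c i"
proof -
  have "cf (\<lambda>x. \<Sum>j\<in>idx L. c j * W j x) i = int01 (\<lambda>x. W i x * (\<Sum>j\<in>idx L. c j * W j x))"
    unfolding cf_def by (simp add: mult.commute)
  also have "\<dots> = (\<Sum>j\<in>idx L. c j * cf (W i) j)"
    by (rule int01_span) (rule cont_W[OF assms])
  also have "\<dots> = (\<Sum>j\<in>idx L. if i = j then c j else 0)"
    by (intro sum.cong refl) (simp add: cf_def int01_W_W[OF assms])
  finally show ?thesis using assms by simp
qed

lemma cf_W_sq: "i \<in> idx L \<Longrightarrow> int01 (\<lambda>x. (W i x)\<^sup>2) = 1"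
  using int01_W_W[of i L i L] by (simp add: power2_eq_square)

lemma cf_diff: "i \<in> idx L \<Longrightarrow> cont01 h \<Longrightarrow> cont01 k \<Longrightarrow> cf (\<lambda>x. h x - k x) i = cf h i - cf k i"
  unfolding cf_def left_diff_distrib by (intro int01_diff continuous_intros cont_W)

lemma cf_cmult: "cf (\<lambda>x. c * h x) i = c * cf h i"
  unfolding cf_def by (simp add: int01_cmult mult.assoc)

lemma cf_cong: "(\<And>x. x \<in> {0..1} \<Longrightarrow> h x = k x) \<Longrightarrow> cf h i = cf k i"
  unfolding cf_def by (intro int01_cong) auto

lemma Bessel:
  assumes h: "cont01 h"
  shows "(\<Sum>i\<in>idx L. (cf h i)\<^sup>2) \<le> int01 (\<lambda>x. (h x)\<^sup>2)"
proof -
  let ?p = "\<lambda>x. \<Sum>i\<in>idx L. cf h i * W i x" and ?s = "\<Sum>i\<in>idx L. (cf h i)\<^sup>2"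
  have p: "cont01 ?p" by (rule cont_span)
  have hp: "int01 (\<lambda>x. h x * ?p x) = ?s"
    using int01_span[OF h, where L = L and c = "cf h"] by (simp add: power2_eq_square)
  have pp: "int01 (\<lambda>x. ?p x * ?p x) = ?s"
    by (subst int01_span[OF p]) (auto simp: power2_eq_square cf_span intro!: sum.cong)
  have "int01 (\<lambda>x. (h x - ?p x)\<^sup>2) = int01 (\<lambda>x. (h x)\<^sup>2 - 2 * (h x * ?p x) + ?p x * ?p x)"
    by (rule int01_cong) (simp add: power2_eq_square algebra_simps)
  also have "\<dots> = int01 (\<lambda>x. (h x)\<^sup>2) - 2 * int01 (\<lambda>x. h x * ?p x) + int01 (\<lambda>x. ?p x * ?p x)"
    using h p by (simp add: int01_add int01_diff int01_cmult continuous_intros)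
  finally show ?thesis using hp pp int01_nonneg[of "\<lambda>x. (h x - ?p x)\<^sup>2"] by simp
qed

lemma cf_le:
  assumes "cont01 h" "i \<in> idx L"
  shows "\<bar>cf h i\<bar> \<le> sqrt (int01 (\<lambda>x. (h x)\<^sup>2))"
  using int01_Cauchy_Schwarz[OF assms(1) cont_W[OF assms(2)]] cf_W_sq[OF assms(2)]
  by (simp add: cf_def)

text \<open>The cost is \<open>2 powr (real L / 2)\<close> rather than the number of wavelets: at a
  given point level \<open>l\<close> contributes only the order \<open>2 powr (real l / 2)\<close>,
  and the finest level dominates.\<close>

lemma sum_abs_W: "x \<in> {0..1} \<Longrightarrow> (\<Sum>i\<in>idx L. \<bar>W i x\<bar>) \<le> 4 * Cw * 2 powr (real L / 2)"
proof -
  assume x: "x \<in> {0..1}"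
  have "(\<Sum>i\<in>idx L. \<bar>W i x\<bar>) = (\<Sum>l\<le>L. \<Sum>k<2^l. \<bar>\<psi> l k x\<bar>)" by (simp add: sum_idx)
  also have "\<dots> \<le> (\<Sum>l\<le>L. Cw * 2 powr (real l / 2))" by (intro sum_mono psi_sum_bound x)
  also have "\<dots> = Cw * (\<Sum>l\<le>L. 2 powr (real l / 2))" by (simp add: sum_distrib_left)
  also have "\<dots> \<le> Cw * (4 * 2 powr (real L / 2))"
    using Cw1 by (intro mult_left_mono sum_powr_half) auto
  finally show ?thesis by simp
qed

lemma span_sup:
  assumes "\<And>i. i \<in> idx L \<Longrightarrow> \<bar>c i\<bar> \<le> m" "x \<in> {0..1}" "0 \<le> m"
  shows "\<bar>\<Sum>i\<in>idx L. c i * W i x\<bar> \<le> m * (4 * Cw * 2 powr (real L / 2))"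
proof -
  have "\<bar>\<Sum>i\<in>idx L. c i * W i x\<bar> \<le> (\<Sum>i\<in>idx L. m * \<bar>W i x\<bar>)"
    by (rule order.trans[OF sum_abs]) (auto simp: abs_mult intro!: sum_mono mult_right_mono assms)
  also have "\<dots> = m * (\<Sum>i\<in>idx L. \<bar>W i x\<bar>)" by (simp add: sum_distrib_left)
  also have "\<dots> \<le> m * (4 * Cw * 2 powr (real L / 2))"
    using assms by (intro mult_left_mono sum_abs_W)
  finally show ?thesis .
qed

text \<open>The difference from the partial sum has vanishing coefficients at every level, so
  completeness applies.\<close>

lemma expansion_eqI:
  assumes h: "cont01 h" and z: "\<And>l k. L < l \<Longrightarrow> k < 2 ^ l \<Longrightarrow> cf h (l, k) = 0" and x: "x \<in> {0..1}"
  shows "h x = (\<Sum>i\<in>idx L. cf h i * W i x)"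
proof -
  let ?p = "\<lambda>x. \<Sum>i\<in>idx L. cf h i * W i x"
  have "int01 (\<lambda>x. (h x - ?p x) * \<psi> l k x) = 0" if k: "k < 2 ^ l" for l k
  proof -
    have i: "(l, k) \<in> idx (max l L)" using k unfolding idx_def by auto
    have "cf ?p (l, k) = cf h (l, k)"
    proof (cases "l \<le> L")
      case True
      then show ?thesis using k by (intro cf_span) (auto simp: idx_def)
    next
      case False
      have "cf ?p (l, k) = int01 (\<lambda>x. W (l, k) x * ?p x)"
        unfolding cf_def by (simp add: mult.commute)
      also have "\<dots> = (\<Sum>j\<in>idx L. cf h j * cf (W (l, k)) j)"
        by (rule int01_span) (simp add: cont_psi k)
      also have "\<dots> = 0"
      proof (intro sum.neutral ballI)
        fix j assume j: "j \<in> idx L"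
        then have "(l, k) \<noteq> j" using False idxD(2) by fastforce
        then have "cf (W (l, k)) j = 0" unfolding cf_def using int01_W_W[OF i j] by simp
        then show "cf h j * cf (W (l, k)) j = 0" by simp
      qed
      finally show ?thesis using z False k by simp
    qed
    then have "cf (\<lambda>x. h x - ?p x) (l, k) = 0" using i h by (simp add: cf_diff cont_span)
    then show ?thesis by (simp add: cf_def)
  qed
  moreover have "cont01 (\<lambda>x. h x - ?p x)" by (intro continuous_on_diff h cont_span)
  ultimately have "h x - ?p x = 0" using complete x by blast
  then show ?thesis by simp
qed

lemma cf_one_high: "J \<le> fst i \<Longrightarrow> i \<in> idx L \<Longrightarrow> cf (\<lambda>_. 1) i = 0"
  using moments[of "fst i" "snd i" 0] S1 by (simp add: cf_def idxD)

text \<open>From level \<open>J\<close> on the wavelets have mean zero, so the constants lie in the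
  span. This lets the log-normaliser be absorbed into the coefficients of a log-density.\<close>

lemma one_expansion:
  assumes "J \<le> L" "x \<in> {0..1}"
  shows "(\<Sum>i\<in>idx L. cf (\<lambda>_. 1) i * W i x) = 1"
proof -
  have "cf (\<lambda>_. 1) (l, k) = 0" if "L < l" "k < 2 ^ l" for l k
    using cf_one_high[of "(l, k)" l] that assms by (simp add: idx_def)
  from expansion_eqI[OF _ this assms(2)] show ?thesis by simp
qed

lemma sum_cf_one_sq:
  assumes "J \<le> L" shows "(\<Sum>i\<in>idx L. (cf (\<lambda>_. 1) i)\<^sup>2) = 1"
proof -
  have "1 = int01 (\<lambda>x. 1 * (\<Sum>i\<in>idx L. cf (\<lambda>_. 1) i * W i x))"
    using int01_cong[of "\<lambda>x. 1 * (\<Sum>i\<in>idx L. cf (\<lambda>_. 1) i * W i x)" "\<lambda>_. 1"] one_expansion[OF assms]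
    by simp
  also have "\<dots> = (\<Sum>i\<in>idx L. cf (\<lambda>_. 1) i * cf (\<lambda>_. 1) i)" by (rule int01_span) simp
  finally show ?thesis by (simp add: power2_eq_square)
qed

text \<open>Height of the wavelet times the length of an interval containing its support.\<close>

lemma int01_abs_W:
  assumes i: "i \<in> idx L"
  shows "int01 (\<lambda>x. \<bar>W i x\<bar>) \<le> 2 * Cw\<^sup>2 * 2 powr (- real (fst i) / 2)"
proof -
  let ?l = "real (fst i)"
  \<comment> \<open>The norm is one, so the wavelet is non-zero somewhere; such a point centres an
    interval containing the support.\<close>
  have "\<exists>x\<in>{0..1}. W i x \<noteq> 0"
  proof (rule ccontr)
    assume "\<not> ?thesis"
    then have "int01 (\<lambda>x. (W i x)\<^sup>2) = int01 (\<lambda>_. 0)" by (intro int01_cong) auto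
    then show False using cf_W_sq[OF i] by simp
  qed
  then obtain x0 where x0: "x0 \<in> {0..1}" "W i x0 \<noteq> 0" by auto
  define r where "r = Cw * 2 powr (- ?l)"
  have r: "0 \<le> r" using Cw1 unfolding r_def by simp
  have "int01 (\<lambda>x. \<bar>W i x\<bar>) \<le> (LINT x|lborel. Cw * 2 powr (?l / 2) * indicator {x0 - r..x0 + r} x)"
    unfolding int01_def set_lebesgue_integral_def
  proof (rule integral_mono)
    show "integrable lborel (\<lambda>x. indicator {0..1} x *\<^sub>R \<bar>W i x\<bar>)"
      using set_integrable_cont01[of "\<lambda>x. \<bar>W i x\<bar>"] cont_W[OF i]
      by (auto simp: set_integrable_def intro!: continuous_intros)
    fix x
    have "\<bar>x - x0\<bar> \<le> r" "\<bar>W i x\<bar> \<le> Cw * 2 powr (?l / 2)" if "x \<in> {0..1}" "W i x \<noteq> 0"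
      using supp[of "snd i" "fst i" x x0] psi_bound[of "snd i" "fst i" x] x0 that idxD[OF i]
      by (auto simp: r_def)
    then show "indicator {0..1} x *\<^sub>R \<bar>W i x\<bar> \<le> Cw * 2 powr (?l / 2) * indicator {x0 - r..x0 + r} x"
      using Cw1 by (cases "x \<in> {0..1} \<and> W i x \<noteq> 0") (auto simp: indicator_def abs_le_iff)
  qed (auto intro!: integrable_mult_right integrable_real_indicator simp: emeasure_lborel_Icc_eq)
  also have "\<dots> = Cw * 2 powr (?l / 2) * (2 * r)" using r by simp
  also have "\<dots> = 2 * Cw\<^sup>2 * (2 powr (?l / 2) * 2 powr (- ?l))"
    unfolding r_def by (simp add: power2_eq_square)
  also have "2 powr (?l / 2) * 2 powr (- ?l) = 2 powr (- ?l / 2)"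
    by (simp add: powr_add[symmetric])
  finally show ?thesis .
qed

section \<open>Decay of coefficients and approximation error\<close>

lemma moments_shifted:
  assumes i: "i \<in> idx L" "J \<le> fst i" and j: "real j < S"
  shows "int01 (\<lambda>x. (x - x0) ^ j * W i x) = 0"
proof -
  have "int01 (\<lambda>x. (x - x0) ^ j * W i x)
      = int01 (\<lambda>x. \<Sum>m\<le>j. (of_nat (j choose m) * (- x0) ^ (j - m)) * (x ^ m * W i x))"
    using binomial_ring[of _ "- x0" j] by (intro int01_cong) (simp add: sum_distrib_left mult_ac)
  also have "\<dots> = (\<Sum>m\<le>j. (of_nat (j choose m) * (- x0) ^ (j - m)) * int01 (\<lambda>x. x ^ m * W i x))"
    using i by (subst int01_sum) (auto intro!: continuous_intros cont_W simp: int01_cmult)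
  also have "\<dots> = 0"
    using i j by (intro sum.neutral) (auto simp: moments idxD)
  finally show ?thesis .
qed

text \<open>From level \<open>J\<close> on, vanishing moments remove the Taylor polynomial at a
  point of the support, whose degree is below \<open>a\<close> and hence below \<open>S\<close>. The
  remainder is of the order of the support diameter to the power \<open>a\<close>, and the L1 norm
  of the wavelet contributes the additional half. The finitely many coarser levels affect the
  constant only.\<close>

lemma cf_decay:
  assumes g: "holder a g" and a: "1 \<le> a" "a \<le> S"
  obtains C where "0 \<le> C" "\<And>i L. i \<in> idx L \<Longrightarrow> \<bar>cf g i\<bar> \<le> C * 2 powr (- (real (fst i) * (a + 1 / 2)))"
proof -
  have a0: "0 < a" using a by simp
  have gc: "cont01 g" using holder_cont01[OF g a0] .
  obtain m D H where D: "real m < a" "a \<le> real m + 1" "0 \<le> H" "\<forall>x\<in>{0..1}. D 0 x = g x"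
    "\<forall>j<m. \<forall>x\<in>{0..1}. (D j has_real_derivative D (Suc j) x) (at x within {0..1})"
    "\<forall>x\<in>{0..1}. \<forall>y\<in>{0..1}. \<bar>D m x - D m y\<bar> \<le> H * \<bar>x - y\<bar> powr (a - real m)"
    using holderE[OF g a0] by metis
  \<comment> \<open>The last factor compensates the decay demanded at levels below \<open>J\<close>,
    where the coefficients are bounded by the L2 norm alone.\<close>
  define B where "B = sqrt (int01 (\<lambda>x. (g x)\<^sup>2)) * 2 powr (real J * (a + 1 / 2))"
  define A where "A = H * Cw powr a * (2 * Cw\<^sup>2)"
  have B0: "0 \<le> B" unfolding B_def by (auto intro!: mult_nonneg_nonneg int01_nonneg)
  have A0: "0 \<le> A" using D(3) unfolding A_def by simp
  have "\<bar>cf g i\<bar> \<le> (A + B) * 2 powr (- (real (fst i) * (a + 1 / 2)))" if i: "i \<in> idx L" for i L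
  proof (cases "fst i < J")
    case True
    have "\<bar>cf g i\<bar> \<le> sqrt (int01 (\<lambda>x. (g x)\<^sup>2)) * 1" using cf_le[OF gc i] by simp
    also have "\<dots> \<le> sqrt (int01 (\<lambda>x. (g x)\<^sup>2)) * 2 powr ((real J - real (fst i)) * (a + 1 / 2))"
      using True a by (intro mult_left_mono ge_one_powr_ge_zero) (auto intro: int01_nonneg)
    also have "\<dots> = B * 2 powr (- (real (fst i) * (a + 1 / 2)))"
      unfolding B_def by (simp add: powr_add[symmetric] algebra_simps)
    also have "\<dots> \<le> (A + B) * 2 powr (- (real (fst i) * (a + 1 / 2)))"
      using A0 by (intro mult_right_mono) auto
    finally show ?thesis .
  next
    case False
    then have J: "J \<le> fst i" by simp
    show ?thesis
    proof (cases "\<exists>x\<in>{0..1}. W i x \<noteq> 0")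
      case False
      then have "cf g i = int01 (\<lambda>_. 0)" unfolding cf_def by (intro int01_cong) auto
      then show ?thesis using A0 B0 by simp
    next
      case True
      then obtain x0 where x0: "x0 \<in> {0..1}" "W i x0 \<noteq> 0" by auto
      let ?q = "\<lambda>x. \<Sum>j\<le>m. D j x0 / fact j * (x - x0) ^ j"
      define r where "r = Cw * 2 powr (- real (fst i))"
      have "int01 (\<lambda>x. ?q x * W i x) = int01 (\<lambda>x. \<Sum>j\<le>m. D j x0 / fact j * ((x - x0) ^ j * W i x))"
        by (simp only: sum_distrib_right mult.assoc)
      also have "\<dots> = (\<Sum>j\<le>m. D j x0 / fact j * int01 (\<lambda>x. (x - x0) ^ j * W i x))"
        using i by (subst int01_sum) (auto intro!: continuous_intros cont_W simp: int01_cmult[symmetric])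
      also have "\<dots> = 0"
      proof (intro sum.neutral ballI)
        fix j assume "j \<in> {..m}"
        then have "real j < S" using D(1) a by auto
        then show "D j x0 / fact j * int01 (\<lambda>x. (x - x0) ^ j * W i x) = 0"
          using moments_shifted[OF i J] by simp
      qed
      finally have q0: "int01 (\<lambda>x. ?q x * W i x) = 0" .
      have "cf g i = int01 (\<lambda>x. (g x - ?q x) * W i x)"
        unfolding left_diff_distrib cf_def using q0 i gc
        by (subst int01_diff) (auto intro!: continuous_intros cont_W)
      also have "\<bar>\<dots>\<bar> \<le> int01 (\<lambda>x. (H * r powr a) * \<bar>W i x\<bar>)"
      proof (rule int01_abs_le)
        fix x :: real assume x: "x \<in> {0..1}"
        show "\<bar>(g x - ?q x) * W i x\<bar> \<le> H * r powr a * \<bar>W i x\<bar>"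
        proof (cases "W i x = 0")
          case False
          have "\<bar>x - x0\<bar> \<le> r"
            using supp[of "snd i" "fst i" x x0] x x0 False idxD[OF i] by (auto simp: r_def)
          then have "\<bar>x - x0\<bar> powr a \<le> r powr a" using a0 by (intro powr_mono2) auto
          moreover have "\<bar>g x - ?q x\<bar> \<le> H * \<bar>x - x0\<bar> powr a"
            using Taylor_Holder[OF D(5,6,3) _ x0(1) x] D(1,4) x by simp
          ultimately have "\<bar>g x - ?q x\<bar> \<le> H * r powr a"
            using D(3) by (meson mult_left_mono order.trans)
          then show ?thesis by (simp add: abs_mult mult_right_mono)
        qed simp
      qed (use i gc in \<open>auto intro!: continuous_intros cont_W\<close>)
      also have "\<dots> \<le> (H * r powr a) * (2 * Cw\<^sup>2 * 2 powr (- real (fst i) / 2))"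
        unfolding int01_cmult using D(3) int01_abs_W[OF i] by (intro mult_left_mono) auto
      also have "r powr a = Cw powr a * 2 powr (- real (fst i) * a)"
        using Cw1 unfolding r_def by (simp add: powr_mult powr_powr)
      also have "H * (Cw powr a * 2 powr (- real (fst i) * a)) * (2 * Cw\<^sup>2 * 2 powr (- real (fst i) / 2))
          = A * (2 powr (- real (fst i) * a) * 2 powr (- real (fst i) / 2))"
        unfolding A_def by simp
      also have "2 powr (- real (fst i) * a) * 2 powr (- real (fst i) / 2)
          = 2 powr (- (real (fst i) * (a + 1 / 2)))"
        by (simp add: powr_add[symmetric] algebra_simps)
      also have "A * 2 powr (- (real (fst i) * (a + 1 / 2))) \<le> (A + B) * 2 powr (- (real (fst i) * (a + 1 / 2)))"
        using B0 by (intro mult_right_mono) auto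
      finally show ?thesis .
    qed
  qed
  then show ?thesis using that[of "A + B"] A0 B0 by auto
qed

text \<open>Within a level, coefficient decay times the overlap bound leaves
  \<open>2 powr (- (real l * a))\<close>, so the partial sums converge uniformly with a geometric
  tail. Coefficients pass to the uniform limit, and completeness identifies it with
  \<open>g\<close>.\<close>

lemma bias_bound:
  assumes g: "holder a g" and a: "1 \<le> a" "a \<le> S"
  obtains C where "0 \<le> C"
    "\<And>L x. x \<in> {0..1} \<Longrightarrow> \<bar>g x - (\<Sum>i\<in>idx L. cf g i * W i x)\<bar> \<le> C * 2 powr (- (real L * a))"
proof -
  have gc: "cont01 g" using holder_cont01[OF g] a by simp
  obtain C where C: "0 \<le> C" "\<And>i L. i \<in> idx L \<Longrightarrow> \<bar>cf g i\<bar> \<le> C * 2 powr (- (real (fst i) * (a + 1 / 2)))"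
    using cf_decay[OF g a] by metis
  define u where "u l x = (\<Sum>k<2^l. cf g (l, k) * \<psi> l k x)" for l x
  \<comment> \<open>\<open>q n\<close> stops before level \<open>n\<close>, so the projection onto
    the levels up to \<open>L\<close> is \<open>q (Suc L)\<close>.\<close>
  define q where "q n x = (\<Sum>l<n. u l x)" for n x
  let ?C = "C * Cw"
  have C0: "0 \<le> ?C" using C Cw1 by simp
  have q_Suc: "q (Suc L) x = (\<Sum>i\<in>idx L. cf g i * W i x)" for L x
    unfolding q_def u_def sum_idx lessThan_Suc_atMost by simp
  have u: "\<bar>u l x\<bar> \<le> ?C * 2 powr (- (real l * a))" if x: "x \<in> {0..1}" for l x
  proof -
    have "\<bar>u l x\<bar> \<le> (\<Sum>k<2^l. C * 2 powr (- (real l * (a + 1 / 2))) * \<bar>\<psi> l k x\<bar>)"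
      unfolding u_def using C(2)[of "(l, _)" l]
      by (intro order.trans[OF sum_abs] sum_mono) (auto simp: abs_mult idx_def intro!: mult_right_mono)
    also have "\<dots> = C * 2 powr (- (real l * (a + 1 / 2))) * (\<Sum>k<2^l. \<bar>\<psi> l k x\<bar>)"
      by (simp add: sum_distrib_left)
    also have "\<dots> \<le> C * 2 powr (- (real l * (a + 1 / 2))) * (Cw * 2 powr (real l / 2))"
      using C by (intro mult_left_mono psi_sum_bound x) auto
    also have "\<dots> = ?C * (2 powr (- (real l * (a + 1 / 2))) * 2 powr (real l / 2))" by simp
    also have "2 powr (- (real l * (a + 1 / 2))) * 2 powr (real l / 2) = 2 powr (- (real l * a))"
      by (simp add: powr_add[symmetric] algebra_simps)
    finally show ?thesis .
  qed
  have diff: "\<bar>q (Suc N) x - q (Suc L) x\<bar> \<le> ?C * 2 powr (- (real L * a))" if x: "x \<in> {0..1}" and "L \<le> N" for x L N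
  proof -
    have "{..<Suc N} = {..<Suc L} \<union> {L<..N}" using that by auto
    then have "q (Suc N) x = (\<Sum>l\<in>{..<Suc L} \<union> {L<..N}. u l x)" unfolding q_def by metis
    also have "\<dots> = q (Suc L) x + (\<Sum>l\<in>{L<..N}. u l x)"
      unfolding q_def by (rule sum.union_disjoint) auto
    finally have "\<bar>q (Suc N) x - q (Suc L) x\<bar> = \<bar>\<Sum>l\<in>{L<..N}. u l x\<bar>" by simp
    also have "\<dots> \<le> (\<Sum>l\<in>{L<..N}. ?C * 2 powr (- (real l * a)))"
      by (intro order.trans[OF sum_abs] sum_mono u x)
    also have "\<dots> \<le> ?C * 2 powr (- (real L * a))"
      unfolding sum_distrib_left[symmetric] using C0 a that by (intro mult_left_mono sum_powr_tail)
    finally show ?thesis .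
  qed
  define G where "G x = (\<Sum>l. u l x)" for x
  have ul: "uniform_limit {0..1} q G sequentially"
    unfolding q_def G_def
  proof (rule Weierstrass_m_test[where M = "\<lambda>l. ?C * (1 / 2) ^ l"])
    fix l :: nat and x :: real assume x: "x \<in> {0..1}"
    have "2 powr (- (real l * a)) \<le> 2 powr (- real l)"
      using a mult_left_mono[of 1 a "real l"] by (intro powr_mono) auto
    also have "\<dots> = (1 / 2) ^ l" by (simp add: powr_minus powr_realpow power_divide field_simps)
    finally have "?C * 2 powr (- (real l * a)) \<le> ?C * (1 / 2) ^ l" using C0 by (intro mult_left_mono)
    then show "norm (u l x) \<le> ?C * (1 / 2) ^ l" using u[OF x, of l] by simp
  qed (auto intro!: summable_mult summable_geometric)
  have cu: "cont01 (u l)" for l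
    unfolding u_def by (intro continuous_intros cont_psi) auto
  have cq: "cont01 (q n)" for n unfolding q_def by (intro continuous_intros cu)
  have cG: "cont01 G"
    by (rule uniform_limit_theorem[OF _ ul]) (auto simp: cq)
  have "int01 (\<lambda>x. (g x - G x) * \<psi> l k x) = 0" if k: "k < 2 ^ l" for l k
  proof -
    let ?i = "(l, k)"
    have i: "?i \<in> idx n" if "l \<le> n" for n using that k unfolding idx_def by auto
    have cW: "cont01 (W ?i)" using k by (simp add: cont_psi)
    have est: "\<bar>cf g ?i - cf G ?i\<bar> \<le> e * int01 (\<lambda>x. \<bar>W ?i x\<bar>)" if e: "0 < e" for e
    proof -
      obtain N where N: "\<And>n x. N \<le> n \<Longrightarrow> x \<in> {0..1} \<Longrightarrow> dist (q n x) (G x) < e"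
        using uniform_limitD[OF ul e] unfolding eventually_sequentially by blast
      let ?n = "max N l"
      have "cf (q (Suc ?n)) ?i = cf g ?i"
        unfolding q_Suc by (rule cf_span[OF i]) simp
      then have "cf g ?i - cf G ?i = cf (\<lambda>x. q (Suc ?n) x - G x) ?i"
        using cf_diff[OF i[of l] cq cG] by simp
      also have "\<bar>\<dots>\<bar> \<le> int01 (\<lambda>x. e * \<bar>W ?i x\<bar>)"
        unfolding cf_def
      proof (rule int01_abs_le)
        fix x :: real assume x: "x \<in> {0..1}"
        have "\<bar>q (Suc ?n) x - G x\<bar> \<le> e" using N[of "Suc ?n" x] x by (simp add: dist_real_def le_SucI)
        then show "\<bar>(q (Suc ?n) x - G x) * W ?i x\<bar> \<le> e * \<bar>W ?i x\<bar>"
          by (simp add: abs_mult mult_right_mono)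
      next
        show "cont01 (\<lambda>x. (q (Suc ?n) x - G x) * W ?i x)"
          by (rule continuous_on_mult[OF continuous_on_diff[OF cq cG] cW])
        show "cont01 (\<lambda>x. e * \<bar>W ?i x\<bar>)"
          by (rule continuous_on_mult[OF continuous_on_const continuous_on_rabs[OF cW]])
      qed
      finally show ?thesis by (simp add: int01_cmult)
    qed
    have "\<bar>cf g ?i - cf G ?i\<bar> \<le> 0"
    proof (rule field_le_epsilon)
      fix e :: real assume e: "0 < e"
      let ?A = "int01 (\<lambda>x. \<bar>W ?i x\<bar>)"
      have A: "0 \<le> ?A" by (rule int01_nonneg) simp
      have "e / (?A + 1) * ?A \<le> e" using e A by (simp add: field_simps)
      then show "\<bar>cf g ?i - cf G ?i\<bar> \<le> 0 + e" using est[of "e / (?A + 1)"] e A by simp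
    qed
    then have "cf (\<lambda>x. g x - G x) ?i = 0" using cf_diff[OF i[of l] gc cG] by simp
    then show ?thesis by (simp add: cf_def)
  qed
  then have gG: "g x = G x" if "x \<in> {0..1}" for x
    using complete[of "\<lambda>x. g x - G x" x] that gc cG by (auto intro!: continuous_on_diff)
  have "\<bar>g x - (\<Sum>i\<in>idx L. cf g i * W i x)\<bar> \<le> ?C * 2 powr (- (real L * a))" if x: "x \<in> {0..1}" for L x
  proof -
    have "(\<lambda>n. q n x) \<longlonglongrightarrow> g x"
      using tendsto_uniform_limitI[OF ul x] gG[OF x] by simp
    then have "(\<lambda>n. q (Suc n) x) \<longlonglongrightarrow> g x" by (rule LIMSEQ_Suc)
    then have "(\<lambda>n. \<bar>q (Suc n) x - q (Suc L) x\<bar>) \<longlonglongrightarrow> \<bar>g x - q (Suc L) x\<bar>"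
      by (intro tendsto_intros)
    then have "\<bar>g x - q (Suc L) x\<bar> \<le> ?C * 2 powr (- (real L * a))"
      by (rule LIMSEQ_le_const2) (use diff[OF x] in blast)
    then show ?thesis unfolding q_Suc .
  qed
  then show ?thesis using that C0 by blast
qed

end

section \<open>Stability of exponential densities\<close>

lemma exp_minus_one_mult_nonneg: "0 \<le> (exp x - 1) * (x::real)"
  by (cases "0 \<le> x") (auto intro: mult_nonneg_nonneg mult_nonpos_nonpos)

text \<open>For negative \<open>x = - y\<close>, the quadratic Taylor lower bound of
  \<open>exp y\<close> is inverted: its product with \<open>1 - y + y\<^sup>2\<close> is at least
  1.\<close>

lemma exp_le_quadratic:
  fixes x :: real assumes "\<bar>x\<bar> \<le> 1" shows "exp x \<le> 1 + x + x\<^sup>2"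
proof (cases "0 \<le> x")
  case True
  then show ?thesis using assms by (intro exp_bound) auto
next
  case False
  define y where "y = - x"
  have y: "0 \<le> y" using False unfolding y_def by simp
  have p: "0 < 1 + y + y\<^sup>2 / 2" using y by (simp add: add_pos_nonneg)
  have "1 + y + y\<^sup>2 / 2 \<le> exp y" using exp_lower_Taylor_quadratic[OF y] .
  then have "exp x * (1 + y + y\<^sup>2 / 2) \<le> exp x * exp y" by (intro mult_left_mono) auto
  also have "\<dots> = 1" unfolding y_def by (simp add: exp_minus)
  also have "1 \<le> 1 + y\<^sup>2 / 2 + y ^ 3 / 2 + y ^ 4 / 2" using y by simp
  also have "\<dots> = (1 - y + y\<^sup>2) * (1 + y + y\<^sup>2 / 2)"
    by (simp add: power2_eq_square power3_eq_cube power4_eq_xxxx field_simps)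
  finally have "exp x \<le> 1 - y + y\<^sup>2" using p by simp
  then show ?thesis unfolding y_def by simp
qed

lemma abs_exp_minus_one_le:
  fixes x :: real assumes "\<bar>x\<bar> \<le> 1" shows "\<bar>exp x - 1\<bar> \<le> 2 * \<bar>x\<bar>"
proof -
  have "\<bar>x\<bar> * \<bar>x\<bar> \<le> 1 * \<bar>x\<bar>" using assms by (intro mult_right_mono) auto
  then have "x\<^sup>2 \<le> \<bar>x\<bar>" by (simp add: power2_eq_square)
  then show ?thesis using exp_le_quadratic[OF assms] exp_ge_add_one_self[of x] by linarith
qed

text \<open>Quantitative monotonicity of the exponential. The constant deteriorates only like
  \<open>1 / (1 + B)\<close>, and this mild dependence is what \<open>sup_le_one\<close>
  exploits.\<close>

lemma exp_minus_one_mult_ge: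
  fixes x :: real assumes "\<bar>x\<bar> \<le> B" shows "x\<^sup>2 / (1 + B) \<le> (exp x - 1) * x"
proof (cases "0 \<le> x")
  case True
  have "x\<^sup>2 / (1 + B) \<le> x\<^sup>2" using assms by (simp add: field_simps mult_nonneg_nonneg)
  also have "\<dots> \<le> (exp x - 1) * x"
    using True exp_ge_add_one_self[of x] unfolding power2_eq_square
    by (intro mult_right_mono; linarith)
  finally show ?thesis .
next
  case False
  define y where "y = - x"
  have y: "0 < y" "y \<le> B" using False assms unfolding y_def by auto
  have "exp x \<le> 1 / (1 + y)"
    using exp_ge_add_one_self[of y] y unfolding y_def by (simp add: exp_minus field_simps)
  then have "y / (1 + y) \<le> 1 - exp x" using y by (simp add: field_simps)
  moreover have "y / (1 + B) \<le> y / (1 + y)" using y by (intro divide_left_mono) auto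
  ultimately have "y / (1 + B) * y \<le> (1 - exp x) * y" using y by (intro mult_right_mono) auto
  then show ?thesis unfolding y_def by (simp add: power2_eq_square algebra_simps)
qed

text \<open>Allows \<open>x\<close> to be replaced by its truncated wavelet expansion
  \<open>x + b\<close>. If \<open>\<bar>x\<bar>\<close> is at least
  \<open>2 * \<bar>b\<bar>\<close>, half of the main term absorbs the error; otherwise
  \<open>x\<close> is small and the linear bound on \<open>exp x - 1\<close> leaves a multiple of
  \<open>b\<^sup>2\<close>.\<close>

lemma exp_minus_one_perturb:
  fixes x b :: real assumes "\<bar>b\<bar> \<le> 1 / 2"
  shows "(exp x - 1) * x / 2 - 4 * b\<^sup>2 \<le> (exp x - 1) * (x + b)"
proof -
  have "\<bar>exp x - 1\<bar> * \<bar>b\<bar> \<le> (exp x - 1) * x / 2 + 4 * b\<^sup>2"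
  proof (cases "2 * \<bar>b\<bar> \<le> \<bar>x\<bar>")
    case True
    then have "\<bar>exp x - 1\<bar> * \<bar>b\<bar> \<le> \<bar>exp x - 1\<bar> * (\<bar>x\<bar> / 2)" by (intro mult_left_mono) auto
    also have "\<dots> = (exp x - 1) * x / 2"
      using exp_minus_one_mult_nonneg[of x] by (simp add: abs_mult[symmetric])
    finally show ?thesis by (simp add: add_increasing2)
  next
    case False
    then have "\<bar>exp x - 1\<bar> \<le> 4 * \<bar>b\<bar>" using abs_exp_minus_one_le[of x] assms by linarith
    then have "\<bar>exp x - 1\<bar> * \<bar>b\<bar> \<le> 4 * \<bar>b\<bar> * \<bar>b\<bar>" by (intro mult_right_mono) auto
    then show ?thesis using exp_minus_one_mult_nonneg[of x] by (simp add: power2_eq_square)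
  qed
  moreover have "- ((exp x - 1) * b) \<le> \<bar>exp x - 1\<bar> * \<bar>b\<bar>" by (metis abs_mult abs_ge_minus_self)
  ultimately show ?thesis by (simp add: distrib_left)
qed

section \<open>Scores with a quadratic penalty\<close>

lemma sum_mult_le_L2_set: "\<bar>\<Sum>i\<in>I. f i * g i\<bar> \<le> L2_set f I * L2_set g I"
proof -
  have "\<bar>\<Sum>i\<in>I. f i * g i\<bar> \<le> (\<Sum>i\<in>I. \<bar>f i\<bar> * \<bar>g i\<bar>)"
    by (rule order.trans[OF sum_abs]) (simp add: abs_mult)
  also have "\<dots> \<le> L2_set f I * L2_set g I" by (rule L2_set_mult_ineq)
  finally show ?thesis .
qed

lemma L2_set_cmult: "L2_set (\<lambda>i. (c::real) * f i) I = \<bar>c\<bar> * L2_set f I"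
  unfolding L2_set_def by (simp add: power_mult_distrib sum_distrib_left[symmetric] real_sqrt_mult)

lemma L2_set_le_max:
  assumes "finite I" "\<And>i. i \<in> I \<Longrightarrow> \<bar>f i\<bar> \<le> m" "0 \<le> m"
  shows "L2_set f I \<le> sqrt (real (card I)) * m"
proof -
  have "(\<Sum>i\<in>I. (f i)\<^sup>2) \<le> (\<Sum>i\<in>I. m\<^sup>2)"
    using assms by (intro sum_mono) (metis abs_ge_zero power2_abs power_mono)
  also have "\<dots> = real (card I) * m\<^sup>2" by simp
  finally show ?thesis
    using assms(3) unfolding L2_set_def by (metis real_sqrt_le_mono real_sqrt_mult real_sqrt_abs abs_of_nonneg)
qed

text \<open>Here \<open>q\<close> is the diagonal of a penalty, \<open>e\<close> a direction to which \<open>c\<close> is orthogonal, and \<open>d\<close> is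
  \<open>\<theta> - t\<close> up to a multiple of \<open>e\<close>. Replacing \<open>d\<close> by the vector \<open>w\<close> of the same class that is
  \<open>q\<close>-orthogonal to \<open>e\<close> gives the penalty a favourable sign.\<close>
lemma penalised_score_bounds:
  fixes c q \<theta> r e d t :: "'i \<Rightarrow> real"
  assumes I: "finite I" and q: "\<And>i. i \<in> I \<Longrightarrow> 0 \<le> q i"
    and c: "\<And>i. i \<in> I \<Longrightarrow> c i + q i * \<theta> i = r i"
    and ce: "(\<Sum>i\<in>I. c i * e i) = 0"
    and th: "\<And>i. i \<in> I \<Longrightarrow> \<theta> i = t i + d i + \<kappa> * e i"
    and G: "L2_set (\<lambda>i. q i * e i) I \<le> G * (\<Sum>i\<in>I. q i * (e i)\<^sup>2)" "0 \<le> G"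
    and e1: "(\<Sum>i\<in>I. (e i)\<^sup>2) = 1"
  shows "(\<Sum>i\<in>I. c i * d i) \<le> (1 + G) * L2_set d I * (L2_set (\<lambda>i. q i * t i) I + L2_set r I)"
    and "i \<in> I \<Longrightarrow> \<bar>c i\<bar> \<le> \<bar>r i\<bar> + q i * ((1 + G) * L2_set d I)
           + (1 + G) * L2_set (\<lambda>i. q i * t i) I + G * \<bar>\<Sum>i\<in>I. r i * e i\<bar>"
proof -
  define Q where "Q = (\<Sum>i\<in>I. q i * (e i)\<^sup>2)"
  \<comment> \<open>This coefficient makes \<open>w\<close> orthogonal to \<open>e\<close> with
    respect to \<open>q\<close>; it is 0 by convention if \<open>Q = 0\<close>.\<close>
  define \<tau> where "\<tau> = (\<Sum>i\<in>I. q i * e i * d i) / Q"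
  define w where "w i = d i - \<tau> * e i" for i
  let ?n = "L2_set d I" and ?p = "L2_set (\<lambda>i. q i * t i) I"
  have Q0: "0 \<le> Q" unfolding Q_def by (auto intro!: sum_nonneg mult_nonneg_nonneg q)
  have e_norm: "L2_set e I = 1" using e1 by (simp add: L2_set_def)
  have qed_le: "\<bar>\<Sum>i\<in>I. q i * e i * d i\<bar> \<le> G * Q * ?n"
    using sum_mult_le_L2_set[of "\<lambda>i. q i * e i" d I] mult_right_mono[OF G(1), of ?n]
    unfolding Q_def by (simp add: L2_set_nonneg)
  have tau: "\<bar>\<tau>\<bar> \<le> G * ?n"
  proof (cases "Q = 0")
    case True
    then show ?thesis using G by (simp add: \<tau>_def L2_set_nonneg)
  next
    case False
    then show ?thesis using qed_le Q0 unfolding \<tau>_def by (simp add: abs_divide field_simps)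
  qed
  \<comment> \<open>If \<open>Q = 0\<close>, then \<open>qed_le\<close> forces the right-hand side
    to vanish as well.\<close>
  have tQ: "\<tau> * Q = (\<Sum>i\<in>I. q i * e i * d i)"
    using qed_le unfolding \<tau>_def by (cases "Q = 0") auto
  have orth: "(\<Sum>i\<in>I. q i * e i * w i) = 0"
  proof -
    have "(\<Sum>i\<in>I. q i * e i * w i) = (\<Sum>i\<in>I. q i * e i * d i) - \<tau> * Q"
      unfolding w_def Q_def by (simp add: sum_subtractf sum_distrib_left power2_eq_square algebra_simps)
    then show ?thesis using tQ by simp
  qed
  have w_norm: "L2_set w I \<le> (1 + G) * ?n"
  proof -
    have "L2_set w I = L2_set (\<lambda>i. d i + (- \<tau>) * e i) I" unfolding w_def by simp
    also have "\<dots> \<le> ?n + L2_set (\<lambda>i. (- \<tau>) * e i) I" by (rule L2_set_triangle_ineq)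
    also have "\<dots> = ?n + \<bar>\<tau>\<bar>" unfolding L2_set_cmult e_norm by simp
    finally show ?thesis using tau by (simp add: algebra_simps)
  qed
  \<comment> \<open>Since \<open>\<kappa>\<close> is not controlled, neither is \<open>l\<close>;
    only \<open>l * Q\<close> will be bounded.\<close>
  define l where "l = \<kappa> + \<tau>"
  have cw: "c i = r i - q i * t i - q i * w i - l * (q i * e i)" if "i \<in> I" for i
    using c[OF that] th[OF that] unfolding w_def l_def by (simp add: algebra_simps)
  have "(\<Sum>i\<in>I. c i * d i) = (\<Sum>i\<in>I. c i * w i) + \<tau> * (\<Sum>i\<in>I. c i * e i)"
    unfolding w_def by (simp add: sum_distrib_left sum.distrib[symmetric] algebra_simps)
  also have "\<dots> = (\<Sum>i\<in>I. c i * w i)" using ce by simp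
  also have "\<dots> = (\<Sum>i\<in>I. r i * w i - (q i * t i) * w i - q i * (w i)\<^sup>2 - l * (q i * e i * w i))"
    by (intro sum.cong refl) (simp add: cw power2_eq_square algebra_simps)
  also have "\<dots> = (\<Sum>i\<in>I. r i * w i) - (\<Sum>i\<in>I. (q i * t i) * w i) - (\<Sum>i\<in>I. q i * (w i)\<^sup>2)
      - l * (\<Sum>i\<in>I. q i * e i * w i)"
    by (simp add: sum_subtractf sum_distrib_left)
  \<comment> \<open>The \<open>q\<close>-weighted square of \<open>w\<close> has a negative sign and
    is dropped; the uncontrolled \<open>l\<close> disappears by orthogonality.\<close>
  also have "\<dots> \<le> L2_set r I * L2_set w I + ?p * L2_set w I"
    using sum_mult_le_L2_set[of r w I] sum_mult_le_L2_set[of "\<lambda>i. q i * t i" w I] orth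
      sum_nonneg[of I "\<lambda>i. q i * (w i)\<^sup>2"] q by simp
  also have "\<dots> = (?p + L2_set r I) * L2_set w I" by (simp add: algebra_simps)
  also have "\<dots> \<le> (?p + L2_set r I) * ((1 + G) * ?n)"
    using w_norm by (intro mult_left_mono) (auto simp: L2_set_nonneg add_nonneg_nonneg)
  finally show "(\<Sum>i\<in>I. c i * d i) \<le> (1 + G) * ?n * (?p + L2_set r I)" by (simp add: mult_ac)
  have member: "\<bar>f i\<bar> \<le> L2_set f I" if "i \<in> I" for f :: "'i \<Rightarrow> real" and i
  proof -
    have "(f i)\<^sup>2 \<le> (\<Sum>i\<in>I. (f i)\<^sup>2)" using I that by (intro member_le_sum) auto
    then show ?thesis unfolding L2_set_def by (intro real_le_rsqrt) simp
  qed
  \<comment> \<open>Testing with \<open>e\<close> itself removes \<open>w\<close> and isolates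
    \<open>l * Q\<close>.\<close>
  have "(\<Sum>i\<in>I. c i * e i)
      = (\<Sum>i\<in>I. r i * e i - (q i * t i) * e i - q i * e i * w i - l * (q i * (e i)\<^sup>2))"
    by (intro sum.cong refl) (simp add: cw power2_eq_square algebra_simps)
  also have "\<dots> = (\<Sum>i\<in>I. r i * e i) - (\<Sum>i\<in>I. (q i * t i) * e i) - l * Q"
    unfolding Q_def using orth by (simp add: sum_subtractf sum_distrib_left)
  finally have "\<bar>l * Q\<bar> \<le> \<bar>\<Sum>i\<in>I. r i * e i\<bar> + \<bar>\<Sum>i\<in>I. (q i * t i) * e i\<bar>"
    unfolding ce by linarith
  then have lQ: "\<bar>l\<bar> * Q \<le> \<bar>\<Sum>i\<in>I. r i * e i\<bar> + ?p"
    using sum_mult_le_L2_set[of "\<lambda>i. q i * t i" e I] e_norm Q0 by (simp add: abs_mult)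
  show "\<bar>c i\<bar> \<le> \<bar>r i\<bar> + q i * ((1 + G) * ?n) + (1 + G) * ?p + G * \<bar>\<Sum>i\<in>I. r i * e i\<bar>" if i: "i \<in> I"
  proof -
    \<comment> \<open>Assumption \<open>G\<close> bounds each \<open>q i * e i\<close> by a multiple
      of \<open>Q\<close>, so control of \<open>l * Q\<close> suffices.\<close>
    have "\<bar>l * (q i * e i)\<bar> \<le> \<bar>l\<bar> * (G * Q)"
      unfolding abs_mult[of l] using member[OF i, of "\<lambda>i. q i * e i"] G(1)
      by (intro mult_left_mono) (auto simp: Q_def)
    also have "\<dots> \<le> G * (\<bar>\<Sum>i\<in>I. r i * e i\<bar> + ?p)"
      using mult_left_mono[OF lQ G(2)] by (simp add: mult_ac)
    finally have 1: "\<bar>l * (q i * e i)\<bar> \<le> G * (\<bar>\<Sum>i\<in>I. r i * e i\<bar> + ?p)" .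
    have "\<bar>q i * w i\<bar> \<le> q i * ((1 + G) * ?n)"
      unfolding abs_mult using q[OF i] member[OF i, of w] w_norm by (simp add: mult_left_mono)
    moreover have "\<bar>q i * t i\<bar> \<le> ?p" using member[OF i, of "\<lambda>i. q i * t i"] by simp
    ultimately show ?thesis using 1 cw[OF i] by (simp add: distrib_left distrib_right)
  qed
qed

section \<open>The true density and the stability estimates\<close>

locale wavelet_density = wavelet_basis +
  fixes g0 :: "real \<Rightarrow> real" and \<alpha> m0 M0 K0 Cb Ct :: real
  assumes g0_cont: "cont01 g0"
    and f0_int: "int01 (\<lambda>x. exp (g0 x)) = 1"
    and m0: "0 < m0" "m0 \<le> 1" "\<And>x. x \<in> {0..1} \<Longrightarrow> m0 \<le> exp (g0 x)"
    and M0: "\<And>x. x \<in> {0..1} \<Longrightarrow> exp (g0 x) \<le> M0"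
    and f0_Lipschitz: "0 \<le> K0"
      "\<And>x y. x \<in> {0..1} \<Longrightarrow> y \<in> {0..1} \<Longrightarrow> \<bar>exp (g0 x) - exp (g0 y)\<bar> \<le> K0 * \<bar>x - y\<bar>"
    and alpha1: "1 \<le> \<alpha>"
    and bias: "0 \<le> Cb" "\<And>L x. x \<in> {0..1} \<Longrightarrow>
      \<bar>g0 x - (\<Sum>i\<in>idx L. cf g0 i * W i x)\<bar> \<le> Cb * 2 powr (- (real L * \<alpha>))"
    and decay: "0 \<le> Ct" "\<And>i L. i \<in> idx L \<Longrightarrow> \<bar>cf g0 i\<bar> \<le> Ct * 2 powr (- (real (fst i) * (\<alpha> + 1 / 2)))"

lemma (in wavelet_basis) holder_wavelet_density:
  assumes g: "holder \<alpha> g0" and a: "1 \<le> \<alpha>" "\<alpha> \<le> S" and int: "int01 (\<lambda>x. exp (g0 x)) = 1"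
  obtains m0 M0 K0 Cb Ct where "wavelet_density \<psi> S Cw J g0 \<alpha> m0 M0 K0 Cb Ct"
proof -
  have gc: "cont01 g0" using holder_cont01[OF g] a by simp
  obtain K where K: "0 \<le> K" "\<And>x y. x \<in> {0..1} \<Longrightarrow> y \<in> {0..1} \<Longrightarrow> \<bar>g0 x - g0 y\<bar> \<le> K * \<bar>x - y\<bar>"
    using holder_Lipschitz[OF g a(1)] by metis
  obtain Cb where Cb: "0 \<le> Cb"
    "\<And>L x. x \<in> {0..1} \<Longrightarrow> \<bar>g0 x - (\<Sum>i\<in>idx L. cf g0 i * W i x)\<bar> \<le> Cb * 2 powr (- (real L * \<alpha>))"
    using bias_bound[OF g a] by metis
  obtain Ct where Ct: "0 \<le> Ct" "\<And>i L. i \<in> idx L \<Longrightarrow> \<bar>cf g0 i\<bar> \<le> Ct * 2 powr (- (real (fst i) * (\<alpha> + 1 / 2)))"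
    using cf_decay[OF g a] by metis
  have "compact (g0 ` {0..1})" using gc by (intro compact_continuous_image) auto
  then obtain B where B: "\<forall>y\<in>g0 ` {0..1}. norm y \<le> B"
    using compact_imp_bounded bounded_iff by metis
  then have Bg: "\<bar>g0 x\<bar> \<le> B" if "x \<in> {0..1}" for x using that by auto
  have B0: "0 \<le> B" using Bg[of 0] by simp
  have "\<bar>exp (g0 x) - exp (g0 y)\<bar> \<le> exp B * K * \<bar>x - y\<bar>" if "x \<in> {0..1}" "y \<in> {0..1}" for x y
  proof -
    have "norm (exp (g0 x) - exp (g0 y)) \<le> exp B * norm (g0 x - g0 y)"
      by (rule field_differentiable_bound[of "{..B}" exp exp])
         (use Bg[OF that(1)] Bg[OF that(2)] in \<open>auto intro!: DERIV_subset[OF DERIV_exp]\<close>)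
    also have "\<dots> \<le> exp B * (K * \<bar>x - y\<bar>)" using K(2)[OF that] by (intro mult_left_mono) auto
    finally show ?thesis by simp
  qed
  moreover have "exp (- B) \<le> exp (g0 x)" "exp (g0 x) \<le> exp B" if "x \<in> {0..1}" for x
    using Bg[OF that] by auto
  ultimately have "wavelet_density \<psi> S Cw J g0 \<alpha> (exp (- B)) (exp B) (exp B * K) Cb Ct"
    using gc int a K(1) Cb Ct B0
    by (auto simp: wavelet_density_def wavelet_density_axioms_def wavelet_basis_axioms)
  then show ?thesis by (rule that)
qed

context wavelet_density
begin

text \<open>For a normalised log-density \<open>g\<close>, this is up to sign the gradient of the
  expected log-likelihood of one observation in the wavelet directions.\<close>

abbreviation score :: "(real \<Rightarrow> real) \<Rightarrow> nat \<times> nat \<Rightarrow> real" where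
  "score g \<equiv> cf (\<lambda>x. exp (g x) - exp (g0 x))"

abbreviation L2dist :: "(real \<Rightarrow> real) \<Rightarrow> real" where
  "L2dist g \<equiv> sqrt (int01 (\<lambda>x. (g x - g0 x)\<^sup>2))"

abbreviation beta :: "nat \<Rightarrow> real" where
  "beta L \<equiv> Cb * 2 powr (- (real L * \<alpha>))"

lemma beta_nonneg: "0 \<le> beta L"
  using bias by simp

lemma L2dist_nonneg: "0 \<le> L2dist g"
  by (auto intro: int01_nonneg)

context
  fixes g :: "real \<Rightarrow> real" and L :: nat and cg :: "nat \<times> nat \<Rightarrow> real"
  assumes g_span: "\<And>x. x \<in> {0..1} \<Longrightarrow> g x = (\<Sum>i\<in>idx L. cg i * W i x)"
begin

abbreviation (input) dl :: "nat \<times> nat \<Rightarrow> real" where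
  "dl i \<equiv> cg i - cf g0 i"

lemma g_cont: "cont01 g"
  using cont_span[of cg L] continuous_on_cong[of "{0..1}" "{0..1}" g "\<lambda>x. \<Sum>i\<in>idx L. cg i * W i x"] g_span
  by simp

lemma cf_diff_g0: "i \<in> idx L \<Longrightarrow> cf (\<lambda>x. g x - g0 x) i = dl i"
  using cf_cong[of g "\<lambda>x. \<Sum>i\<in>idx L. cg i * W i x" i] g_span
  by (simp add: cf_diff g_cont g0_cont cf_span)

lemma L2_dl_le: "L2_set dl (idx L) \<le> L2dist g"
proof -
  have "(\<Sum>i\<in>idx L. (dl i)\<^sup>2) = (\<Sum>i\<in>idx L. (cf (\<lambda>x. g x - g0 x) i)\<^sup>2)"
    by (intro sum.cong refl) (simp add: cf_diff_g0)
  also have "\<dots> \<le> int01 (\<lambda>x. (g x - g0 x)\<^sup>2)"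
    by (intro Bessel continuous_on_diff g_cont g0_cont)
  finally show ?thesis unfolding L2_set_def by simp
qed

lemma diff_split:
  assumes "x \<in> {0..1}"
  shows "\<bar>(g x - g0 x) - (\<Sum>i\<in>idx L. dl i * W i x)\<bar> \<le> beta L"
  using bias(2)[OF assms, of L] g_span[OF assms]
  by (simp add: left_diff_distrib sum_subtractf abs_minus_commute)

lemma sup_le_L2:
  assumes "x \<in> {0..1}"
  shows "\<bar>g x - g0 x\<bar> \<le> 4 * Cw * 2 powr (real L / 2) * L2dist g + beta L"
proof -
  have "\<bar>dl i\<bar> \<le> L2dist g" if "i \<in> idx L" for i
    using cf_le[of "\<lambda>x. g x - g0 x" i L] cf_diff_g0 that g_cont g0_cont by (simp add: continuous_on_diff)
  then have "\<bar>\<Sum>i\<in>idx L. dl i * W i x\<bar> \<le> L2dist g * (4 * Cw * 2 powr (real L / 2))"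
    by (intro span_sup assms L2dist_nonneg)
  then show ?thesis using diff_split[OF assms] by (simp add: mult_ac)
qed

text \<open>The difference of the densities is tested with the projection of \<open>g - g0\<close>.
  Monotonicity of the exponential bounds the result below by the squared L2 distance up to the
  squared bias, and the assumption on the scores bounds it above linearly in that distance.\<close>

lemma L2_stage:
  assumes sc: "(\<Sum>i\<in>idx L. score g i * dl i) \<le> \<kappa> * L2_set dl (idx L)" and k: "0 \<le> \<kappa>"
    and beta: "beta L \<le> 1 / 2" and B: "\<And>x. x \<in> {0..1} \<Longrightarrow> \<bar>g x - g0 x\<bar> \<le> B"
  shows "L2dist g \<le> 2 * (1 + B) / m0 * (\<kappa> + 2 * beta L)"
proof -
  let ?D = "\<lambda>x. g x - g0 x" and ?p = "\<lambda>x. \<Sum>i\<in>idx L. dl i * W i x" and ?f0 = "\<lambda>x. exp (g0 x)"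
  let ?b = "beta L" and ?N = "L2dist g" and ?A = "2 * (1 + B) / m0"
  have B0: "0 \<le> B" using B[of 0] by auto
  have c: "cont01 ?D" by (intro continuous_on_diff g_cont g0_cont)
  have cp: "cont01 ?p" by (rule cont_span)
  have "m0 / (2 * (1 + B)) * int01 (\<lambda>x. (?D x)\<^sup>2) - 4 * ?b\<^sup>2 * int01 ?f0
      = int01 (\<lambda>x. m0 / (2 * (1 + B)) * (?D x)\<^sup>2 - 4 * ?b\<^sup>2 * ?f0 x)"
    unfolding int01_cmult[symmetric]
    by (intro int01_diff[symmetric] continuous_on_mult continuous_on_const continuous_on_power c
        continuous_on_exp g0_cont)
  also have "\<dots> \<le> int01 (\<lambda>x. (exp (g x) - ?f0 x) * ?p x)"
  proof (rule int01_mono)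
    fix x :: real assume x: "x \<in> {0..1}"
    \<comment> \<open>The projection differs from \<open>?D\<close> by the bias of \<open>g0\<close>
      alone, because \<open>g\<close> itself lies in the span.\<close>
    define b where "b = ?p x - ?D x"
    have b: "\<bar>b\<bar> \<le> ?b" using diff_split[OF x] by (simp add: b_def abs_minus_commute)
    then have b2: "b\<^sup>2 \<le> ?b\<^sup>2" using power_mono[of "\<bar>b\<bar>" ?b 2] by simp
    have "m0 * (?D x)\<^sup>2 / (1 + B) \<le> ?f0 x * ((exp (?D x) - 1) * ?D x)"
      using mult_mono[OF m0(3)[OF x] exp_minus_one_mult_ge[OF B[OF x]]] B0 by simp
    then have "m0 * (?D x)\<^sup>2 / (1 + B) / 2 \<le> ?f0 x * ((exp (?D x) - 1) * ?D x) / 2"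
      by (rule divide_right_mono) simp
    also have "m0 * (?D x)\<^sup>2 / (1 + B) / 2 = m0 / (2 * (1 + B)) * (?D x)\<^sup>2"
      by (simp only: divide_divide_eq_left times_divide_eq_left mult.commute[of 2])
    also have "?f0 x * ((exp (?D x) - 1) * ?D x) / 2 = ?f0 x * ((exp (?D x) - 1) * ?D x / 2)"
      by (rule times_divide_eq_right[symmetric])
    finally have "m0 / (2 * (1 + B)) * (?D x)\<^sup>2 - 4 * ?b\<^sup>2 * ?f0 x
        \<le> ?f0 x * ((exp (?D x) - 1) * ?D x / 2) - 4 * ?b\<^sup>2 * ?f0 x"
      by (rule diff_right_mono)
    also have "\<dots> \<le> ?f0 x * ((exp (?D x) - 1) * ?D x / 2) - ?f0 x * (4 * b\<^sup>2)"
      using mult_left_mono[OF b2, of "4 * ?f0 x"] by (intro diff_left_mono) (simp add: mult_ac)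
    also have "\<dots> = ?f0 x * ((exp (?D x) - 1) * ?D x / 2 - 4 * b\<^sup>2)"
      by (rule right_diff_distrib[symmetric])
    also have "\<dots> \<le> ?f0 x * ((exp (?D x) - 1) * (?D x + b))"
      using b beta by (intro mult_left_mono exp_minus_one_perturb) auto
    also have "\<dots> = (exp (g x) - ?f0 x) * ?p x"
      unfolding b_def by (simp add: exp_diff right_diff_distrib left_diff_distrib)
    finally show "m0 / (2 * (1 + B)) * (?D x)\<^sup>2 - 4 * ?b\<^sup>2 * ?f0 x \<le> (exp (g x) - ?f0 x) * ?p x" .
  qed (intro continuous_intros g_cont g0_cont cp cont_W; simp)+
  also have "\<dots> = (\<Sum>i\<in>idx L. dl i * score g i)"
    by (intro int01_span continuous_intros g_cont g0_cont)
  also have "\<dots> \<le> \<kappa> * L2_set dl (idx L)" using sc by (simp add: mult.commute)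
  also have "\<dots> \<le> \<kappa> * ?N" using k by (intro mult_left_mono L2_dl_le)
  finally have "m0 / (2 * (1 + B)) * ?N\<^sup>2 \<le> \<kappa> * ?N + 4 * ?b\<^sup>2"
    using f0_int by (simp add: int01_nonneg)
  then have ineq: "?N\<^sup>2 \<le> ?A * (\<kappa> * ?N + 4 * ?b\<^sup>2)"
    using m0 B0 by (simp add: field_simps)
  have A1: "1 \<le> ?A" using m0 B0 by (simp add: field_simps)
  \<comment> \<open>If \<open>?N\<close> exceeded the claim, then
    \<open>?A * (2 * ?b) \<le> ?N\<close> and, as \<open>?A \<ge> 1\<close>, also
    \<open>2 * ?b \<le> ?N\<close>. The bias term in \<open>ineq\<close> is then at most
    \<open>?A * (2 * ?b) * ?N\<close>, a contradiction.\<close>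
  show ?thesis
  proof (rule ccontr)
    assume "\<not> ?thesis"
    then have lt: "?A * (\<kappa> + 2 * ?b) < ?N" by simp
    have t: "?A * (2 * ?b) \<le> ?N" "2 * ?b \<le> ?N"
    proof -
      have "0 \<le> ?A * \<kappa>" using A1 k by (intro mult_nonneg_nonneg) auto
      then show "?A * (2 * ?b) \<le> ?N" using lt by (simp only: distrib_left)
      moreover have "1 * (2 * ?b) \<le> ?A * (2 * ?b)" using A1 beta_nonneg by (intro mult_right_mono) auto
      ultimately show "2 * ?b \<le> ?N" by linarith
    qed
    have N0: "0 < ?N" using lt A1 k beta_nonneg by (smt (verit) mult_nonneg_nonneg)
    have "?A * (\<kappa> * ?N + 4 * ?b\<^sup>2) = ?A * \<kappa> * ?N + ?A * (2 * ?b) * (2 * ?b)"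
      by (simp add: power2_eq_square algebra_simps)
    also have "\<dots> \<le> ?A * \<kappa> * ?N + ?A * (2 * ?b) * ?N"
      using t A1 bias(1) by (intro add_left_mono mult_left_mono mult_nonneg_nonneg) auto
    also have "\<dots> = ?A * (\<kappa> + 2 * ?b) * ?N" by (simp only: distrib_left distrib_right)
    also have "\<dots> < ?N * ?N" using lt N0 by (intro mult_strict_right_mono)
    finally show False using ineq by (simp add: power2_eq_square)
  qed
qed

text \<open>A self-improving bound: the supremum bound \<open>B\<close> obtained from the L2
  distance is fed into \<open>L2_stage\<close>, whose constant is only linear in
  \<open>1 + B\<close>. By smallness \<open>B \<le> (1 + B) / 4 + 1 / 4\<close>.\<close>

lemma sup_le_one:
  assumes sc: "(\<Sum>i\<in>idx L. score g i * dl i) \<le> \<kappa> * L2_set dl (idx L)" and k: "0 \<le> \<kappa>"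
    and beta: "beta L \<le> 1 / 4"
    and small: "4 * Cw * 2 powr (real L / 2) * (2 / m0 * (\<kappa> + 2 * beta L)) \<le> 1 / 4"
    and x: "x \<in> {0..1}"
  shows "\<bar>g x - g0 x\<bar> \<le> 1"
proof -
  let ?c = "4 * Cw * 2 powr (real L / 2)"
  define B where "B = ?c * L2dist g + beta L"
  have c0: "0 \<le> ?c" using Cw1 by simp
  have B0: "0 \<le> B" unfolding B_def using mult_nonneg_nonneg[OF c0 L2dist_nonneg] beta_nonneg
    by (rule add_nonneg_nonneg)
  have Bx: "\<bar>g x - g0 x\<bar> \<le> B" if "x \<in> {0..1}" for x using sup_le_L2[OF that] unfolding B_def .
  have "L2dist g \<le> 2 * (1 + B) / m0 * (\<kappa> + 2 * beta L)"
    using L2_stage[OF sc k _ Bx] beta by simp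
  then have "?c * L2dist g \<le> ?c * (2 * (1 + B) / m0 * (\<kappa> + 2 * beta L))"
    using c0 by (rule mult_left_mono)
  also have "\<dots> = (1 + B) * (?c * (2 / m0 * (\<kappa> + 2 * beta L)))"
    by (simp only: times_divide_eq_left times_divide_eq_right mult_ac)
  also have "\<dots> \<le> (1 + B) * (1 / 4)" using small B0 by (intro mult_left_mono) auto
  finally have "B \<le> 1" using beta unfolding B_def by simp
  then show ?thesis using Bx[OF x] by simp
qed

lemma sup_stage:
  assumes D1: "\<And>x. x \<in> {0..1} \<Longrightarrow> \<bar>g x - g0 x\<bar> \<le> 1"
    and sc: "\<And>i. i \<in> idx L \<Longrightarrow> \<bar>score g i\<bar> \<le> \<gamma>" and ga: "0 \<le> \<gamma>" and x: "x \<in> {0..1}"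
  shows "\<bar>exp (g x) - exp (g0 x)\<bar> \<le> 2 * M0 * ((\<gamma> * (4 * Cw * 2 powr (real L / 2))
      + 4 * M0 * Cw\<^sup>2 * 2 ^ L * (L2dist g)\<^sup>2 + 4 * K0 * Cw\<^sup>2 * L2dist g) / m0 + beta L)"
proof -
  let ?D = "\<lambda>x. g x - g0 x" and ?f0 = "\<lambda>x. exp (g0 x)" and ?N = "L2dist g"
  let ?R = "\<lambda>y. ?f0 y * (exp (?D y) - 1 - ?D y)" and ?K = "\<lambda>y. (?f0 y - ?f0 x) * ?D y"
  let ?h = "2 powr (real L / 2)"
  have c: "cont01 ?D" by (intro continuous_on_diff g_cont g0_cont)
  have cR: "cont01 ?R" and cK: "cont01 ?K" and cS: "cont01 (\<lambda>x. exp (g x) - exp (g0 x))"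
    by (intro continuous_intros g_cont g0_cont)+
  have M0p: "0 \<le> M0" using M0[OF x] m0(3)[OF x] m0(1) by linarith
  have N2: "?N\<^sup>2 = int01 (\<lambda>x. (?D x)\<^sup>2)" by (simp add: int01_nonneg)
  \<comment> \<open>Coefficients of the pointwise identity expressing \<open>?f0 x * ?D\<close> as
    the difference of densities minus \<open>?R\<close> minus \<open>?K\<close>.\<close>
  have dec: "?f0 x * dl i = score g i - cf ?R i - cf ?K i" if i: "i \<in> idx L" for i
  proof -
    have "cf (\<lambda>y. ?f0 x * ?D y) i = cf (\<lambda>y. ((exp (g y) - exp (g0 y)) - ?R y) - ?K y) i"
      by (intro cf_cong) (simp add: exp_diff algebra_simps)
    also have "\<dots> = score g i - cf ?R i - cf ?K i"
      using i cR cK cS by (simp add: cf_diff continuous_on_diff)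
    finally show ?thesis using cf_diff_g0[OF i] by (simp add: cf_cmult)
  qed
  have cfR: "\<bar>cf ?R i\<bar> \<le> M0 * Cw * ?h * ?N\<^sup>2" if i: "i \<in> idx L" for i
  proof -
    have "\<bar>cf ?R i\<bar> \<le> int01 (\<lambda>y. (M0 * Cw * ?h) * (?D y)\<^sup>2)"
      unfolding cf_def
    proof (rule int01_abs_le)
      fix y :: real assume y: "y \<in> {0..1}"
      have "\<bar>exp (?D y) - 1 - ?D y\<bar> \<le> (?D y)\<^sup>2"
        using exp_le_quadratic[OF D1[OF y]] exp_ge_add_one_self[of "?D y"] by linarith
      then have 1: "\<bar>?R y\<bar> \<le> M0 * (?D y)\<^sup>2"
        unfolding abs_mult using M0[OF y] M0p by (intro mult_mono) auto
      have "2 powr (real (fst i) / 2) \<le> ?h" using idxD(2)[OF i] by (intro powr_mono) auto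
      then have "Cw * 2 powr (real (fst i) / 2) \<le> Cw * ?h" using Cw1 by (intro mult_left_mono) auto
      then have 2: "\<bar>W i y\<bar> \<le> Cw * ?h" using psi_bound[of "snd i" "fst i" y] idxD(1)[OF i] y by simp
      have "\<bar>?R y * W i y\<bar> \<le> (M0 * (?D y)\<^sup>2) * (Cw * ?h)"
        unfolding abs_mult[of "?R y"] using 1 2 M0p by (intro mult_mono) auto
      then show "\<bar>?R y * W i y\<bar> \<le> (M0 * Cw * ?h) * (?D y)\<^sup>2" by (simp add: mult_ac)
    qed (intro continuous_intros cR c g_cont g0_cont cont_W[OF i])+
    then show ?thesis by (simp add: int01_cmult N2)
  qed
  \<comment> \<open>The factor \<open>W i x\<close> is kept because only wavelets with
    \<open>x\<close> in their support gain \<open>2 powr (- real (fst i))\<close>.\<close>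
  have cfK: "\<bar>cf ?K i * W i x\<bar> \<le> K0 * Cw * ?N * (2 powr (- real (fst i)) * \<bar>W i x\<bar>)" if i: "i \<in> idx L" for i
  proof (cases "W i x = 0")
    case False
    let ?k = "K0 * (Cw * 2 powr (- real (fst i)))"
    have k0: "0 \<le> ?k" using f0_Lipschitz(1) Cw1 by simp
    have "\<bar>cf ?K i\<bar> \<le> int01 (\<lambda>y. ?k * (\<bar>?D y\<bar> * \<bar>W i y\<bar>))"
      unfolding cf_def
    proof (rule int01_abs_le)
      fix y :: real assume y: "y \<in> {0..1}"
      show "\<bar>?K y * W i y\<bar> \<le> ?k * (\<bar>?D y\<bar> * \<bar>W i y\<bar>)"
      proof (cases "W i y = 0")
        case Wy: False
        have "\<bar>?f0 y - ?f0 x\<bar> \<le> K0 * \<bar>y - x\<bar>" by (rule f0_Lipschitz(2)[OF y x])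
        also have "\<dots> \<le> ?k"
          using supp[OF idxD(1)[OF i] y x Wy False] f0_Lipschitz(1) by (intro mult_left_mono)
        finally have "\<bar>?f0 y - ?f0 x\<bar> * (\<bar>?D y\<bar> * \<bar>W i y\<bar>) \<le> ?k * (\<bar>?D y\<bar> * \<bar>W i y\<bar>)"
          by (intro mult_right_mono) auto
        then show ?thesis by (simp add: abs_mult mult.assoc)
      qed simp
    qed (intro continuous_intros cK c g_cont g0_cont cont_W[OF i])+
    also have "\<dots> = ?k * int01 (\<lambda>y. \<bar>?D y\<bar> * \<bar>W i y\<bar>)" by (rule int01_cmult)
    also have "\<dots> \<le> ?k * (?N * 1)"
    proof (intro mult_left_mono k0)
      have "\<bar>int01 (\<lambda>y. \<bar>?D y\<bar> * \<bar>W i y\<bar>)\<bar>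
          \<le> sqrt (int01 (\<lambda>y. \<bar>?D y\<bar>\<^sup>2)) * sqrt (int01 (\<lambda>y. \<bar>W i y\<bar>\<^sup>2))"
        by (intro int01_Cauchy_Schwarz continuous_intros c g_cont g0_cont cont_W[OF i])
      then show "int01 (\<lambda>y. \<bar>?D y\<bar> * \<bar>W i y\<bar>) \<le> ?N * 1" using cf_W_sq[OF i] by simp
    qed
    finally have "\<bar>cf ?K i\<bar> * \<bar>W i x\<bar> \<le> ?k * (?N * 1) * \<bar>W i x\<bar>" by (intro mult_right_mono) auto
    then show ?thesis by (simp add: abs_mult mult_ac)
  qed simp
  have K: "\<bar>\<Sum>i\<in>idx L. cf ?K i * W i x\<bar> \<le> 4 * K0 * Cw\<^sup>2 * ?N"
  proof -
    have k0: "0 \<le> K0 * Cw * ?N" using f0_Lipschitz(1) Cw1 L2dist_nonneg[of g] by (intro mult_nonneg_nonneg) auto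
    have "\<bar>\<Sum>i\<in>idx L. cf ?K i * W i x\<bar> \<le> (\<Sum>i\<in>idx L. K0 * Cw * ?N * (2 powr (- real (fst i)) * \<bar>W i x\<bar>))"
      by (intro order.trans[OF sum_abs] sum_mono cfK)
    also have "\<dots> = K0 * Cw * ?N * (\<Sum>l\<le>L. 2 powr (- real l) * (\<Sum>k<2^l. \<bar>\<psi> l k x\<bar>))"
      unfolding sum_distrib_left[symmetric] by (simp add: sum_idx sum_distrib_left)
    also have "\<dots> \<le> K0 * Cw * ?N * (\<Sum>l\<le>L. 2 powr (- real l) * (Cw * 2 powr (real l / 2)))"
      by (intro mult_left_mono[OF _ k0] sum_mono mult_left_mono psi_sum_bound x) auto
    also have "\<dots> = K0 * Cw * ?N * (Cw * (\<Sum>l\<le>L. 2 powr (- real l / 2)))"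
    proof -
      have "2 powr (- real l) * (Cw * 2 powr (real l / 2)) = Cw * 2 powr (- real l / 2)" for l
      proof -
        have "2 powr (- real l) * 2 powr (real l / 2) = 2 powr (- real l / 2)"
          unfolding powr_add[symmetric] by (simp add: field_simps)
        then show ?thesis by simp
      qed
      then have "(\<Sum>l\<le>L. 2 powr (- real l) * (Cw * 2 powr (real l / 2))) = Cw * (\<Sum>l\<le>L. 2 powr (- real l / 2))"
        by (simp only: sum_distrib_left)
      then show ?thesis by (simp only:)
    qed
    also have "\<dots> \<le> K0 * Cw * ?N * (Cw * 4)"
      using Cw1 by (intro mult_left_mono[OF _ k0] mult_left_mono sum_powr_neg_half) auto
    finally show ?thesis by (simp add: power2_eq_square mult_ac)
  qed
  have "\<bar>\<Sum>i\<in>idx L. cf ?R i * W i x\<bar> \<le> M0 * Cw * ?h * ?N\<^sup>2 * (4 * Cw * ?h)"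
    using M0p Cw1 by (intro span_sup cfR x mult_nonneg_nonneg) auto
  also have "\<dots> = 4 * M0 * Cw\<^sup>2 * (?h * ?h) * ?N\<^sup>2" by (simp only: power2_eq_square mult_ac)
  also have "?h * ?h = 2 ^ L" unfolding powr_add[symmetric] by (simp add: powr_realpow)
  finally have R: "\<bar>\<Sum>i\<in>idx L. cf ?R i * W i x\<bar> \<le> 4 * M0 * Cw\<^sup>2 * 2 ^ L * ?N\<^sup>2" .
  have Sc: "\<bar>\<Sum>i\<in>idx L. score g i * W i x\<bar> \<le> \<gamma> * (4 * Cw * ?h)"
    by (intro span_sup sc x ga)
  let ?p = "\<Sum>i\<in>idx L. dl i * W i x"
  let ?T = "\<gamma> * (4 * Cw * ?h) + 4 * M0 * Cw\<^sup>2 * 2 ^ L * ?N\<^sup>2 + 4 * K0 * Cw\<^sup>2 * ?N"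
  have "?f0 x * ?p = (\<Sum>i\<in>idx L. (?f0 x * dl i) * W i x)" by (simp add: sum_distrib_left mult.assoc)
  also have "\<dots> = (\<Sum>i\<in>idx L. (score g i - cf ?R i - cf ?K i) * W i x)"
    by (intro sum.cong refl) (simp only: dec)
  also have "\<dots> = (\<Sum>i\<in>idx L. score g i * W i x) - (\<Sum>i\<in>idx L. cf ?R i * W i x) - (\<Sum>i\<in>idx L. cf ?K i * W i x)"
    by (simp add: left_diff_distrib sum_subtractf)
  finally have "\<bar>?f0 x * ?p\<bar> \<le> ?T" using R K Sc by linarith
  \<comment> \<open>The lower bound on the true density undoes the multiplication by
    \<open>?f0 x\<close>.\<close>
  moreover have "m0 * \<bar>?p\<bar> \<le> \<bar>?f0 x * ?p\<bar>"
    unfolding abs_mult using m0(3)[OF x] by (intro mult_right_mono) auto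
  ultimately have "\<bar>?p\<bar> \<le> ?T / m0" using m0(1) by (simp add: field_simps)
  then have D: "\<bar>?D x\<bar> \<le> ?T / m0 + beta L" using diff_split[OF x] by linarith
  have "\<bar>exp (g x) - exp (g0 x)\<bar> = ?f0 x * \<bar>exp (?D x) - 1\<bar>"
  proof -
    have "exp (g x) - exp (g0 x) = ?f0 x * (exp (?D x) - 1)" by (simp add: exp_diff right_diff_distrib)
    then show ?thesis by (simp add: abs_mult)
  qed
  also have "\<dots> \<le> M0 * (2 * \<bar>?D x\<bar>)"
    using M0[OF x] abs_exp_minus_one_le[OF D1[OF x]] M0p by (intro mult_mono) auto
  also have "\<dots> \<le> M0 * (2 * (?T / m0 + beta L))" using D M0p by (intro mult_left_mono) auto
  finally show ?thesis by (simp add: mult_ac)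
qed

end

end

section \<open>Exponential moments under the posterior\<close>

text \<open>The parameter \<open>\<omega>\<close> unifies the two kinds of prior: it is \<open>0\<close> for a log-Lipschitz density (with
  constant \<open>K\<close>) and \<open>1\<close>, with \<open>K = 0\<close>, for the standard Gaussian density, whose log-gradient
  \<open>-x\<close> is unbounded and has to be kept as a first-order term.\<close>
locale wavelet_posterior = wavelet_density +
  fixes \<sigma> :: "nat \<Rightarrow> real" and \<phi> f0 :: "real \<Rightarrow> real" and \<omega> K :: real
  assumes sigma_pos: "\<And>l. 0 < \<sigma> l"
    and phi_meas [measurable]: "\<phi> \<in> borel_measurable lborel"
    and phi_nonneg: "\<And>x. 0 \<le> \<phi> x"
    and phi_int: "(\<integral>\<^sup>+ x. ennreal (\<phi> x) \<partial>lborel) = 1"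
    and phi_shift: "\<And>x t. \<phi> x * exp (- (\<omega> * t * x) - K * \<bar>t\<bar> - \<omega> * t\<^sup>2 / 2) \<le> \<phi> (t + x)"
    and omega_K: "0 \<le> \<omega>" "0 \<le> K"
    and f0_meas [measurable]: "f0 \<in> borel_measurable lborel"
    and f0_eq: "\<And>x. x \<in> {0..1} \<Longrightarrow> f0 x = exp (g0 x)"
begin

section \<open>Likelihood, prior and their translates\<close>

abbreviation coefM :: "nat \<Rightarrow> (nat \<times> nat \<Rightarrow> real) measure" where
  "coefM L \<equiv> PiM (idx L) (\<lambda>_. lborel)"

abbreviation T :: "nat \<Rightarrow> (nat \<times> nat \<Rightarrow> real) \<Rightarrow> real \<Rightarrow> real" where
  "T L \<equiv> wT \<psi> \<sigma> L"

abbreviation F :: "nat \<Rightarrow> (nat \<times> nat \<Rightarrow> real) \<Rightarrow> real \<Rightarrow> real" where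
  "F L a \<equiv> expdens (T L a)"

definition nrm :: "nat \<Rightarrow> (nat \<times> nat \<Rightarrow> real) \<Rightarrow> real" where
  "nrm L a = int01 (\<lambda>x. exp (T L a x))"

definition lik :: "nat \<Rightarrow> nat \<Rightarrow> (nat \<Rightarrow> real) \<Rightarrow> (nat \<times> nat \<Rightarrow> real) \<Rightarrow> real" where
  "lik L n xs a = (\<Prod>j<n. F L a (xs j))"

abbreviation spn :: "nat \<Rightarrow> (nat \<times> nat \<Rightarrow> real) \<Rightarrow> real \<Rightarrow> real" where
  "spn L z x \<equiv> \<Sum>i\<in>idx L. z i * W i x"

lemma T_eq: "T L a x = (\<Sum>i\<in>idx L. \<sigma> (fst i) * a i * W i x)"
  unfolding wT_def by (simp add: case_prod_beta)

lemma T_cont: "cont01 (T L a)"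
  unfolding T_eq by (rule cont_span)

lemma nrm_pos: "0 < nrm L a"
proof -
  have "compact (T L a ` {0..1})" by (intro compact_continuous_image T_cont) auto
  then obtain B where B: "\<forall>y\<in>T L a ` {0..1}. norm y \<le> B"
    using compact_imp_bounded bounded_iff by metis
  have "int01 (\<lambda>x. exp (- B)) \<le> int01 (\<lambda>x. exp (T L a x))"
  proof (rule int01_mono)
    fix x :: real assume "x \<in> {0..1}"
    then have "\<bar>T L a x\<bar> \<le> B" using B by auto
    then show "exp (- B) \<le> exp (T L a x)" by simp
  qed (intro continuous_intros T_cont)+
  then show ?thesis unfolding nrm_def by (simp add: less_le_trans[OF exp_gt_zero])
qed

lemma F_eq: "F L a x = exp (T L a x - ln (nrm L a))"
  unfolding expdens_def nrm_def int01_def ..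

lemma F_eq_divide: "F L a x = exp (T L a x) / nrm L a"
  unfolding F_eq using nrm_pos by (simp add: exp_diff)

lemma F_pos: "0 < F L a x"
  by (simp add: F_eq)

lemma F_cont: "cont01 (F L a)"
  unfolding F_eq by (intro continuous_intros T_cont)

lemma int01_F_mult: "int01 (\<lambda>x. h x * F L a x) = int01 (\<lambda>x. h x * exp (T L a x)) / nrm L a"
proof -
  have "int01 (\<lambda>x. h x * F L a x) = int01 (\<lambda>x. 1 / nrm L a * (h x * exp (T L a x)))"
    by (intro int01_cong) (simp add: F_eq_divide)
  then show ?thesis unfolding int01_cmult by simp
qed

lemma int01_F: "int01 (F L a) = 1"
  using int01_F_mult[of "\<lambda>_. 1" L a] nrm_pos[of L a] by (simp add: nrm_def)

lemma measurable_int01_exp_T: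
  assumes h: "cont01 h"
  shows "(\<lambda>a. int01 (\<lambda>x. h x * exp (T L a x))) \<in> borel_measurable (coefM L)"
proof -
  \<comment> \<open>Continuity is known on the unit interval only; the cut-off makes the integrand
    jointly measurable in \<open>a\<close> and \<open>x\<close>.\<close>
  let ?h = "\<lambda>x. indicator {0..1} x * h x" and ?W = "\<lambda>i x. indicator {0..1} x * W i x"
  have [measurable]: "?h \<in> borel_measurable borel"
    using borel_measurable_continuous_on_indicator[OF _ h] by simp
  have [measurable]: "?W i \<in> borel_measurable borel" if "i \<in> idx L" for i
    using borel_measurable_continuous_on_indicator[OF _ cont_W[OF that]] by simp
  have "(\<lambda>(a, x). ?h x * exp (\<Sum>i\<in>idx L. \<sigma> (fst i) * a i * ?W i x)) \<in> borel_measurable (coefM L \<Otimes>\<^sub>M lborel)"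
    by measurable
  then have "(\<lambda>a. LINT x|lborel. ?h x * exp (\<Sum>i\<in>idx L. \<sigma> (fst i) * a i * ?W i x)) \<in> borel_measurable (coefM L)"
    by (rule lborel.borel_measurable_lebesgue_integral)
  moreover have "(LINT x|lborel. ?h x * exp (\<Sum>i\<in>idx L. \<sigma> (fst i) * a i * ?W i x))
      = int01 (\<lambda>x. h x * exp (T L a x))" for a
    unfolding int01_def set_lebesgue_integral_def T_eq
    by (intro Bochner_Integration.integral_cong) (auto simp: indicator_def)
  ultimately show ?thesis by simp
qed

lemma measurable_nrm [measurable]: "nrm L \<in> borel_measurable (coefM L)"
  unfolding nrm_def[abs_def] using measurable_int01_exp_T[of "\<lambda>_. 1" L] by simp

lemma measurable_int01_F:
  "cont01 h \<Longrightarrow> (\<lambda>a. int01 (\<lambda>x. h x * F L a x)) \<in> borel_measurable (coefM L)"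
  unfolding int01_F_mult using measurable_int01_exp_T[of h L] by measurable

lemma measurable_lik [measurable]: "lik L n xs \<in> borel_measurable (coefM L)"
  unfolding lik_def[abs_def] F_eq T_eq by measurable

lemma lik_nonneg: "0 \<le> lik L n xs a"
  unfolding lik_def by (intro prod_nonneg) (simp add: F_pos less_imp_le)

text \<open>Replacing \<open>T\<close> by \<open>T - v\<close> changes the log-normaliser by at most its first two orders
  \<open>-\<integral>v f + \<integral>v\<^sup>2 f\<close>, whatever the density \<open>f\<close>.\<close>
lemma lik_shift:
  assumes v: "\<And>x. x \<in> {0..1} \<Longrightarrow> \<bar>spn L z x\<bar> \<le> 1"
    and a': "\<And>i. i \<in> idx L \<Longrightarrow> a' i = - z i / \<sigma> (fst i) + a i"
  shows "lik L n xs a * exp (real n * int01 (\<lambda>x. spn L z x * F L a x) - (\<Sum>j<n. spn L z (xs j))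
      - real n * int01 (\<lambda>x. (spn L z x)\<^sup>2 * F L a x)) \<le> lik L n xs a'"
proof -
  let ?v = "spn L z" and ?f = "F L a"
  let ?m = "int01 (\<lambda>x. ?v x * ?f x)" and ?s = "int01 (\<lambda>x. (?v x)\<^sup>2 * ?f x)"
  have cv: "cont01 ?v" by (rule cont_span)
  have T': "T L a' x = T L a x - ?v x" for x
    unfolding T_eq sum_subtractf[symmetric]
    by (intro sum.cong refl) (use sigma_pos in \<open>simp add: a' algebra_simps less_imp_neq[symmetric]\<close>)
  \<comment> \<open>Relative to \<open>nrm L a\<close>, the new normaliser is the mean of
    \<open>exp (- ?v x)\<close> under the density \<open>?f\<close>.\<close>
  have nrm_a': "nrm L a' = int01 (\<lambda>x. nrm L a * (exp (- ?v x) * ?f x))"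
    unfolding nrm_def[of L a'] using nrm_pos[of L a]
    by (intro int01_cong) (simp add: T' F_eq_divide exp_diff exp_minus field_simps)
  have "int01 (\<lambda>x. exp (- ?v x) * ?f x) \<le> int01 (\<lambda>x. ?f x - ?v x * ?f x + (?v x)\<^sup>2 * ?f x)"
  proof (rule int01_mono)
    fix x :: real assume x: "x \<in> {0..1}"
    have "exp (- ?v x) * ?f x \<le> (1 + - ?v x + (- ?v x)\<^sup>2) * ?f x"
      using v[OF x] F_pos[of L a x] by (intro mult_right_mono exp_le_quadratic) auto
    then show "exp (- ?v x) * ?f x \<le> ?f x - ?v x * ?f x + (?v x)\<^sup>2 * ?f x"
      by (simp add: algebra_simps)
  qed (intro continuous_on_add continuous_on_diff continuous_on_mult continuous_on_exp
        continuous_on_minus continuous_on_power cv F_cont)+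
  also have "int01 (\<lambda>x. ?f x - ?v x * ?f x + (?v x)\<^sup>2 * ?f x) = 1 - ?m + ?s"
    by (subst int01_add int01_diff; (intro continuous_on_diff continuous_on_mult continuous_on_power cv F_cont)?)+
       (simp add: int01_F)
  also have "\<dots> \<le> exp (- ?m + ?s)" using exp_ge_add_one_self[of "- ?m + ?s"] by linarith
  finally have nrm_le: "nrm L a' \<le> nrm L a * exp (- ?m + ?s)"
    unfolding nrm_a' int01_cmult using nrm_pos[of L a] by (intro mult_left_mono) auto
  have "F L a (xs j) * exp (?m - ?v (xs j) - ?s) \<le> F L a' (xs j)" for j
  proof -
    have "F L a (xs j) * exp (?m - ?v (xs j) - ?s) = exp (T L a' (xs j)) / (nrm L a * exp (- ?m + ?s))"
      unfolding F_eq_divide T' by (simp add: exp_diff exp_minus exp_add field_simps)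
    also have "\<dots> \<le> exp (T L a' (xs j)) / nrm L a'"
      using nrm_le nrm_pos[of L a'] nrm_pos[of L a] by (intro divide_left_mono) auto
    finally show ?thesis by (simp add: F_eq_divide)
  qed
  then have "(\<Prod>j<n. F L a (xs j) * exp (?m - ?v (xs j) - ?s)) \<le> lik L n xs a'"
    unfolding lik_def by (intro prod_mono) (auto simp: F_pos less_imp_le)
  moreover have "(\<Prod>j<n. exp (?m - ?v (xs j) - ?s)) = exp (real n * ?m - (\<Sum>j<n. ?v (xs j)) - real n * ?s)"
    unfolding exp_sum[symmetric, OF finite_lessThan] by (simp add: sum_subtractf)
  ultimately show ?thesis unfolding lik_def by (simp add: prod.distrib)
qed

text \<open>The part of the cost of translating the prior that does not depend on the position; the
  first-order Gaussian part, which does, is moved into \<open>dev\<close>.\<close>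

definition pen :: "nat \<Rightarrow> (nat \<times> nat \<Rightarrow> real) \<Rightarrow> real" where
  "pen L z = (\<Sum>i\<in>idx L. K * \<bar>z i\<bar> / \<sigma> (fst i) + \<omega> * (z i)\<^sup>2 / (2 * (\<sigma> (fst i))\<^sup>2))"

lemma prior_shift:
  assumes a': "\<And>i. i \<in> idx L \<Longrightarrow> a' i = - z i / \<sigma> (fst i) + a i"
  shows "(\<Prod>i\<in>idx L. \<phi> (a i)) * exp ((\<Sum>i\<in>idx L. \<omega> * z i * a i / \<sigma> (fst i)) - pen L z) \<le> (\<Prod>i\<in>idx L. \<phi> (a' i))"
proof -
  have "(\<Prod>i\<in>idx L. \<phi> (a i) * exp (\<omega> * z i * a i / \<sigma> (fst i)
      - (K * \<bar>z i\<bar> / \<sigma> (fst i) + \<omega> * (z i)\<^sup>2 / (2 * (\<sigma> (fst i))\<^sup>2)))) \<le> (\<Prod>i\<in>idx L. \<phi> (a' i))"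
  proof (intro prod_mono conjI)
    fix i assume i: "i \<in> idx L"
    show "\<phi> (a i) * exp (\<omega> * z i * a i / \<sigma> (fst i)
      - (K * \<bar>z i\<bar> / \<sigma> (fst i) + \<omega> * (z i)\<^sup>2 / (2 * (\<sigma> (fst i))\<^sup>2))) \<le> \<phi> (a' i)"
      using phi_shift[of "a i" "- z i / \<sigma> (fst i)"] sigma_pos[of "fst i"] unfolding a'[OF i]
      by (simp add: power_divide mult.commute diff_diff_eq)
  qed (simp add: phi_nonneg)
  then show ?thesis
    unfolding pen_def prod.distrib exp_sum[symmetric, OF finite_idx] by (simp add: sum_subtractf)
qed

lemma coef_prior_eq: "coef_prior \<phi> L = density (coefM L) (\<lambda>a. ennreal (\<Prod>i\<in>idx L. \<phi> (a i)))"
  unfolding coef_prior_def PiM_density_lborel[OF finite_idx phi_meas phi_int]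
  by (simp add: prod_ennreal phi_nonneg)

lemma sets_coef_prior [measurable_cong]: "sets (coef_prior \<phi> L) = sets (coefM L)"
  unfolding coef_prior_eq by simp

lemma space_coef_prior: "space (coef_prior \<phi> L) = space (coefM L)"
  unfolding coef_prior_eq by simp

text \<open>The linear functional whose exponential moment is controlled: the centred mean of the
  direction under the density, plus the first-order term of a Gaussian prior.\<close>

definition dev :: "nat \<Rightarrow> nat \<Rightarrow> (nat \<times> nat \<Rightarrow> real) \<Rightarrow> (nat \<times> nat \<Rightarrow> real) \<Rightarrow> real" where
  "dev L n z a = real n * (int01 (\<lambda>x. spn L z x * F L a x) - int01 (\<lambda>x. spn L z x * exp (g0 x)))
     + (\<Sum>i\<in>idx L. \<omega> * z i * a i / \<sigma> (fst i))"

lemma measurable_dev [measurable]: "dev L n z \<in> borel_measurable (coefM L)"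
  unfolding dev_def[abs_def] using measurable_int01_F[OF cont_span[of z L], of L] by measurable

text \<open>The empirical process in direction \<open>z\<close>. The indicator gives measurability,
  since the wavelets are arbitrary outside the unit interval.\<close>

definition emp :: "nat \<Rightarrow> nat \<Rightarrow> (nat \<times> nat \<Rightarrow> real) \<Rightarrow> (nat \<Rightarrow> real) \<Rightarrow> real" where
  "emp L n z xs = (\<Sum>j<n. indicator {0..1} (xs j) * spn L z (xs j) - int01 (\<lambda>x. spn L z x * exp (g0 x)))"

lemma emp_eq:
  assumes "\<And>j. j < n \<Longrightarrow> xs j \<in> {0..1}"
  shows "emp L n z xs = (\<Sum>j<n. spn L z (xs j)) - real n * int01 (\<lambda>x. spn L z x * exp (g0 x))"
  using assms unfolding emp_def by (simp add: sum_subtractf)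

lemma measurable_spn: "(\<lambda>x. indicator {0..1} x * spn L z x) \<in> borel_measurable borel"
  using borel_measurable_continuous_on_indicator[OF _ cont_span] by simp

lemma measurable_emp [measurable]: "emp L n z \<in> borel_measurable (sample f0 n)"
proof -
  note measurable_spn[measurable]
  show ?thesis unfolding emp_def[abs_def] sample_def by measurable
qed

text \<open>On \<open>A\<close> the integrand is dominated by prior density times likelihood at the
  translated point. That point may leave \<open>A\<close>, so the integral is extended to the whole
  space, where translation invariance returns the normalising integral of the posterior.\<close>

lemma posterior_exp_moment:
  assumes v: "\<And>x. x \<in> {0..1} \<Longrightarrow> \<bar>spn L z x\<bar> \<le> 1" and xs: "\<And>j. j < n \<Longrightarrow> xs j \<in> {0..1}"
    and A[measurable]: "A \<in> sets (coefM L)"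
    and V: "\<And>a. a \<in> A \<Longrightarrow> int01 (\<lambda>x. (spn L z x)\<^sup>2 * F L a x) \<le> V"
  shows "(\<integral>\<^sup>+a. ennreal (lik L n xs a * exp (dev L n z a)) * indicator A a \<partial>coef_prior \<phi> L)
    \<le> ennreal (exp (emp L n z xs + real n * V + pen L z)) * (\<integral>\<^sup>+a. ennreal (lik L n xs a) \<partial>coef_prior \<phi> L)"
proof -
  let ?c = "exp (emp L n z xs + real n * V + pen L z)" and ?p = "\<lambda>a. \<Prod>i\<in>idx L. \<phi> (a i)"
  let ?s = "\<lambda>a. \<lambda>i\<in>idx L. - z i / \<sigma> (fst i) + a i"
  have [measurable]: "?p \<in> borel_measurable (coefM L)" by measurable
  have p0: "0 \<le> ?p a" for a by (intro prod_nonneg) (simp add: phi_nonneg)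
  have "(\<integral>\<^sup>+a. ennreal (lik L n xs a * exp (dev L n z a)) * indicator A a \<partial>coef_prior \<phi> L)
      = (\<integral>\<^sup>+a. ennreal (?p a) * (ennreal (lik L n xs a * exp (dev L n z a)) * indicator A a) \<partial>coefM L)"
    unfolding coef_prior_eq by (rule nn_integral_density) measurable
  also have "\<dots> \<le> (\<integral>\<^sup>+a. ennreal ?c * ennreal (?p (?s a) * lik L n xs (?s a)) \<partial>coefM L)"
  proof (rule nn_integral_mono)
    fix a
    let ?m = "int01 (\<lambda>x. spn L z x * F L a x)" and ?q = "int01 (\<lambda>x. (spn L z x)\<^sup>2 * F L a x)"
    let ?S = "\<Sum>j<n. spn L z (xs j)" and ?t = "\<Sum>i\<in>idx L. \<omega> * z i * a i / \<sigma> (fst i)"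
    show "ennreal (?p a) * (ennreal (lik L n xs a * exp (dev L n z a)) * indicator A a)
        \<le> ennreal ?c * ennreal (?p (?s a) * lik L n xs (?s a))"
    proof (cases "a \<in> A")
      case True
      have "?p a * (lik L n xs a * exp (dev L n z a))
          = exp (emp L n z xs + real n * ?q + pen L z) *
            ((?p a * exp (?t - pen L z)) * (lik L n xs a * exp (real n * ?m - ?S - real n * ?q)))"
      proof -
        \<comment> \<open>\<open>dev\<close> is centred at the true mean and
          \<open>lik_shift\<close> at the empirical one; \<open>emp\<close> is the
          difference.\<close>
        have "exp (dev L n z a) = exp (emp L n z xs + real n * ?q + pen L z)
            * (exp (?t - pen L z) * exp (real n * ?m - ?S - real n * ?q))"
          unfolding exp_add[symmetric] by (simp add: dev_def emp_eq[OF xs] algebra_simps)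
        then show ?thesis by (simp only: mult_ac)
      qed
      also have "\<dots> \<le> ?c * (?p (?s a) * lik L n xs (?s a))"
      proof (intro mult_mono)
        show "exp (emp L n z xs + real n * ?q + pen L z) \<le> ?c" using V[OF True] by (simp add: mult_left_mono)
        show "?p a * exp (?t - pen L z) \<le> ?p (?s a)" by (rule prior_shift) simp
        show "lik L n xs a * exp (real n * ?m - ?S - real n * ?q) \<le> lik L n xs (?s a)"
          by (rule lik_shift[OF v]) auto
      qed (auto intro!: mult_nonneg_nonneg p0 lik_nonneg)
      finally show ?thesis using True p0 lik_nonneg by (simp add: ennreal_mult'[symmetric] ennreal_leI)
    qed simp
  qed
  also have "\<dots> = ennreal ?c * (\<integral>\<^sup>+a. ennreal (?p (?s a) * lik L n xs (?s a)) \<partial>coefM L)"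
    by (rule nn_integral_cmult) measurable
  also have "(\<integral>\<^sup>+a. ennreal (?p (?s a) * lik L n xs (?s a)) \<partial>coefM L)
      = (\<integral>\<^sup>+a. ennreal (?p a * lik L n xs a) \<partial>coefM L)"
    by (rule nn_integral_PiM_lborel_shift[of "idx L" "\<lambda>a. ennreal (?p a * lik L n xs a)"]) (simp, measurable)
  also have "\<dots> = (\<integral>\<^sup>+a. ennreal (?p a) * ennreal (lik L n xs a) \<partial>coefM L)"
    by (simp add: ennreal_mult' p0)
  also have "\<dots> = (\<integral>\<^sup>+a. ennreal (lik L n xs a) \<partial>coef_prior \<phi> L)"
    unfolding coef_prior_eq by (rule nn_integral_density[symmetric]) measurable
  finally show ?thesis .
qed

text \<open>Markov's inequality for each direction, and a union bound over \<open>Z\<close>. The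
  sets \<open>A k\<close> allow a variance bound that holds on part of the space only.\<close>

lemma post_le:
  assumes Z: "finite Z"
    and v: "\<And>k x. k \<in> Z \<Longrightarrow> x \<in> {0..1} \<Longrightarrow> \<bar>spn L (z k) x\<bar> \<le> 1"
    and xs: "\<And>j. j < n \<Longrightarrow> xs j \<in> {0..1}"
    and A: "\<And>k. k \<in> Z \<Longrightarrow> A k \<in> sets (coefM L)"
    and V: "\<And>k a. k \<in> Z \<Longrightarrow> a \<in> A k \<Longrightarrow> int01 (\<lambda>x. (spn L (z k) x)\<^sup>2 * F L a x) \<le> V k"
    and cover: "\<And>a. a \<in> space (coefM L) \<Longrightarrow> Q (F L a) \<Longrightarrow> \<exists>k\<in>Z. a \<in> A k \<and> t k \<le> dev L n (z k) a"
  shows "post \<psi> \<sigma> \<phi> L Q n xs \<le> (\<Sum>k\<in>Z. exp (emp L n (z k) xs) * exp (real n * V k + pen L (z k) - t k))"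
    (is "_ \<le> ?c")
proof -
  let ?N = "\<integral>\<^sup>+a. ennreal (lik L n xs a) * indicator {a. Q (F L a)} a \<partial>coef_prior \<phi> L"
  let ?D = "\<integral>\<^sup>+a. ennreal (lik L n xs a) \<partial>coef_prior \<phi> L"
  let ?g = "\<lambda>k a. ennreal (exp (- t k)) * (ennreal (lik L n xs a * exp (dev L n (z k) a)) * indicator (A k) a)"
  have c0: "0 \<le> ?c" by (intro sum_nonneg) auto
  have g_meas: "(\<lambda>a. ennreal (lik L n xs a * exp (dev L n (z k) a)) * indicator (A k) a)
      \<in> borel_measurable (coef_prior \<phi> L)" if "k \<in> Z" for k
  proof -
    note A[OF that, measurable]
    show ?thesis by measurable
  qed
  have "?N \<le> (\<integral>\<^sup>+a. (\<Sum>k\<in>Z. ?g k a) \<partial>coef_prior \<phi> L)"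
  proof (rule nn_integral_mono)
    fix a assume a: "a \<in> space (coef_prior \<phi> L)"
    show "ennreal (lik L n xs a) * indicator {a. Q (F L a)} a \<le> (\<Sum>k\<in>Z. ?g k a)"
    proof (cases "Q (F L a)")
      case True
      then obtain k where k: "k \<in> Z" "a \<in> A k" "t k \<le> dev L n (z k) a"
        using cover a unfolding space_coef_prior by blast
      have "lik L n xs a * 1 \<le> lik L n xs a * exp (dev L n (z k) a - t k)"
        using k lik_nonneg by (intro mult_left_mono) auto
      also have "\<dots> = exp (- t k) * (lik L n xs a * exp (dev L n (z k) a))"
        by (simp add: exp_diff exp_minus field_simps)
      finally have "ennreal (lik L n xs a) \<le> ?g k a"
        using k lik_nonneg by (simp add: ennreal_mult'[symmetric] ennreal_leI)
      also have "\<dots> \<le> (\<Sum>k\<in>Z. ?g k a)" using k Z by (intro member_le_sum) auto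
      finally show ?thesis using True by simp
    qed simp
  qed
  also have "\<dots> = (\<Sum>k\<in>Z. \<integral>\<^sup>+a. ?g k a \<partial>coef_prior \<phi> L)"
    by (intro nn_integral_sum borel_measurable_times_ennreal g_meas) auto
  also have "\<dots> = (\<Sum>k\<in>Z. ennreal (exp (- t k)) *
      (\<integral>\<^sup>+a. ennreal (lik L n xs a * exp (dev L n (z k) a)) * indicator (A k) a \<partial>coef_prior \<phi> L))"
    by (intro sum.cong refl nn_integral_cmult g_meas)
  also have "\<dots> \<le> (\<Sum>k\<in>Z. ennreal (exp (- t k)) * (ennreal (exp (emp L n (z k) xs + real n * V k + pen L (z k))) * ?D))"
    using v xs A V by (intro sum_mono mult_left_mono posterior_exp_moment) auto
  also have "\<dots> = (\<Sum>k\<in>Z. ennreal (exp (emp L n (z k) xs) * exp (real n * V k + pen L (z k) - t k)) * ?D)"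
  proof (intro sum.cong refl)
    fix k
    have "exp (- t k) * exp (emp L n (z k) xs + real n * V k + pen L (z k))
        = exp (emp L n (z k) xs) * exp (real n * V k + pen L (z k) - t k)"
      unfolding exp_add[symmetric] by (simp add: algebra_simps)
    then show "ennreal (exp (- t k)) * (ennreal (exp (emp L n (z k) xs + real n * V k + pen L (z k))) * ?D)
        = ennreal (exp (emp L n (z k) xs) * exp (real n * V k + pen L (z k) - t k)) * ?D"
      by (simp add: mult.assoc[symmetric] ennreal_mult'[symmetric])
  qed
  also have "\<dots> = ennreal ?c * ?D"
    unfolding sum_distrib_right[symmetric] by (simp add: sum_ennreal)
  finally have ND: "?N \<le> ennreal ?c * ?D" .
  have "post \<psi> \<sigma> \<phi> L Q n xs = enn2real ?N / enn2real ?D"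
    unfolding post_def Let_def lik_def by simp
  also have "\<dots> \<le> ?c"
  proof (cases "enn2real ?D = 0")
    \<comment> \<open>A normalising integral that is 0 or infinite becomes 0 under
      \<open>enn2real\<close>, and the quotient is then 0.\<close>
    case True
    then show ?thesis using c0 by simp
  next
    case False
    then have D: "?D < top" by (metis enn2real_top less_top)
    have "enn2real ?N \<le> enn2real (ennreal ?c * ?D)"
      using ND D by (intro enn2real_mono) (auto simp: ennreal_mult_less_top)
    also have "\<dots> = ?c * enn2real ?D" using c0 by (simp add: enn2real_mult)
    finally show ?thesis using False by (simp add: field_simps less_le)
  qed
  finally show ?thesis .
qed

section \<open>Expectation over the sample\<close>

abbreviation f0M :: "real measure" where
  "f0M \<equiv> density lborel (\<lambda>x. ennreal (indicator {0..1} x * f0 x))"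

lemma prob_space_f0M: "prob_space f0M"
proof -
  let ?f = "\<lambda>x. exp (g0 x)"
  have "emeasure f0M (space f0M) = (\<integral>\<^sup>+x. ennreal (indicator {0..1} x *\<^sub>R ?f x) \<partial>lborel)"
    by (subst emeasure_density) (auto simp: indicator_def f0_eq intro!: nn_integral_cong)
  also have "\<dots> = ennreal (int01 ?f)"
    by (intro nn_integral_int01 continuous_on_exp g0_cont) simp
  finally show ?thesis using f0_int by (intro prob_spaceI) simp
qed

lemma AE_sample: "AE xs in sample f0 n. \<forall>j<n. xs j \<in> {0..1}"
proof -
  have AE1: "AE x in f0M. x \<in> {0..1}"
    by (subst AE_density) (auto simp: indicator_def)
  have "AE xs in sample f0 n. xs j \<in> {0..1}" if "j \<in> {..<n}" for j
    unfolding sample_def using that by (intro AE_PiM_component AE1 prob_space_f0M)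
  then have "AE xs in sample f0 n. \<forall>j\<in>{..<n}. xs j \<in> {0..1}"
    by (subst AE_ball_countable) auto
  then show ?thesis by (simp add: Ball_def)
qed

text \<open>The same second-order bound on the exponential as in \<open>lik_shift\<close>, now for a
  single observation under the true density; independence multiplies the factors.\<close>

lemma sample_exp_moment:
  assumes v: "\<And>x. x \<in> {0..1} \<Longrightarrow> \<bar>spn L z x\<bar> \<le> 1"
  shows "(\<integral>\<^sup>+xs. ennreal (exp (emp L n z xs)) \<partial>sample f0 n)
    \<le> ennreal (exp (real n * int01 (\<lambda>x. (spn L z x)\<^sup>2 * exp (g0 x))))"
proof -
  let ?v = "spn L z" and ?f = "\<lambda>x. exp (g0 x)"
  let ?m = "int01 (\<lambda>x. ?v x * ?f x)" and ?s = "int01 (\<lambda>x. (?v x)\<^sup>2 * ?f x)"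
  let ?M = f0M
  let ?u = "\<lambda>x. indicator {0..1} x * ?v x"
  have cv: "cont01 ?v" by (rule cont_span)
  have [measurable]: "?u \<in> borel_measurable borel" by (rule measurable_spn)
  have nn: "(\<integral>\<^sup>+x. ennreal (exp (?u x - ?m)) \<partial>?M) = ennreal (int01 (\<lambda>x. exp (?v x - ?m) * ?f x))"
  proof -
    have "(\<integral>\<^sup>+x. ennreal (exp (?u x - ?m)) \<partial>?M)
        = (\<integral>\<^sup>+x. ennreal (indicator {0..1} x * f0 x) * ennreal (exp (?u x - ?m)) \<partial>lborel)"
      by (rule nn_integral_density) measurable
    also have "\<dots> = (\<integral>\<^sup>+x. ennreal (indicator {0..1} x *\<^sub>R (exp (?v x - ?m) * ?f x)) \<partial>lborel)"
      by (intro nn_integral_cong) (auto simp: indicator_def f0_eq ennreal_mult'[symmetric] mult.commute)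
    also have "\<dots> = ennreal (int01 (\<lambda>x. exp (?v x - ?m) * ?f x))"
      by (intro nn_integral_int01 continuous_on_mult continuous_on_exp continuous_on_diff
          continuous_on_const cv g0_cont) simp
    finally show ?thesis .
  qed
  have "int01 (\<lambda>x. exp (?v x - ?m) * ?f x) \<le> exp ?s"
  proof -
    have eq: "int01 (\<lambda>x. exp (?v x - ?m) * ?f x) = exp (- ?m) * int01 (\<lambda>x. exp (?v x) * ?f x)"
      unfolding int01_cmult[symmetric] by (intro int01_cong) (simp add: exp_diff exp_minus field_simps)
    have "int01 (\<lambda>x. exp (?v x) * ?f x) \<le> int01 (\<lambda>x. ?f x + ?v x * ?f x + (?v x)\<^sup>2 * ?f x)"
    proof (rule int01_mono)
      fix x :: real assume x: "x \<in> {0..1}"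
      have "exp (?v x) * ?f x \<le> (1 + ?v x + (?v x)\<^sup>2) * ?f x"
        using v[OF x] by (intro mult_right_mono exp_le_quadratic) auto
      then show "exp (?v x) * ?f x \<le> ?f x + ?v x * ?f x + (?v x)\<^sup>2 * ?f x" by (simp add: algebra_simps)
    qed (intro continuous_on_add continuous_on_mult continuous_on_exp continuous_on_power cv g0_cont)+
    also have "\<dots> = 1 + ?m + ?s"
      by (subst int01_add; (intro continuous_on_add continuous_on_mult continuous_on_exp continuous_on_power cv g0_cont)?)+
         (simp add: f0_int)
    also have "\<dots> \<le> exp (?m + ?s)" using exp_ge_add_one_self[of "?m + ?s"] by linarith
    finally have "exp (- ?m) * int01 (\<lambda>x. exp (?v x) * ?f x) \<le> exp (- ?m) * exp (?m + ?s)"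
      by (rule mult_left_mono) simp
    also have "\<dots> = exp ?s" unfolding exp_add[symmetric] by simp
    finally show ?thesis unfolding eq .
  qed
  then have one: "(\<integral>\<^sup>+x. ennreal (exp (?u x - ?m)) \<partial>?M) \<le> ennreal (exp ?s)"
    unfolding nn by (rule ennreal_leI)
  interpret M: product_sigma_finite "\<lambda>_::nat. ?M"
    using prob_space_f0M by (simp add: product_sigma_finite_def prob_space_imp_sigma_finite)
  have "(\<integral>\<^sup>+xs. ennreal (exp (emp L n z xs)) \<partial>sample f0 n)
      = (\<integral>\<^sup>+xs. (\<Prod>j<n. ennreal (exp (?u (xs j) - ?m))) \<partial>sample f0 n)"
    unfolding emp_def by (simp add: exp_sum prod_ennreal)
  also have "\<dots> = (\<Prod>j<n. \<integral>\<^sup>+x. ennreal (exp (?u x - ?m)) \<partial>?M)"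
    unfolding sample_def by (rule M.product_nn_integral_prod) (simp, measurable)
  also have "\<dots> \<le> (\<Prod>j<n. ennreal (exp ?s))" by (intro prod_mono_ennreal one)
  also have "\<dots> = ennreal (exp (real n * ?s))"
    by (simp add: ennreal_power exp_of_nat_mult)
  finally show ?thesis .
qed

text \<open>The factor 2 arises because the likelihood comparison and the empirical process
  contribute one variance term each.\<close>

lemma integral_post_le:
  assumes Z: "finite Z"
    and v: "\<And>k x. k \<in> Z \<Longrightarrow> x \<in> {0..1} \<Longrightarrow> \<bar>spn L (z k) x\<bar> \<le> 1"
    and A: "\<And>k. k \<in> Z \<Longrightarrow> A k \<in> sets (coefM L)"
    and V: "\<And>k a. k \<in> Z \<Longrightarrow> a \<in> A k \<Longrightarrow> int01 (\<lambda>x. (spn L (z k) x)\<^sup>2 * F L a x) \<le> V k"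
    and V0: "\<And>k. k \<in> Z \<Longrightarrow> int01 (\<lambda>x. (spn L (z k) x)\<^sup>2 * exp (g0 x)) \<le> V k"
    and cover: "\<And>a. a \<in> space (coefM L) \<Longrightarrow> Q (F L a) \<Longrightarrow> \<exists>k\<in>Z. a \<in> A k \<and> t k \<le> dev L n (z k) a"
  shows "(\<integral>xs. post \<psi> \<sigma> \<phi> L Q n xs \<partial>sample f0 n)
    \<le> (\<Sum>k\<in>Z. exp (2 * real n * V k + pen L (z k) - t k))"
proof (rule integral_real_bounded)
  \<comment> \<open>A function that is not integrable has Bochner integral 0, so a bound on the
    nonnegative integral covers every case.\<close>
  let ?b = "\<lambda>k. exp (real n * V k + pen L (z k) - t k)"
  have "(\<integral>\<^sup>+xs. ennreal (post \<psi> \<sigma> \<phi> L Q n xs) \<partial>sample f0 n)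
      \<le> (\<integral>\<^sup>+xs. (\<Sum>k\<in>Z. ennreal (exp (emp L n (z k) xs)) * ennreal (?b k)) \<partial>sample f0 n)"
  proof (rule nn_integral_mono_AE, rule AE_mp[OF AE_sample], rule AE_I2, rule impI)
    fix xs :: "nat \<Rightarrow> real" assume xs: "\<forall>j<n. xs j \<in> {0..1}"
    have "post \<psi> \<sigma> \<phi> L Q n xs \<le> (\<Sum>k\<in>Z. exp (emp L n (z k) xs) * ?b k)"
      using xs by (intro post_le[OF Z v _ A V cover]) auto
    then show "ennreal (post \<psi> \<sigma> \<phi> L Q n xs) \<le> (\<Sum>k\<in>Z. ennreal (exp (emp L n (z k) xs)) * ennreal (?b k))"
      by (simp add: ennreal_mult'[symmetric] sum_ennreal ennreal_leI)
  qed
  also have "\<dots> = (\<Sum>k\<in>Z. \<integral>\<^sup>+xs. ennreal (exp (emp L n (z k) xs)) * ennreal (?b k) \<partial>sample f0 n)"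
    by (intro nn_integral_sum) measurable
  also have "\<dots> = (\<Sum>k\<in>Z. (\<integral>\<^sup>+xs. ennreal (exp (emp L n (z k) xs)) \<partial>sample f0 n) * ennreal (?b k))"
    by (intro sum.cong refl nn_integral_multc) measurable
  also have "\<dots> \<le> (\<Sum>k\<in>Z. ennreal (exp (real n * V k)) * ennreal (?b k))"
  proof (intro sum_mono mult_right_mono)
    fix k assume k: "k \<in> Z"
    have "(\<integral>\<^sup>+xs. ennreal (exp (emp L n (z k) xs)) \<partial>sample f0 n)
        \<le> ennreal (exp (real n * int01 (\<lambda>x. (spn L (z k) x)\<^sup>2 * exp (g0 x))))"
      using v[OF k] by (rule sample_exp_moment)
    also have "\<dots> \<le> ennreal (exp (real n * V k))"
      using V0[OF k] by (intro ennreal_leI) (simp add: mult_left_mono)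
    finally show "(\<integral>\<^sup>+xs. ennreal (exp (emp L n (z k) xs)) \<partial>sample f0 n) \<le> ennreal (exp (real n * V k))" .
  qed simp
  also have "\<dots> = (\<Sum>k\<in>Z. ennreal (exp (2 * real n * V k + pen L (z k) - t k)))"
    by (intro sum.cong refl) (simp add: ennreal_mult'[symmetric] exp_add[symmetric])
  also have "\<dots> = ennreal (\<Sum>k\<in>Z. exp (2 * real n * V k + pen L (z k) - t k))"
    by (rule sum_ennreal) simp
  finally show "(\<integral>\<^sup>+xs. ennreal (post \<psi> \<sigma> \<phi> L Q n xs) \<partial>sample f0 n)
      \<le> ennreal (\<Sum>k\<in>Z. exp (2 * real n * V k + pen L (z k) - t k))" .
qed (intro sum_nonneg; simp)

end

section \<open>Contraction in supremum norm\<close>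

text \<open>The factors \<open>K\<close> and \<open>\<omega>\<close> are kept on both sides so that
  the condition for the other prior becomes \<open>0 \<le> 0\<close>. In the Gaussian case the
  exponent \<open>2 * \<alpha> + 1 / 2\<close> encodes
  \<open>r \<le> \<alpha> - 1 / 4\<close>.\<close>

locale wavelet_posterior_scales = wavelet_posterior +
  assumes omega_le: "\<omega> \<le> 1"
    and sigma_K: "\<And>l. K / \<sigma> l \<le> K * 2 powr (real l * (\<alpha> + 1 / 2))"
    and sigma_omega: "\<And>l. \<omega> / (\<sigma> l)\<^sup>2 \<le> \<omega> * 2 powr (real l * (2 * \<alpha> + 1 / 2))"
    and sigma_omega_ge: "\<And>l. \<omega> \<le> \<omega> / (\<sigma> l)\<^sup>2"
begin

text \<open>Up to centring by the empirical measure, \<open>rr\<close> is minus the gradient of the log-posterior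
  divided by \<open>n\<close>: the score is complemented by the gradient of the Gaussian prior.\<close>
definition rr :: "nat \<Rightarrow> nat \<Rightarrow> (nat \<times> nat \<Rightarrow> real) \<Rightarrow> nat \<times> nat \<Rightarrow> real" where
  "rr L n a i = cf (\<lambda>x. F L a x - exp (g0 x)) i + \<omega> * a i / (\<sigma> (fst i) * real n)"

lemma dev_eq:
  assumes "0 < n" shows "dev L n z a = real n * (\<Sum>i\<in>idx L. z i * rr L n a i)"
proof -
  have c: "cont01 (\<lambda>x. F L a x - exp (g0 x))"
    by (intro continuous_on_diff continuous_on_exp F_cont g0_cont)
  have "int01 (\<lambda>x. spn L z x * F L a x) - int01 (\<lambda>x. spn L z x * exp (g0 x))
      = int01 (\<lambda>x. spn L z x * F L a x - spn L z x * exp (g0 x))"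
    by (intro int01_diff[symmetric] continuous_on_mult continuous_on_exp F_cont g0_cont cont_span)
  also have "\<dots> = int01 (\<lambda>x. (F L a x - exp (g0 x)) * spn L z x)"
    by (intro int01_cong) (simp add: left_diff_distrib mult.commute)
  also have "\<dots> = (\<Sum>i\<in>idx L. z i * cf (\<lambda>x. F L a x - exp (g0 x)) i)"
    by (rule int01_span[OF c])
  finally have "dev L n z a = real n * (\<Sum>i\<in>idx L. z i * cf (\<lambda>x. F L a x - exp (g0 x)) i)
      + (\<Sum>i\<in>idx L. \<omega> * z i * a i / \<sigma> (fst i))"
    unfolding dev_def by simp
  also have "\<dots> = (\<Sum>i\<in>idx L. real n * (z i * rr L n a i))"
    unfolding sum_distrib_left sum.distrib[symmetric]
    using assms sigma_pos by (intro sum.cong refl) (simp add: rr_def field_simps less_imp_neq[symmetric])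
  finally show ?thesis by (simp add: sum_distrib_left)
qed

lemma measurable_rr [measurable]:
  assumes "i \<in> idx L" shows "(\<lambda>a. rr L n a i) \<in> borel_measurable (coefM L)"
proof -
  have "cf (\<lambda>x. F L a x - exp (g0 x)) i = int01 (\<lambda>x. W i x * F L a x) - cf (\<lambda>x. exp (g0 x)) i" for a
    using assms by (subst cf_diff) (auto intro!: F_cont continuous_on_exp g0_cont simp: cf_def mult.commute)
  moreover have "(\<lambda>a. int01 (\<lambda>x. W i x * F L a x)) \<in> borel_measurable (coefM L)"
    using assms by (intro measurable_int01_F cont_W)
  ultimately show ?thesis using assms unfolding rr_def by simp
qed

text \<open>Serves as \<open>G\<close> in \<open>penalised_score_bounds\<close>: how far the prior
  precision can grow over the levels below \<open>J\<close>, which carry the constants.\<close>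

definition Gc :: real where "Gc = 2 powr (real J * (2 * \<alpha> + 1 / 2))"
text \<open>Threshold for the sign patterns: \<open>32 * Cw\<^sup>2\<close> covers two variance
  terms, \<open>2 * (K + 1)\<close> the penalty, and the remaining 3 the number of patterns together
  with a margin.\<close>

definition M1 :: real where "M1 = 32 * Cw\<^sup>2 + 2 * K + 5"
text \<open>Threshold for single wavelets: the first summand covers two variance terms and the
  second leaves a factor \<open>1 / n\<^sup>2\<close> for each test.\<close>

definition M2 :: real where "M2 = 2 * exp 1 * M0 + 2"
text \<open>The L2 constant from \<open>L2_stage\<close> with \<open>B = 1\<close>.\<close>

definition CN :: real where "CN = 4 / m0 * ((1 + Gc) * (2 * Ct + 2 * M2) + 2 * Cb)"
text \<open>Collects the four terms of the coefficientwise bound in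
  \<open>penalised_score_bounds\<close>.\<close>

definition Cg :: real where
  "Cg = M2 + (1 + Gc) * CN + (1 + Gc) * (2 * Ct) + Gc * (real (card (idx J)) * M2)"
definition Cfin :: real where
  "Cfin = 2 * M0 * ((4 * Cw * Cg + 4 * M0 * Cw\<^sup>2 * CN\<^sup>2 + 4 * K0 * Cw\<^sup>2 * CN) / m0 + Cb)"
text \<open>The reciprocal of a sum of nonnegative terms, so that all smallness requirements in
  \<open>eta_bounds\<close> hold simultaneously.\<close>

definition eta :: real where
  "eta = 1 / (4 * Cw + 4 * Cb + 32 * Cw / m0 * ((1 + Gc) * (2 * Ct + M1) + 2 * Cb))"

lemma Gc0: "0 \<le> Gc" unfolding Gc_def by simp

lemma M0_nonneg: "0 \<le> M0"
  using M0[of 0] exp_gt_zero[of "g0 0"] by (metis atLeastAtMost_iff less_eq_real_def order.trans zero_le_one)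

lemma M1_pos: "0 \<le> M1" and M2_pos: "0 \<le> M2"
  unfolding M1_def M2_def using omega_K M0_nonneg by auto

lemma eta_bounds:
  "0 < eta" "4 * Cw * eta \<le> 1" "Cb * eta \<le> 1 / 4"
  "4 * Cw * (2 / m0 * ((1 + Gc) * (2 * Ct + M1) * eta + 2 * (Cb * eta))) \<le> 1 / 4"
proof -
  define X where "X = 32 * Cw / m0 * ((1 + Gc) * (2 * Ct + M1) + 2 * Cb)"
  have X: "0 \<le> X" unfolding X_def using Cw1 m0 Gc0 decay(1) M1_pos bias(1)
    by (intro mult_nonneg_nonneg add_nonneg_nonneg divide_nonneg_nonneg) auto
  have pos: "0 < 4 * Cw + 4 * Cb + X" using Cw1 bias(1) X by linarith
  have e: "eta = 1 / (4 * Cw + 4 * Cb + X)" unfolding eta_def X_def ..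
  show "0 < eta" unfolding e using pos by simp
  show "4 * Cw * eta \<le> 1" "Cb * eta \<le> 1 / 4"
    unfolding e using pos X Cw1 bias(1) by (simp_all add: field_simps)
  have "X * eta \<le> 1" unfolding e using pos Cw1 bias(1) by (simp add: field_simps)
  moreover have "4 * Cw * (2 / m0 * ((1 + Gc) * (2 * Ct + M1) * eta + 2 * (Cb * eta))) = X * eta / 4"
    unfolding X_def using m0(1) by (simp add: field_simps)
  ultimately show "4 * Cw * (2 / m0 * ((1 + Gc) * (2 * Ct + M1) * eta + 2 * (Cb * eta))) \<le> 1 / 4"
    by linarith
qed

section \<open>Fixed sample size and resolution level\<close>

context
  fixes n L :: nat
  assumes n1: "1 \<le> ln (real n)" and JL: "J \<le> L"
    and nL: "2 powr (real L * (2 * \<alpha> + 1)) * ln (real n) \<le> real n"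
    and sm1: "2 powr (3 * real L / 2) / sqrt (real n) \<le> eta"
    and sm2: "2 powr (- real L / 2) \<le> eta"
begin

text \<open>Next to the noise level \<open>\<delta>\<close> of one coefficient, \<open>eps\<close>
  is the order of the bias at level \<open>L\<close> and \<open>hh\<close> the height of the finest
  wavelets.\<close>

abbreviation (input) \<delta> :: real where "\<delta> \<equiv> sqrt (ln (real n) / real n)"
abbreviation (input) eps :: real where "eps \<equiv> 2 powr (- (real L * \<alpha>))"
abbreviation (input) hh :: real where "hh \<equiv> 2 powr (real L / 2)"

lemma n_pos: "0 < n" using n1 by (cases n) auto

lemma n_ge: "2 powr (real L * (2 * \<alpha> + 1)) \<le> real n"
proof -
  have "2 powr (real L * (2 * \<alpha> + 1)) * 1 \<le> 2 powr (real L * (2 * \<alpha> + 1)) * ln (real n)"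
    using n1 by (intro mult_left_mono) auto
  then show ?thesis using nL by linarith
qed

lemma sqrt_n_ge: "2 powr (real L * (\<alpha> + 1 / 2)) \<le> sqrt (real n)"
proof (rule real_le_rsqrt)
  have "(2 powr (real L * (\<alpha> + 1 / 2)))\<^sup>2 = 2 powr (real L * (2 * \<alpha> + 1))"
    unfolding power2_eq_square powr_add[symmetric] by (simp add: algebra_simps)
  then show "(2 powr (real L * (\<alpha> + 1 / 2)))\<^sup>2 \<le> real n" using n_ge by simp
qed

lemma delta_pos: "0 < \<delta>"
proof -
  have "0 < ln (real n)" using n1 by linarith
  then show ?thesis using n_pos by (simp add: divide_pos_pos)
qed

lemma delta_sq: "\<delta>\<^sup>2 = ln (real n) / real n" using n1 n_pos by simp

lemma n_delta_sq: "real n * \<delta>\<^sup>2 = ln (real n)" unfolding delta_sq using n_pos by simp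

lemma delta_le: "\<delta> * 2 powr (real L * (\<alpha> + 1 / 2)) \<le> 1"
proof -
  have "(\<delta> * 2 powr (real L * (\<alpha> + 1 / 2)))\<^sup>2 = ln (real n) / real n * 2 powr (real L * (2 * \<alpha> + 1))"
    unfolding power_mult_distrib delta_sq power2_eq_square[of "2 powr _"] powr_add[symmetric]
    by (simp add: algebra_simps)
  also have "\<dots> \<le> 1" using nL n_pos by (simp add: field_simps)
  finally have "(\<delta> * 2 powr (real L * (\<alpha> + 1 / 2)))\<^sup>2 \<le> 1\<^sup>2" by simp
  then show ?thesis by (rule power2_le_imp_le) simp
qed

text \<open>The balance behind the choice of the level: coefficient noise, once summed in supremum
  norm, stays below the bias.\<close>

lemma delta_hh: "\<delta> * hh \<le> eps"
proof -
  have "\<delta> * 2 powr (real L * (\<alpha> + 1 / 2)) * eps \<le> 1 * eps"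
    by (intro mult_right_mono delta_le) simp
  moreover have "2 powr (real L * (\<alpha> + 1 / 2)) * eps = hh"
    unfolding powr_add[symmetric] by (simp add: algebra_simps)
  ultimately show ?thesis by (simp add: mult.assoc)
qed

lemma hh_ge: "1 \<le> hh" by (rule ge_one_powr_ge_zero) auto

lemma hh_sq: "hh * hh = 2 ^ L"
  unfolding powr_add[symmetric] by (simp add: powr_realpow)

lemma delta_eps: "\<delta> \<le> eps"
proof -
  have "\<delta> * 1 \<le> \<delta> * hh" using delta_pos by (intro mult_left_mono hh_ge) linarith
  then show ?thesis using delta_hh by linarith
qed

lemma inv_sqrt_n: "1 / sqrt (real n) \<le> \<delta>"
  using n1 n_pos by (simp add: real_sqrt_divide divide_right_mono)

lemma eps_le: "eps \<le> 2 powr (- real L / 2)"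
proof -
  have "real L * (1/2) \<le> real L * \<alpha>" using alpha1 by (intro mult_left_mono) auto
  then show ?thesis by (intro powr_mono) auto
qed

text \<open>Makes the quadratic remainder \<open>2 ^ L * eps\<^sup>2\<close> of order
  \<open>eps\<close>; this uses \<open>\<alpha> \<ge> 1\<close>, with equality of the powers at
  \<open>\<alpha> = 1\<close>.\<close>

lemma pow_eps: "2 ^ L * eps \<le> 1"
proof -
  have "2 ^ L * eps = 2 powr (real L - real L * \<alpha>)"
    unfolding powr_realpow[symmetric, of 2 L, simplified] powr_add[symmetric] by simp
  also have "\<dots> \<le> 2 powr 0"
    using alpha1 mult_left_mono[of 1 \<alpha> "real L"] by (intro powr_mono) auto
  finally show ?thesis by simp
qed

lemma sqrt_card: "sqrt (real (card (idx L))) \<le> 2 * hh"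
proof (rule real_le_lsqrt)
  have "(2 * hh)\<^sup>2 = 4 * 2 ^ L" by (simp add: power2_eq_square hh_sq)
  then show "real (card (idx L)) \<le> (2 * hh)\<^sup>2" using card_idx[of L] by simp
qed auto

section \<open>The penalised score of a density in the support of the prior\<close>

abbreviation (input) gg :: "(nat \<times> nat \<Rightarrow> real) \<Rightarrow> real \<Rightarrow> real" where
  "gg a \<equiv> \<lambda>x. T L a x - ln (nrm L a)"

abbreviation (input) ee :: "nat \<times> nat \<Rightarrow> real" where
  "ee \<equiv> cf (\<lambda>_. 1)"

text \<open>The log-normaliser is subtracted through the coefficients \<open>ee\<close> of the
  constant function.\<close>

abbreviation (input) cg :: "(nat \<times> nat \<Rightarrow> real) \<Rightarrow> nat \<times> nat \<Rightarrow> real" where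
  "cg a \<equiv> \<lambda>i. \<sigma> (fst i) * a i - ln (nrm L a) * ee i"

text \<open>Precision of the Gaussian prior on the coefficient \<open>\<sigma> (fst i) * a i\<close>
  of \<open>T\<close>, divided by \<open>n\<close>; it is zero for a log-Lipschitz prior.\<close>

abbreviation (input) qq :: "nat \<times> nat \<Rightarrow> real" where
  "qq \<equiv> \<lambda>i. \<omega> / ((\<sigma> (fst i))\<^sup>2 * real n)"

lemma gg_span: "x \<in> {0..1} \<Longrightarrow> gg a x = (\<Sum>i\<in>idx L. cg a i * W i x)"
  using one_expansion[OF JL, of x]
  by (simp add: T_eq left_diff_distrib sum_subtractf mult.assoc sum_distrib_left[symmetric])

lemma qq_nonneg: "0 \<le> qq i" using omega_K by simp

lemma qq_le: assumes "i \<in> idx L" shows "qq i \<le> 2 powr (real L * (2 * \<alpha> + 1 / 2)) / real n"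
    "qq i \<le> 2 powr (real (fst i) * (2 * \<alpha> + 1 / 2)) / real n"
proof -
  have "\<omega> / (\<sigma> (fst i))\<^sup>2 \<le> \<omega> * 2 powr (real (fst i) * (2 * \<alpha> + 1 / 2))" by (rule sigma_omega)
  also have "\<dots> \<le> 1 * 2 powr (real (fst i) * (2 * \<alpha> + 1 / 2))"
    using omega_le by (intro mult_right_mono) auto
  finally have 1: "\<omega> / (\<sigma> (fst i))\<^sup>2 \<le> 2 powr (real (fst i) * (2 * \<alpha> + 1 / 2))" by simp
  show "qq i \<le> 2 powr (real (fst i) * (2 * \<alpha> + 1 / 2)) / real n"
    using divide_right_mono[OF 1, of "real n"] by simp
  also have "\<dots> \<le> 2 powr (real L * (2 * \<alpha> + 1 / 2)) / real n"
    using idxD(2)[OF assms] alpha1 by (intro divide_right_mono powr_mono mult_right_mono) auto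
  finally show "qq i \<le> 2 powr (real L * (2 * \<alpha> + 1 / 2)) / real n" .
qed

text \<open>The shrinkage bias of a Gaussian prior. Decay of the true coefficients reduces the
  precision to \<open>2 powr (real L * \<alpha>)\<close>; the number of coefficients contributes
  \<open>hh\<close>, and the product is at most \<open>sqrt (real n)\<close>.\<close>

lemma L2_qt: "L2_set (\<lambda>i. qq i * cf g0 i) (idx L) \<le> 2 * Ct / sqrt (real n)"
proof -
  have "\<bar>qq i * cf g0 i\<bar> \<le> Ct * 2 powr (real L * \<alpha>) / real n" if i: "i \<in> idx L" for i
  proof -
    let ?l = "real (fst i)"
    have "\<bar>qq i * cf g0 i\<bar> \<le> 2 powr (?l * (2 * \<alpha> + 1 / 2)) / real n * (Ct * 2 powr (- (?l * (\<alpha> + 1 / 2))))"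
      unfolding abs_mult abs_of_nonneg[OF qq_nonneg]
      using qq_le(2)[OF i] decay(2)[OF i] by (intro mult_mono) auto
    also have "\<dots> = Ct * (2 powr (?l * (2 * \<alpha> + 1 / 2)) * 2 powr (- (?l * (\<alpha> + 1 / 2)))) / real n" by simp
    also have "2 powr (?l * (2 * \<alpha> + 1 / 2)) * 2 powr (- (?l * (\<alpha> + 1 / 2))) = 2 powr (?l * \<alpha>)"
      unfolding powr_add[symmetric] by (simp add: algebra_simps)
    also have "Ct * 2 powr (?l * \<alpha>) / real n \<le> Ct * 2 powr (real L * \<alpha>) / real n"
      using idxD(2)[OF i] alpha1 decay(1)
      by (intro divide_right_mono mult_left_mono powr_mono mult_right_mono) auto
    finally show ?thesis .
  qed
  then have "L2_set (\<lambda>i. qq i * cf g0 i) (idx L) \<le> sqrt (real (card (idx L))) * (Ct * 2 powr (real L * \<alpha>) / real n)"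
    using decay(1) by (intro L2_set_le_max) auto
  also have "\<dots> \<le> (2 * hh) * (Ct * 2 powr (real L * \<alpha>) / real n)"
    using decay(1) by (intro mult_right_mono sqrt_card) auto
  also have "\<dots> = 2 * Ct * (hh * 2 powr (real L * \<alpha>)) / real n" by simp
  also have "hh * 2 powr (real L * \<alpha>) = 2 powr (real L * (\<alpha> + 1 / 2))"
    unfolding powr_add[symmetric] by (simp add: algebra_simps)
  also have "2 * Ct * 2 powr (real L * (\<alpha> + 1 / 2)) / real n \<le> 2 * Ct * sqrt (real n) / real n"
    using decay(1) by (intro divide_right_mono mult_left_mono sqrt_n_ge) auto
  also have "\<dots> = 2 * Ct / sqrt (real n)"
    using n_pos by (simp add: frac_eq_eq mult.assoc)
  finally show ?thesis .
qed

text \<open>The constant function has coefficients below level \<open>J\<close> only, where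
  \<open>qq\<close> is at most \<open>Gc * \<omega> / n\<close>, whereas \<open>qq\<close> is at
  least \<open>\<omega> / n\<close> everywhere.\<close>

lemma L2_qe: "L2_set (\<lambda>i. qq i * ee i) (idx L) \<le> Gc * (\<Sum>i\<in>idx L. qq i * (ee i)\<^sup>2)"
proof -
  have e1: "L2_set ee (idx L) = 1" using sum_cf_one_sq[OF JL] by (simp add: L2_set_def)
  have "L2_set (\<lambda>i. qq i * ee i) (idx L) \<le> L2_set (\<lambda>i. \<omega> * Gc / real n * \<bar>ee i\<bar>) (idx L)"
  proof -
    have "\<bar>qq i * ee i\<bar> \<le> \<omega> * Gc / real n * \<bar>ee i\<bar>" if i: "i \<in> idx L" for i
    proof (cases "ee i = 0")
      case False
      then have "fst i < J" using cf_one_high[OF _ i] by force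
      then have "2 powr (real (fst i) * (2 * \<alpha> + 1 / 2)) \<le> Gc"
        unfolding Gc_def using alpha1 by (intro powr_mono mult_right_mono) auto
      then have 1: "\<omega> / (\<sigma> (fst i))\<^sup>2 \<le> \<omega> * Gc"
        using sigma_omega[of "fst i"] omega_K(1) by (meson mult_left_mono order.trans)
      have "qq i \<le> \<omega> * Gc / real n"
        using divide_right_mono[OF 1, of "real n"] by simp
      then show ?thesis unfolding abs_mult abs_of_nonneg[OF qq_nonneg] by (intro mult_right_mono) auto
    qed simp
    then have "L2_set (\<lambda>i. \<bar>qq i * ee i\<bar>) (idx L) \<le> L2_set (\<lambda>i. \<omega> * Gc / real n * \<bar>ee i\<bar>) (idx L)"
      by (intro L2_set_mono) auto
    then show ?thesis by (simp only: L2_set_def power2_abs)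
  qed
  also have "\<dots> = Gc * (\<omega> / real n)"
    unfolding L2_set_cmult using e1 omega_K(1) Gc0 by (simp add: L2_set_def abs_mult)
  also have "\<dots> \<le> Gc * (\<Sum>i\<in>idx L. qq i * (ee i)\<^sup>2)"
  proof (intro mult_left_mono Gc0)
    have "\<omega> / real n = (\<Sum>i\<in>idx L. \<omega> / real n * (ee i)\<^sup>2)"
      using sum_cf_one_sq[OF JL] by (simp add: sum_distrib_left[symmetric] del: times_divide_eq_left)
    also have "\<dots> \<le> (\<Sum>i\<in>idx L. qq i * (ee i)\<^sup>2)"
    proof (intro sum_mono mult_right_mono)
      fix i show "\<omega> / real n \<le> qq i"
        using divide_right_mono[OF sigma_omega_ge[of "fst i"], of "real n"] by simp
    qed simp
    finally show "\<omega> / real n \<le> (\<Sum>i\<in>idx L. qq i * (ee i)\<^sup>2)" .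
  qed
  finally show ?thesis .
qed

lemma score_rr: "i \<in> idx L \<Longrightarrow> score (gg a) i + qq i * (\<sigma> (fst i) * a i) = rr L n a i"
  unfolding rr_def F_eq using sigma_pos[of "fst i"] n_pos by (simp add: power2_eq_square)

text \<open>Both densities integrate to one, and the constant function lies in the span.\<close>

lemma score_one: "(\<Sum>i\<in>idx L. score (gg a) i * ee i) = 0"
proof -
  have c: "cont01 (\<lambda>x. F L a x - exp (g0 x))"
    by (intro continuous_on_diff continuous_on_exp F_cont g0_cont)
  have "int01 (\<lambda>x. F L a x - exp (g0 x)) = 0"
    by (subst int01_diff) (auto intro!: F_cont continuous_on_exp g0_cont simp: int01_F f0_int)
  moreover have "int01 (\<lambda>x. F L a x - exp (g0 x)) = int01 (\<lambda>x. (F L a x - exp (g0 x)) * spn L ee x)"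
    by (intro int01_cong) (simp add: one_expansion[OF JL])
  ultimately show ?thesis
    using int01_span[OF c, where c = ee and L = L] unfolding F_eq by (simp add: mult.commute)
qed

text \<open>The role of \<open>\<kappa>\<close> is played by the log-normaliser, which is not
  controlled but enters along \<open>ee\<close> only.\<close>

lemmas score_bounds = penalised_score_bounds[of "idx L" qq "score (gg a)" "\<lambda>i. \<sigma> (fst i) * a i"
    "rr L n a" ee "cf g0" "\<lambda>i. cg a i - cf g0 i" "ln (nrm L a)" Gc for a,
  OF finite_idx qq_nonneg score_rr score_one _ L2_qe Gc0 sum_cf_one_sq[OF JL]]

text \<open>The l1 bound dominates the l2 norm of \<open>rr\<close>, so the score functional is of
  order \<open>2 ^ L / sqrt (real n)\<close>. Passing to the supremum norm costs \<open>hh\<close>,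
  and the product \<open>2 powr (3 * real L / 2) / sqrt (real n)\<close> is small by
  \<open>sm1\<close>.\<close>

lemma stage_one:
  assumes r: "(\<Sum>i\<in>idx L. \<bar>rr L n a i\<bar>) \<le> M1 * 2 ^ L / sqrt (real n)" and x: "x \<in> {0..1}"
  shows "\<bar>gg a x - g0 x\<bar> \<le> 1"
proof -
  let ?d = "\<lambda>i. cg a i - cf g0 i" and ?k = "(1 + Gc) * (2 * Ct + M1) * (2 ^ L / sqrt (real n))"
  have L1: "(1::real) \<le> 2 ^ L" by simp
  have "L2_set (\<lambda>i. qq i * cf g0 i) (idx L) + L2_set (rr L n a) (idx L)
      \<le> 2 * Ct / sqrt (real n) + M1 * 2 ^ L / sqrt (real n)"
    using L2_qt L2_set_le_sum_abs[of "rr L n a" "idx L"] r by linarith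
  also have "\<dots> \<le> 2 * Ct * 2 ^ L / sqrt (real n) + M1 * 2 ^ L / sqrt (real n)"
    using decay(1) mult_left_mono[OF L1, of "2 * Ct"] by (intro add_right_mono divide_right_mono) auto
  also have "\<dots> = (2 * Ct + M1) * (2 ^ L / sqrt (real n))"
    by (simp add: add_divide_distrib distrib_right)
  finally have *: "L2_set (\<lambda>i. qq i * cf g0 i) (idx L) + L2_set (rr L n a) (idx L)
      \<le> (2 * Ct + M1) * (2 ^ L / sqrt (real n))" .
  have "(\<Sum>i\<in>idx L. score (gg a) i * ?d i)
      \<le> (1 + Gc) * L2_set ?d (idx L) * (L2_set (\<lambda>i. qq i * cf g0 i) (idx L) + L2_set (rr L n a) (idx L))"
    by (rule score_bounds(1)) auto
  also have "\<dots> \<le> (1 + Gc) * L2_set ?d (idx L) * ((2 * Ct + M1) * (2 ^ L / sqrt (real n)))"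
    using * Gc0 by (intro mult_left_mono mult_nonneg_nonneg) (auto simp: L2_set_nonneg)
  also have "\<dots> = ?k * L2_set ?d (idx L)" by (simp only: mult_ac)
  finally have sc: "(\<Sum>i\<in>idx L. score (gg a) i * ?d i) \<le> ?k * L2_set ?d (idx L)" .
  have k0: "0 \<le> ?k" using Gc0 decay(1) M1_pos by simp
  have "eps \<le> eta" using order.trans[OF eps_le sm2] .
  then have "Cb * eps \<le> Cb * eta" using bias(1) by (rule mult_left_mono)
  then have b: "beta L \<le> 1 / 4" using eta_bounds(3) by simp
  have hk: "hh * ?k \<le> (1 + Gc) * (2 * Ct + M1) * eta"
  proof -
    have "hh * (2 ^ L / sqrt (real n)) = 2 powr (3 * real L / 2) / sqrt (real n)"
      unfolding powr_realpow[symmetric, of 2 L, simplified] times_divide_eq_right powr_add[symmetric] by simp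
    then have "hh * (2 ^ L / sqrt (real n)) \<le> eta" using sm1 by (simp only:)
    then have "(1 + Gc) * (2 * Ct + M1) * (hh * (2 ^ L / sqrt (real n))) \<le> (1 + Gc) * (2 * Ct + M1) * eta"
      using Gc0 decay(1) M1_pos by (intro mult_left_mono) auto
    then show ?thesis by (simp only: mult_ac)
  qed
  have hb: "hh * beta L \<le> Cb * eta"
  proof -
    have "hh * eps \<le> 2 powr (- real L / 2)"
      unfolding powr_add[symmetric] using alpha1 mult_left_mono[of 1 \<alpha> "real L"]
      by (intro powr_mono) auto
    then have "Cb * (hh * eps) \<le> Cb * eta" using sm2 bias(1) by (intro mult_left_mono) auto
    then show ?thesis by (simp only: mult_ac)
  qed
  have "4 * Cw * hh * (2 / m0 * (?k + 2 * beta L)) = 4 * Cw * (2 / m0 * (hh * ?k + 2 * (hh * beta L)))"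
    by (simp only: distrib_left mult_ac)
  also have "\<dots> \<le> 4 * Cw * (2 / m0 * ((1 + Gc) * (2 * Ct + M1) * eta + 2 * (Cb * eta)))"
    using hk hb Cw1 m0(1) by (intro mult_left_mono add_mono) auto
  also have "\<dots> \<le> 1 / 4" by (rule eta_bounds)
  finally show ?thesis using sup_le_one[OF gg_span sc k0 b _ x] by simp
qed

text \<open>With the density already comparable to the true one, \<open>L2_stage\<close> applies
  with \<open>B = 1\<close> and gives the rate in L2. This controls the penalty in each single
  score, as required by \<open>sup_stage\<close>.\<close>

lemma stage_two:
  assumes D1: "\<And>x. x \<in> {0..1} \<Longrightarrow> \<bar>gg a x - g0 x\<bar> \<le> 1"
    and r: "\<And>i. i \<in> idx L \<Longrightarrow> \<bar>rr L n a i\<bar> \<le> M2 * \<delta>" and x: "x \<in> {0..1}"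
  shows "\<bar>F L a x - exp (g0 x)\<bar> \<le> Cfin * eps"
proof -
  let ?d = "\<lambda>i. cg a i - cf g0 i" and ?N = "L2dist (gg a)"
  let ?k = "(1 + Gc) * ((2 * Ct + 2 * M2) * eps)"
  have qt: "L2_set (\<lambda>i. qq i * cf g0 i) (idx L) \<le> 2 * Ct * \<delta>"
    using L2_qt inv_sqrt_n decay(1) mult_left_mono[of "1 / sqrt (real n)" \<delta> "2 * Ct"] by simp
  have M2d: "0 \<le> M2 * \<delta>" using M2_pos delta_pos by simp
  have "L2_set (rr L n a) (idx L) \<le> sqrt (real (card (idx L))) * (M2 * \<delta>)"
    by (intro L2_set_le_max r M2d finite_idx)
  also have "\<dots> \<le> 2 * hh * (M2 * \<delta>)" by (intro mult_right_mono sqrt_card M2d)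
  also have "\<dots> = 2 * M2 * (\<delta> * hh)" by (simp only: mult_ac)
  also have "\<dots> \<le> 2 * M2 * eps" using M2_pos by (intro mult_left_mono delta_hh) auto
  finally have rL2: "L2_set (rr L n a) (idx L) \<le> 2 * M2 * eps" .
  have qt': "L2_set (\<lambda>i. qq i * cf g0 i) (idx L) \<le> 2 * Ct * eps"
    using qt mult_left_mono[OF delta_eps, of "2 * Ct"] decay(1) by simp
  have *: "L2_set (\<lambda>i. qq i * cf g0 i) (idx L) + L2_set (rr L n a) (idx L) \<le> (2 * Ct + 2 * M2) * eps"
    using rL2 qt' by (simp add: distrib_right)
  have "(\<Sum>i\<in>idx L. score (gg a) i * ?d i)
      \<le> (1 + Gc) * L2_set ?d (idx L) * (L2_set (\<lambda>i. qq i * cf g0 i) (idx L) + L2_set (rr L n a) (idx L))"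
    by (rule score_bounds(1)) auto
  also have "\<dots> \<le> (1 + Gc) * L2_set ?d (idx L) * ((2 * Ct + 2 * M2) * eps)"
    using * Gc0 by (intro mult_left_mono mult_nonneg_nonneg) (auto simp: L2_set_nonneg)
  also have "\<dots> = ?k * L2_set ?d (idx L)" by (simp only: mult_ac)
  finally have sc: "(\<Sum>i\<in>idx L. score (gg a) i * ?d i) \<le> ?k * L2_set ?d (idx L)" .
  have k0: "0 \<le> ?k" using Gc0 decay(1) M2_pos by simp
  have "eps \<le> eta" using order.trans[OF eps_le sm2] .
  then have "Cb * eps \<le> Cb * eta" using bias(1) by (rule mult_left_mono)
  then have b: "beta L \<le> 1 / 2" using eta_bounds(3) by simp
  have "?N \<le> 2 * (1 + 1) / m0 * (?k + 2 * beta L)"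
    by (rule L2_stage[OF gg_span sc k0 b D1])
  also have "\<dots> = CN * eps" unfolding CN_def by (simp add: algebra_simps)
  finally have N: "?N \<le> CN * eps" .
  have CN0: "0 \<le> CN" unfolding CN_def using m0 Gc0 decay(1) M2_pos bias(1) by simp
  define \<gamma> where "\<gamma> = M2 * \<delta> + 2 powr (real L * (2 * \<alpha> + 1 / 2)) / real n * ((1 + Gc) * (CN * eps))
      + (1 + Gc) * (2 * Ct * \<delta>) + Gc * (real (card (idx J)) * (M2 * \<delta>))"
  \<comment> \<open>Only the indices below level \<open>J\<close> contribute, so their number is
    independent of \<open>n\<close>.\<close>
  have re: "\<bar>\<Sum>i\<in>idx L. rr L n a i * ee i\<bar> \<le> real (card (idx J)) * (M2 * \<delta>)"
  proof -
    have "(\<Sum>i\<in>idx L. rr L n a i * ee i) = (\<Sum>i\<in>idx J. rr L n a i * ee i)"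
    proof (rule sum.mono_neutral_right)
      show "\<forall>i\<in>idx L - idx J. rr L n a i * ee i = 0"
      proof
        fix i assume i: "i \<in> idx L - idx J"
        then have "J \<le> fst i" unfolding idx_def by auto
        then have "ee i = 0" using cf_one_high i by blast
        then show "rr L n a i * ee i = 0" by simp
      qed
    qed (use idx_mono[OF JL] in auto)
    also have "\<bar>\<dots>\<bar> \<le> (\<Sum>i\<in>idx J. M2 * \<delta>)"
    proof (rule order.trans[OF sum_abs], rule sum_mono)
      fix i assume i: "i \<in> idx J"
      then have iL: "i \<in> idx L" using idx_mono[OF JL] by auto
      have "\<bar>ee i\<bar> \<le> 1" using cf_le[OF _ i, of "\<lambda>_. 1"] by simp
      then have "\<bar>rr L n a i\<bar> * \<bar>ee i\<bar> \<le> (M2 * \<delta>) * 1" using r[OF iL] M2d by (intro mult_mono) auto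
      then show "\<bar>rr L n a i * ee i\<bar> \<le> M2 * \<delta>" by (simp add: abs_mult)
    qed
    finally show ?thesis by simp
  qed
  have gam: "\<bar>score (gg a) i\<bar> \<le> \<gamma>" if i: "i \<in> idx L" for i
  proof -
    have "\<bar>score (gg a) i\<bar> \<le> \<bar>rr L n a i\<bar> + qq i * ((1 + Gc) * L2_set ?d (idx L))
       + (1 + Gc) * L2_set (\<lambda>i. qq i * cf g0 i) (idx L) + Gc * \<bar>\<Sum>i\<in>idx L. rr L n a i * ee i\<bar>"
      using i by (intro score_bounds(2)) auto
    also have "\<dots> \<le> \<gamma>"
      unfolding \<gamma>_def
    proof (intro add_mono)
      have "L2_set ?d (idx L) \<le> CN * eps" using L2_dl_le[OF gg_span] N by (rule order.trans)
      then show "qq i * ((1 + Gc) * L2_set ?d (idx L))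
          \<le> 2 powr (real L * (2 * \<alpha> + 1 / 2)) / real n * ((1 + Gc) * (CN * eps))"
        using qq_le(1)[OF i] Gc0 by (intro mult_mono mult_left_mono) (auto simp: L2_set_nonneg)
    qed (use r[OF i] qt re Gc0 in \<open>auto intro!: mult_left_mono\<close>)
    finally show ?thesis .
  qed
  have g0': "0 \<le> \<gamma>"
    unfolding \<gamma>_def using M2_pos Gc0 CN0 decay(1) delta_pos by (intro add_nonneg_nonneg mult_nonneg_nonneg) auto
  \<comment> \<open>In the penalty term the extra \<open>hh\<close> raises the exponent
    \<open>2 * \<alpha> + 1 / 2\<close> to exactly \<open>2 * \<alpha> + 1\<close>, which
    \<open>n\<close> still dominates.\<close>
  have gh: "\<gamma> * hh \<le> Cg * eps"
  proof -
    have "2 powr (real L * (2 * \<alpha> + 1 / 2)) / real n * hh = 2 powr (real L * (2 * \<alpha> + 1)) / real n"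
    proof -
      have "2 powr (real L * (2 * \<alpha> + 1 / 2)) * hh = 2 powr (real L * (2 * \<alpha> + 1))"
        unfolding powr_add[symmetric] by (simp add: algebra_simps)
      then show ?thesis by simp
    qed
    then have q: "2 powr (real L * (2 * \<alpha> + 1 / 2)) / real n * hh \<le> 1" using n_ge n_pos by simp
    have "\<gamma> * hh = (M2 + (1 + Gc) * (2 * Ct) + Gc * (real (card (idx J)) * M2)) * (\<delta> * hh)
        + (2 powr (real L * (2 * \<alpha> + 1 / 2)) / real n * hh) * ((1 + Gc) * (CN * eps))"
      unfolding \<gamma>_def by (simp only: distrib_left distrib_right mult_ac add_ac)
    also have "\<dots> \<le> (M2 + (1 + Gc) * (2 * Ct) + Gc * (real (card (idx J)) * M2)) * eps + 1 * ((1 + Gc) * (CN * eps))"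
      using delta_hh q M2_pos Gc0 decay(1) CN0
      by (intro add_mono mult_left_mono mult_right_mono add_nonneg_nonneg mult_nonneg_nonneg) auto
    also have "\<dots> = Cg * eps" unfolding Cg_def by (simp add: algebra_simps)
    finally show ?thesis .
  qed
  have N2: "2 ^ L * ?N\<^sup>2 \<le> CN\<^sup>2 * eps"
  proof -
    have "?N\<^sup>2 \<le> (CN * eps)\<^sup>2" using N L2dist_nonneg by (intro power_mono)
    then have "2 ^ L * ?N\<^sup>2 \<le> 2 ^ L * (CN * eps)\<^sup>2" by simp
    also have "\<dots> = CN\<^sup>2 * eps * (2 ^ L * eps)" by (simp add: power2_eq_square)
    also have "\<dots> \<le> CN\<^sup>2 * eps * 1" by (intro mult_left_mono pow_eps) auto
    finally show ?thesis by simp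
  qed
  have "\<bar>F L a x - exp (g0 x)\<bar> \<le> 2 * M0 * ((\<gamma> * (4 * Cw * hh) + 4 * M0 * Cw\<^sup>2 * 2 ^ L * ?N\<^sup>2 + 4 * K0 * Cw\<^sup>2 * ?N) / m0 + beta L)"
    unfolding F_eq by (rule sup_stage[OF gg_span D1 gam g0' x])
  also have "\<dots> = 2 * M0 * ((4 * Cw * (\<gamma> * hh) + 4 * M0 * Cw\<^sup>2 * (2 ^ L * ?N\<^sup>2) + 4 * K0 * Cw\<^sup>2 * ?N) / m0 + beta L)"
    by (simp only: mult_ac)
  also have "\<dots> \<le> 2 * M0 * ((4 * Cw * (Cg * eps) + 4 * M0 * Cw\<^sup>2 * (CN\<^sup>2 * eps) + 4 * K0 * Cw\<^sup>2 * (CN * eps)) / m0 + Cb * eps)"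
    using gh N2 N Cw1 M0_nonneg m0(1) f0_Lipschitz(1) bias(1)
    by (intro mult_left_mono add_mono divide_right_mono mult_nonneg_nonneg) auto
  also have "\<dots> = Cfin * eps" unfolding Cfin_def by (simp add: field_simps add_divide_distrib)
  finally show ?thesis .
qed

section \<open>Test directions and their cost\<close>

lemma pow_le_n: "2 ^ L \<le> real n"
proof -
  have "2 ^ L = (2::real) powr (real L)" by (simp add: powr_realpow)
  also have "\<dots> \<le> 2 powr (real L * (2 * \<alpha> + 1))"
    using alpha1 mult_left_mono[of 1 "2 * \<alpha> + 1" "real L"] by (intro powr_mono) auto
  finally show ?thesis using n_ge by linarith
qed

text \<open>A translation by at most \<open>2 powr (- (real L * (\<alpha> + 1 / 2)))\<close> costs
  each coordinate a bounded amount: in the log-Lipschitz case this is the smallest admissible prior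
  scale up to level \<open>L\<close>, and in the Gaussian case the precision is at most the inverse
  square of it.\<close>

lemma pen_term:
  assumes i: "i \<in> idx L" and z: "\<bar>z\<bar> * 2 powr (real L * (\<alpha> + 1 / 2)) \<le> 1"
  shows "K * \<bar>z\<bar> / \<sigma> (fst i) + \<omega> * z\<^sup>2 / (2 * (\<sigma> (fst i))\<^sup>2) \<le> K + 1"
proof (rule add_mono)
  let ?l = "real (fst i)"
  have mono: "2 powr (?l * (\<alpha> + 1 / 2)) \<le> 2 powr (real L * (\<alpha> + 1 / 2))"
    using idxD(2)[OF i] alpha1 by (intro powr_mono mult_right_mono) auto
  have "K / \<sigma> (fst i) * \<bar>z\<bar> \<le> K * 2 powr (real L * (\<alpha> + 1 / 2)) * \<bar>z\<bar>"
    using sigma_K[of "fst i"] mult_left_mono[OF mono omega_K(2)] by (intro mult_right_mono) auto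
  also have "\<dots> = K * (\<bar>z\<bar> * 2 powr (real L * (\<alpha> + 1 / 2)))" by simp
  also have "\<dots> \<le> K * 1" using z omega_K(2) by (rule mult_left_mono)
  finally show "K * \<bar>z\<bar> / \<sigma> (fst i) \<le> K" by simp
  have "\<omega> / (\<sigma> (fst i))\<^sup>2 \<le> 2 powr (real L * (2 * \<alpha> + 1))"
  proof -
    have "\<omega> / (\<sigma> (fst i))\<^sup>2 \<le> \<omega> * 2 powr (?l * (2 * \<alpha> + 1 / 2))" by (rule sigma_omega)
    also have "\<dots> \<le> 1 * 2 powr (real L * (2 * \<alpha> + 1))"
      using omega_K(1) omega_le idxD(2)[OF i] alpha1 by (intro mult_mono powr_mono) auto
    finally show ?thesis by simp
  qed
  then have "\<omega> / (\<sigma> (fst i))\<^sup>2 * z\<^sup>2 \<le> 2 powr (real L * (2 * \<alpha> + 1)) * z\<^sup>2"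
    by (intro mult_right_mono) auto
  also have "\<dots> = (\<bar>z\<bar> * 2 powr (real L * (\<alpha> + 1 / 2)))\<^sup>2"
    unfolding power_mult_distrib power2_abs power2_eq_square[of "2 powr _"] powr_add[symmetric]
    by (simp add: algebra_simps)
  also have "\<dots> \<le> 1" using z by (simp add: power_le_one)
  finally show "\<omega> * z\<^sup>2 / (2 * (\<sigma> (fst i))\<^sup>2) \<le> 1" by simp
qed

text \<open>The scale \<open>1 / sqrt (real n)\<close> makes \<open>n\<close> times the variance of
  order \<open>2 ^ L\<close>, comparable to the logarithm of the number of patterns. For single
  wavelets the scale \<open>\<delta>\<close> in \<open>zI\<close> makes it of order
  \<open>ln (real n)\<close>.\<close>

abbreviation (input) zS :: "(nat \<times> nat) set \<Rightarrow> nat \<times> nat \<Rightarrow> real" where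
  "zS B \<equiv> \<lambda>i. (if i \<in> B then 1 else - 1) / sqrt (real n)"

abbreviation (input) zI :: "(nat \<times> nat) \<times> real \<Rightarrow> nat \<times> nat \<Rightarrow> real" where
  "zI p \<equiv> \<lambda>j. if j = fst p then snd p * \<delta> else 0"

lemma inv_sqrt_scaled: "1 / sqrt (real n) * 2 powr (real L * (\<alpha> + 1 / 2)) \<le> 1"
  using sqrt_n_ge n_pos by simp

lemma spn_zS: assumes "x \<in> {0..1}" shows "\<bar>spn L (zS B) x\<bar> \<le> 4 * Cw * hh / sqrt (real n)"
proof -
  have "\<bar>spn L (zS B) x\<bar> \<le> 1 / sqrt (real n) * (4 * Cw * hh)"
    by (intro span_sup assms) auto
  then show ?thesis by simp
qed

lemma spn_zS_le_one: "4 * Cw * hh / sqrt (real n) \<le> 1"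
proof -
  have "hh \<le> 2 powr (3 * real L / 2)" by (intro powr_mono) auto
  then have "hh / sqrt (real n) \<le> eta"
    using sm1 divide_right_mono[of hh "2 powr (3 * real L / 2)" "sqrt (real n)"] by simp
  then have "4 * Cw * (hh / sqrt (real n)) \<le> 4 * Cw * eta" using Cw1 by (intro mult_left_mono) auto
  then show ?thesis using eta_bounds(2) by simp
qed

lemma spn_zI: assumes "i \<in> idx L" shows "spn L (zI (i, s)) x = s * \<delta> * W i x"
proof -
  have "spn L (zI (i, s)) x = (\<Sum>j\<in>idx L. if j = i then s * \<delta> * W i x else 0)"
    by (intro sum.cong refl) auto
  then show ?thesis using assms by simp
qed

lemma spn_zI_le_one:
  assumes i: "i \<in> idx L" and s: "\<bar>s\<bar> = 1" and x: "x \<in> {0..1}"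
  shows "\<bar>spn L (zI (i, s)) x\<bar> \<le> 1"
proof -
  have "2 powr (real (fst i) / 2) \<le> hh" using idxD(2)[OF i] by (intro powr_mono) auto
  then have "Cw * 2 powr (real (fst i) / 2) \<le> Cw * hh" using Cw1 by (intro mult_left_mono) auto
  then have "\<bar>W i x\<bar> \<le> Cw * hh" using psi_bound[of "snd i" "fst i" x] idxD(1)[OF i] x by simp
  then have "\<delta> * \<bar>W i x\<bar> \<le> \<delta> * (Cw * hh)" using delta_pos by (intro mult_left_mono) linarith+
  also have "\<dots> = Cw * (\<delta> * hh)" by (simp only: mult_ac)
  also have "\<dots> \<le> Cw * eps" using Cw1 by (intro mult_left_mono delta_hh) auto
  also have "\<dots> \<le> Cw * eta" using Cw1 order.trans[OF eps_le sm2] by (intro mult_left_mono) auto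
  also have "\<dots> \<le> 1" using eta_bounds(1,2) Cw1 by simp
  finally show ?thesis unfolding spn_zI[OF i] using s delta_pos by (simp add: abs_mult)
qed

lemma pen_zS: "pen L (zS B) \<le> 2 * 2 ^ L * (K + 1)"
proof -
  have "pen L (zS B) \<le> (\<Sum>i\<in>idx L. K + 1)"
    unfolding pen_def using inv_sqrt_scaled by (intro sum_mono pen_term) auto
  also have "\<dots> = real (card (idx L)) * (K + 1)" by simp
  also have "\<dots> \<le> 2 * 2 ^ L * (K + 1)" using omega_K(2) by (intro mult_right_mono card_idx) auto
  finally show ?thesis .
qed

lemma pen_zI: assumes "i \<in> idx L" "\<bar>s\<bar> = 1" shows "pen L (zI (i, s)) \<le> K + 1"
proof -
  let ?p = "\<lambda>j z. K * \<bar>z\<bar> / \<sigma> (fst j) + \<omega> * z\<^sup>2 / (2 * (\<sigma> (fst j))\<^sup>2)"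
  have "pen L (zI (i, s)) = (\<Sum>j\<in>idx L. if j = i then ?p i (s * \<delta>) else 0)"
    unfolding pen_def by (intro sum.cong refl) auto
  also have "\<dots> = ?p i (s * \<delta>)" using assms by simp
  also have "\<dots> \<le> K + 1"
    using assms delta_le delta_pos by (intro pen_term) (auto simp: abs_mult)
  finally show ?thesis .
qed

lemma int01_sq_le:
  assumes v: "\<And>x. x \<in> {0..1} \<Longrightarrow> \<bar>v x\<bar> \<le> c" "cont01 v" and f: "cont01 f" "\<And>x. 0 \<le> f x" "int01 f = 1"
  shows "int01 (\<lambda>x. (v x)\<^sup>2 * f x) \<le> c\<^sup>2"
proof -
  have "int01 (\<lambda>x. (v x)\<^sup>2 * f x) \<le> int01 (\<lambda>x. c\<^sup>2 * f x)"
  proof (rule int01_mono)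
    fix x :: real assume "x \<in> {0..1}"
    then have "(v x)\<^sup>2 \<le> c\<^sup>2" using v(1) by (metis abs_ge_zero power2_abs power_mono)
    then show "(v x)\<^sup>2 * f x \<le> c\<^sup>2 * f x" using f(2) by (rule mult_right_mono)
  qed (intro continuous_on_mult continuous_on_power continuous_on_const v f)+
  then show ?thesis unfolding int01_cmult using f(3) by simp
qed

text \<open>An upper bound on the density allows the unit L2 norm of the wavelet to be used instead
  of its height; this gains a factor \<open>2 ^ L\<close> over \<open>int01_sq_le\<close>.\<close>

lemma int01_zI_sq_le:
  assumes i: "i \<in> idx L" and s: "\<bar>s\<bar> = 1" and f: "cont01 f" "\<And>x. x \<in> {0..1} \<Longrightarrow> f x \<le> c"
  shows "int01 (\<lambda>x. (spn L (zI (i, s)) x)\<^sup>2 * f x) \<le> \<delta>\<^sup>2 * c"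
proof -
  have s2: "s\<^sup>2 = 1" using s by (metis one_power2 power2_abs)
  have "int01 (\<lambda>x. (spn L (zI (i, s)) x)\<^sup>2 * f x) \<le> int01 (\<lambda>x. \<delta>\<^sup>2 * c * (W i x)\<^sup>2)"
  proof (rule int01_mono)
    fix x :: real assume x: "x \<in> {0..1}"
    have "(\<delta>\<^sup>2 * (W i x)\<^sup>2) * f x \<le> (\<delta>\<^sup>2 * (W i x)\<^sup>2) * c"
      by (intro mult_left_mono f(2)[OF x] mult_nonneg_nonneg zero_le_power2)
    then show "(spn L (zI (i, s)) x)\<^sup>2 * f x \<le> \<delta>\<^sup>2 * c * (W i x)\<^sup>2"
      unfolding spn_zI[OF i] power_mult_distrib s2 by (simp only: mult_ac mult_1)
  qed (intro continuous_on_mult continuous_on_power continuous_on_const f(1) cont_span cont_W[OF i])+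
  also have "\<dots> = \<delta>\<^sup>2 * c" unfolding int01_cmult cf_W_sq[OF i] by simp
  finally show ?thesis .
qed

text \<open>Sign patterns are tested on the whole space, single wavelets only where the rough bound
  holds. A parameter that no test excludes satisfies the assumptions of \<open>stage_one\<close> and
  \<open>stage_two\<close>, and hence violates \<open>Q\<close>.\<close>

lemma integral_post_bound:
  assumes Q: "\<And>a. Q (F L a) \<Longrightarrow> \<exists>x\<in>{0..1}. Cfin * eps < \<bar>F L a x - exp (g0 x)\<bar>"
  shows "(\<integral>xs. post \<psi> \<sigma> \<phi> L Q n xs \<partial>sample f0 n) \<le> exp (- (2 ^ L)) + 4 * exp (K + 1) / real n"
proof -
  \<comment> \<open>On this set \<open>stage_one\<close> bounds the density by
    \<open>exp 1 * M0\<close>, which the variance bound for single wavelets requires.\<close>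
  define A2 where "A2 = {a \<in> space (coefM L). (\<Sum>i\<in>idx L. \<bar>rr L n a i\<bar>) \<le> M1 * 2 ^ L / sqrt (real n)}"
  define Z where "Z = Pow (idx L) <+> (idx L \<times> {-1, 1::real})"
  define z where "z = case_sum zS zI"
  define A where "A = case_sum (\<lambda>_::(nat \<times> nat) set. space (coefM L)) (\<lambda>_::(nat \<times> nat) \<times> real. A2)"
  define V where "V = case_sum (\<lambda>_::(nat \<times> nat) set. 16 * Cw\<^sup>2 * 2 ^ L / real n)
    (\<lambda>_::(nat \<times> nat) \<times> real. \<delta>\<^sup>2 * (exp 1 * M0))"
  define t where "t = case_sum (\<lambda>_::(nat \<times> nat) set. M1 * 2 ^ L) (\<lambda>_::(nat \<times> nat) \<times> real. M2 * ln (real n))"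
  note defs = z_def A_def V_def t_def
  have A2: "A2 \<in> sets (coefM L)" unfolding A2_def by measurable
  have Zcases: "(\<exists>B. k = Inl B) \<or> (\<exists>i s. k = Inr (i, s) \<and> i \<in> idx L \<and> \<bar>s\<bar> = 1)" if "k \<in> Z" for k
    using that unfolding Z_def by auto
  have V1: "(4 * Cw * hh / sqrt (real n))\<^sup>2 = 16 * Cw\<^sup>2 * 2 ^ L / real n"
    unfolding power_divide power_mult_distrib power2_eq_square[of hh] hh_sq by simp
  have "(\<integral>xs. post \<psi> \<sigma> \<phi> L Q n xs \<partial>sample f0 n)
      \<le> (\<Sum>k\<in>Z. exp (2 * real n * V k + pen L (z k) - t k))"
  proof (rule integral_post_le[where A = A])
    show "finite Z" unfolding Z_def by simp
    show "\<bar>spn L (z k) x\<bar> \<le> 1" if k: "k \<in> Z" and x: "x \<in> {0..1}" for k x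
      using Zcases[OF k]
    proof (elim disjE exE conjE)
      fix B assume "k = Inl B"
      then show ?thesis
        using order.trans[OF spn_zS[OF x] spn_zS_le_one, of B] unfolding defs by (simp only: sum.case)
    next
      fix i s assume i: "k = Inr (i, s)" "i \<in> idx L" "\<bar>s\<bar> = 1"
      then show ?thesis
        using spn_zI_le_one[OF i(2,3) x] unfolding defs by (simp only: sum.case)
    qed
    show "A k \<in> sets (coefM L)" if "k \<in> Z" for k
      using Zcases[OF that] A2 unfolding defs by auto
    show "int01 (\<lambda>x. (spn L (z k) x)\<^sup>2 * exp (g0 x)) \<le> V k" if k: "k \<in> Z" for k
      using Zcases[OF k]
    proof (elim disjE exE conjE)
      fix B assume "k = Inl B"
      moreover have "int01 (\<lambda>x. (spn L (zS B) x)\<^sup>2 * exp (g0 x)) \<le> (4 * Cw * hh / sqrt (real n))\<^sup>2"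
        by (intro int01_sq_le spn_zS cont_span continuous_on_exp g0_cont f0_int) auto
      ultimately show ?thesis unfolding defs V1 by simp
    next
      fix i s assume i: "k = Inr (i, s)" "i \<in> idx L" "\<bar>s\<bar> = 1"
      have "exp (g0 x) \<le> exp 1 * M0" if "x \<in> {0..1}" for x
        using mult_mono[of 1 "exp 1" "exp (g0 x)" M0] M0[OF that] by simp
      then have "int01 (\<lambda>x. (spn L (zI (i, s)) x)\<^sup>2 * exp (g0 x)) \<le> \<delta>\<^sup>2 * (exp 1 * M0)"
        using i by (intro int01_zI_sq_le continuous_on_exp g0_cont) auto
      then show ?thesis unfolding defs i(1) by (simp only: sum.case)
    qed
    show "int01 (\<lambda>x. (spn L (z k) x)\<^sup>2 * F L a x) \<le> V k" if k: "k \<in> Z" and a: "a \<in> A k" for k a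
      using Zcases[OF k]
    proof (elim disjE exE conjE)
      fix B assume "k = Inl B"
      moreover have "int01 (\<lambda>x. (spn L (zS B) x)\<^sup>2 * F L a x) \<le> (4 * Cw * hh / sqrt (real n))\<^sup>2"
        by (intro int01_sq_le spn_zS cont_span F_cont int01_F less_imp_le[OF F_pos])
      ultimately show ?thesis unfolding defs V1 by simp
    next
      fix i s assume i: "k = Inr (i, s)" "i \<in> idx L" "\<bar>s\<bar> = 1"
      have "a \<in> A2" using a unfolding defs i(1) by simp
      then have D: "\<bar>gg a x - g0 x\<bar> \<le> 1" if "x \<in> {0..1}" for x
        using stage_one[OF _ that] unfolding A2_def by blast
      have "F L a x \<le> exp 1 * M0" if "x \<in> {0..1}" for x
      proof -
        have "F L a x \<le> exp (1 + g0 x)" unfolding F_eq using D[OF that] by simp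
        also have "\<dots> \<le> exp 1 * M0" unfolding exp_add using M0[OF that] by (intro mult_left_mono) auto
        finally show ?thesis .
      qed
      then have "int01 (\<lambda>x. (spn L (zI (i, s)) x)\<^sup>2 * F L a x) \<le> \<delta>\<^sup>2 * (exp 1 * M0)"
        using i by (intro int01_zI_sq_le F_cont) auto
      then show ?thesis unfolding defs i(1) by (simp only: sum.case)
    qed
    show "\<exists>k\<in>Z. a \<in> A k \<and> t k \<le> dev L n (z k) a" if a: "a \<in> space (coefM L)" and Qa: "Q (F L a)" for a
    proof (cases "a \<in> A2")
      case False
      \<comment> \<open>Matching the signs turns the linear functional \<open>dev\<close> into the
        l1 norm of \<open>rr\<close>.\<close>
      let ?B = "{i \<in> idx L. 0 \<le> rr L n a i}"
      have "(\<Sum>i\<in>idx L. zS ?B i * rr L n a i) = (\<Sum>i\<in>idx L. \<bar>rr L n a i\<bar>) / sqrt (real n)"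
        unfolding sum_divide_distrib by (intro sum.cong refl) auto
      then have "dev L n (zS ?B) a = real n / sqrt (real n) * (\<Sum>i\<in>idx L. \<bar>rr L n a i\<bar>)"
        unfolding dev_eq[OF n_pos] by simp
      also have "\<dots> = sqrt (real n) * (\<Sum>i\<in>idx L. \<bar>rr L n a i\<bar>)" by (simp add: real_div_sqrt)
      also have "\<dots> \<ge> sqrt (real n) * (M1 * 2 ^ L / sqrt (real n))"
        using False a unfolding A2_def by (intro mult_left_mono) auto
      finally have "M1 * 2 ^ L \<le> dev L n (zS ?B) a" using n_pos by simp
      then show ?thesis using a by (intro bexI[of _ "Inl ?B"]) (auto simp: defs Z_def)
    next
      case True
      then have D: "\<bar>gg a x - g0 x\<bar> \<le> 1" if "x \<in> {0..1}" for x
        using stage_one[OF _ that] unfolding A2_def by blast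
      have "\<exists>i\<in>idx L. M2 * \<delta> < \<bar>rr L n a i\<bar>"
      proof (rule ccontr)
        assume "\<not> ?thesis"
        then have "\<bar>F L a x - exp (g0 x)\<bar> \<le> Cfin * eps" if "x \<in> {0..1}" for x
          using stage_two[OF D _ that] by (meson not_le)
        then show False using Q[OF Qa] by (meson not_le)
      qed
      then obtain i where i: "i \<in> idx L" "M2 * \<delta> < \<bar>rr L n a i\<bar>" by blast
      define s :: real where "s = (if 0 \<le> rr L n a i then 1 else - 1)"
      have s: "s \<in> {-1, 1}" "s * rr L n a i = \<bar>rr L n a i\<bar>" unfolding s_def by auto
      have "(\<Sum>j\<in>idx L. zI (i, s) j * rr L n a j) = (\<Sum>j\<in>idx L. if j = i then s * \<delta> * rr L n a i else 0)"
        by (intro sum.cong refl) auto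
      also have "\<dots> = \<delta> * \<bar>rr L n a i\<bar>" using i(1) s(2) by (simp add: mult_ac)
      finally have "dev L n (zI (i, s)) a = real n * (\<delta> * \<bar>rr L n a i\<bar>)" unfolding dev_eq[OF n_pos] by simp
      also have "\<dots> \<ge> real n * (\<delta> * (M2 * \<delta>))"
        using i(2) delta_pos by (intro mult_left_mono) linarith+
      also have "real n * (\<delta> * (M2 * \<delta>)) = M2 * (real n * \<delta>\<^sup>2)" by (simp only: power2_eq_square mult_ac)
      finally have "M2 * ln (real n) \<le> dev L n (zI (i, s)) a" unfolding n_delta_sq .
      then show ?thesis using True i(1) s(1) by (intro bexI[of _ "Inr (i, s)"]) (auto simp: defs Z_def)
    qed
  qed
  also have "\<dots> = (\<Sum>B\<in>Pow (idx L). exp (2 * real n * (16 * Cw\<^sup>2 * 2 ^ L / real n) + pen L (zS B) - M1 * 2 ^ L))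
      + (\<Sum>p\<in>idx L \<times> {-1, 1}. exp (2 * real n * (\<delta>\<^sup>2 * (exp 1 * M0)) + pen L (zI p) - M2 * ln (real n)))"
    unfolding Z_def defs by (subst sum.Plus) simp_all
  also have "\<dots> \<le> (\<Sum>B\<in>Pow (idx L). exp (- 3 * 2 ^ L)) + (\<Sum>p\<in>idx L \<times> {-1, 1::real}. exp (K + 1) / (real n)\<^sup>2)"
  proof (intro add_mono sum_mono)
    fix B
    have "2 * real n * (16 * Cw\<^sup>2 * 2 ^ L / real n) = 32 * Cw\<^sup>2 * 2 ^ L" using n_pos by simp
    then have "2 * real n * (16 * Cw\<^sup>2 * 2 ^ L / real n) + pen L (zS B) - M1 * 2 ^ L \<le> - 3 * 2 ^ L"
      using pen_zS[of B] unfolding M1_def by (simp add: algebra_simps)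
    then show "exp (2 * real n * (16 * Cw\<^sup>2 * 2 ^ L / real n) + pen L (zS B) - M1 * 2 ^ L) \<le> exp (- 3 * 2 ^ L)"
      by (simp only: exp_le_cancel_iff)
  next
    fix p assume p: "p \<in> idx L \<times> {-1, 1::real}"
    then obtain i s where "p = (i, s)" "i \<in> idx L" "\<bar>s\<bar> = 1" by force
    then have "pen L (zI p) \<le> K + 1" using pen_zI[of i s] by (simp only:)
    moreover have "2 * real n * (\<delta>\<^sup>2 * (exp 1 * M0)) = 2 * exp 1 * M0 * ln (real n)"
    proof -
      have "2 * real n * (\<delta>\<^sup>2 * (exp 1 * M0)) = 2 * exp 1 * M0 * (real n * \<delta>\<^sup>2)" by (simp only: mult_ac)
      then show ?thesis unfolding n_delta_sq .
    qed
    ultimately have "2 * real n * (\<delta>\<^sup>2 * (exp 1 * M0)) + pen L (zI p) - M2 * ln (real n) \<le> K + 1 - 2 * ln (real n)"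
      unfolding M2_def by (simp only: distrib_right)
    then have "exp (2 * real n * (\<delta>\<^sup>2 * (exp 1 * M0)) + pen L (zI p) - M2 * ln (real n)) \<le> exp (K + 1 - 2 * ln (real n))"
      by (simp only: exp_le_cancel_iff)
    also have "\<dots> = exp (K + 1) / (real n)\<^sup>2"
      unfolding exp_diff[of "K + 1"] exp_double using n_pos by simp
    finally show "exp (2 * real n * (\<delta>\<^sup>2 * (exp 1 * M0)) + pen L (zI p) - M2 * ln (real n)) \<le> exp (K + 1) / (real n)\<^sup>2" .
  qed
  also have "\<dots> \<le> exp (- (2 ^ L)) + 4 * exp (K + 1) / real n"
  proof (rule add_mono)
    \<comment> \<open>The number of sign patterns is at most \<open>exp (2 * 2 ^ L)\<close>, which
      leaves one factor \<open>exp (- (2 ^ L))\<close>.\<close>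
    have "(2::real) \<le> exp 1" using exp_ge_add_one_self[of 1] by simp
    then have "(2::real) ^ card (idx L) \<le> exp 1 ^ card (idx L)" by (rule power_mono) simp
    also have "\<dots> = exp (real (card (idx L)))" by (simp add: exp_of_nat_mult[symmetric])
    also have "\<dots> \<le> exp (2 * 2 ^ L)" using card_idx by simp
    finally have "2 ^ card (idx L) * exp (- 3 * 2 ^ L) \<le> exp (2 * 2 ^ L) * exp (- 3 * 2 ^ L :: real)"
      by (intro mult_right_mono) auto
    also have "\<dots> = exp (- (2 ^ L))" unfolding exp_add[symmetric] by simp
    finally show "(\<Sum>B\<in>Pow (idx L). exp (- 3 * 2 ^ L)) \<le> exp (- (2 ^ L) :: real)" by (simp add: card_Pow)
    \<comment> \<open>There are at most \<open>4 * 2 ^ L \<le> 4 * n\<close> signed wavelets, so the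
      factor \<open>1 / n\<^sup>2\<close> of each test suffices.\<close>
    have "(\<Sum>p\<in>idx L \<times> {-1, 1::real}. exp (K + 1) / (real n)\<^sup>2) = 2 * real (card (idx L)) * (exp (K + 1) / (real n)\<^sup>2)"
      by (simp add: card_cartesian_product)
    also have "\<dots> \<le> 4 * real n * (exp (K + 1) / (real n)\<^sup>2)"
      using card_idx[of L] pow_le_n by (intro mult_right_mono; (linarith | simp))
    also have "\<dots> = 4 * exp (K + 1) / real n" using n_pos by (simp add: power2_eq_square)
    finally show "(\<Sum>p\<in>idx L \<times> {-1, 1::real}. exp (K + 1) / (real n)\<^sup>2) \<le> 4 * exp (K + 1) / real n" .
  qed
  finally show ?thesis .
qed

end

end

section \<open>The resolution level as a function of the sample size\<close>

lemma
  assumes a: "1 \<le> \<alpha>" and n: "1 \<le> ln (real n)"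
  shows Ln_powr_le: "2 powr (real (Ln \<alpha> n) * (2 * \<alpha> + 1)) * ln (real n) \<le> real n"
    and Ln_gt: "log 2 (real n / ln (real n)) < (real (Ln \<alpha> n) + 1) * (2 * \<alpha> + 1)"
    and Ln_eps_star: "2 powr (- (real (Ln \<alpha> n) * \<alpha>)) \<le> 2 powr \<alpha> * eps_star \<alpha> n"
proof -
  define x where "x = real n / ln (real n)"
  let ?L = "real (Ln \<alpha> n)"
  have n0: "0 < real n" using n by (cases n) auto
  have x1: "1 \<le> x" using ln_le_minus_one[OF n0] n unfolding x_def by (simp add: field_simps)
  have A: "0 < 2 * \<alpha> + 1" using a by simp
  have h: "log 2 (1 / hn \<alpha> n) = log 2 x / (2 * \<alpha> + 1)"
    using x1 unfolding hn_def x_def[symmetric] by (simp add: powr_minus_divide log_powr log_divide)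
  have lx: "0 \<le> log 2 x" using x1 by simp
  \<comment> \<open>Nonnegativity makes the truncation by \<open>nat\<close> in \<open>Ln\<close>
    harmless.\<close>
  have "0 \<le> log 2 x / (2 * \<alpha> + 1)" using lx A by simp
  then have L: "?L \<le> log 2 x / (2 * \<alpha> + 1)" "log 2 x / (2 * \<alpha> + 1) < ?L + 1"
    unfolding Ln_def h by linarith+
  have L1: "?L * (2 * \<alpha> + 1) \<le> log 2 x" using L(1) A by (simp add: field_simps)
  have L2: "log 2 x < (?L + 1) * (2 * \<alpha> + 1)" using L(2) A by (simp add: field_simps)
  show "log 2 (real n / ln (real n)) < (?L + 1) * (2 * \<alpha> + 1)" using L2 unfolding x_def .
  have "2 powr (?L * (2 * \<alpha> + 1)) \<le> 2 powr (log 2 x)" using L1 by (intro powr_mono) auto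
  also have "\<dots> = x" using x1 by simp
  finally show "2 powr (?L * (2 * \<alpha> + 1)) * ln (real n) \<le> real n"
    using n unfolding x_def by (simp add: field_simps)
  \<comment> \<open>Rounding down loses less than one level, at the price of the factor
    \<open>2 powr \<alpha>\<close>.\<close>
  have "- (?L * \<alpha>) = \<alpha> + - ((?L + 1) * \<alpha>)" by (simp add: algebra_simps)
  then have "2 powr (- (?L * \<alpha>)) = 2 powr \<alpha> * 2 powr (- ((?L + 1) * \<alpha>))" by (simp only: powr_add)
  also have "\<dots> \<le> 2 powr \<alpha> * 2 powr (log 2 x * (- \<alpha> / (2 * \<alpha> + 1)))"
  proof (intro mult_left_mono powr_mono)
    have "log 2 x * \<alpha> / (2 * \<alpha> + 1) \<le> (?L + 1) * \<alpha>"
      using mult_right_mono[OF less_imp_le[OF L(2)], of \<alpha>] a by simp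
    then show "- ((?L + 1) * \<alpha>) \<le> log 2 x * (- \<alpha> / (2 * \<alpha> + 1))" by simp
  qed auto
  also have "2 powr (log 2 x * (- \<alpha> / (2 * \<alpha> + 1))) = x powr (- \<alpha> / (2 * \<alpha> + 1))"
    using x1 unfolding powr_powr[symmetric] by simp
  also have "\<dots> = (1 / x) powr (\<alpha> / (2 * \<alpha> + 1))"
    using x1 by (simp add: powr_minus_divide powr_divide)
  also have "1 / x = ln (real n) / real n" unfolding x_def by simp
  finally show "2 powr (- (?L * \<alpha>)) \<le> 2 powr \<alpha> * eps_star \<alpha> n" unfolding eps_star_def .
qed

lemma filterlim_Ln:
  assumes a: "1 \<le> \<alpha>" shows "filterlim (Ln \<alpha>) at_top sequentially"
proof -
  have "filterlim (\<lambda>n. log 2 (real n / ln (real n))) at_top sequentially" by real_asymp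
  moreover have n1: "eventually (\<lambda>n. 1 \<le> ln (real n)) sequentially" by real_asymp
  ultimately show ?thesis
    unfolding filterlim_at_top
  proof (intro allI)
    fix N :: nat
    assume "\<forall>Z. \<forall>\<^sub>F n in sequentially. Z \<le> log 2 (real n / ln (real n))"
    then have "eventually (\<lambda>n. (real N + 1) * (2 * \<alpha> + 1) \<le> log 2 (real n / ln (real n))) sequentially"
      by blast
    with n1 show "eventually (\<lambda>n. N \<le> Ln \<alpha> n) sequentially"
    proof eventually_elim
      case (elim n)
      then have "(real N + 1) * (2 * \<alpha> + 1) < (real (Ln \<alpha> n) + 1) * (2 * \<alpha> + 1)"
        using Ln_gt[OF a] by (meson order.strict_trans1)
      then show ?case using a by simp
    qed
  qed
qed

lemma post_nonneg: "0 \<le> post \<psi> \<sigma> \<phi> L Q n xs"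
  unfolding post_def Let_def by simp

text \<open>The radius \<open>R\<close> is left general in order to cover both radii of the final
  statement; each eventually exceeds a fixed multiple of \<open>eps_star\<close>.\<close>

lemma (in wavelet_posterior_scales) EP_supdist_tendsto:
  assumes R: "eventually (\<lambda>n. Cfin * (2 powr \<alpha> * eps_star \<alpha> n) \<le> R n) sequentially"
  shows "(\<lambda>n. EP \<psi> \<sigma> \<phi> \<alpha> f0 (\<lambda>f. supdist f f0 > R n) n) \<longlonglongrightarrow> 0"
proof -
  note fL = filterlim_Ln[OF alpha1]
  have n1: "eventually (\<lambda>n. 1 \<le> ln (real n)) sequentially" by real_asymp
  have JL: "eventually (\<lambda>n. J \<le> Ln \<alpha> n) sequentially"
    using fL unfolding filterlim_at_top by blast
  have lim1: "(\<lambda>n. 1 / sqrt (ln (real n))) \<longlonglongrightarrow> 0" by real_asymp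
  have s1: "eventually (\<lambda>n. 1 / sqrt (ln (real n)) < eta) sequentially"
    using order_tendstoD(2)[OF lim1 eta_bounds(1)] .
  have "(\<lambda>l::nat. 2 powr (- real l / 2)) \<longlonglongrightarrow> 0" by real_asymp
  then have "(\<lambda>n. 2 powr (- real (Ln \<alpha> n) / 2)) \<longlonglongrightarrow> 0" by (rule filterlim_compose[OF _ fL])
  then have s2: "eventually (\<lambda>n. 2 powr (- real (Ln \<alpha> n) / 2) < eta) sequentially"
    using order_tendstoD(2) eta_bounds(1) by blast
  have CN0: "0 \<le> CN" unfolding CN_def using m0 Gc0 decay(1) M2_pos bias(1) by simp
  have Cf0: "0 \<le> Cfin"
    unfolding Cfin_def Cg_def using m0(1) M0_nonneg Gc0 decay(1) M2_pos bias(1) f0_Lipschitz(1) Cw1 CN0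
    by (intro mult_nonneg_nonneg add_nonneg_nonneg divide_nonneg_nonneg zero_le_power2) auto
  have le: "eventually (\<lambda>n. EP \<psi> \<sigma> \<phi> \<alpha> f0 (\<lambda>f. supdist f f0 > R n) n
      \<le> exp (- (2 ^ Ln \<alpha> n)) + 4 * exp (K + 1) / real n) sequentially"
    using n1 JL s1 s2 R
  proof eventually_elim
    case (elim n)
    let ?L = "Ln \<alpha> n"
    have nL: "2 powr (real ?L * (2 * \<alpha> + 1)) * ln (real n) \<le> real n"
      by (rule Ln_powr_le[OF alpha1 elim(1)])
    \<comment> \<open>For \<open>\<alpha> = 1\<close> the two powers of 2 coincide, and smallness
      comes solely from the logarithm built into the level.\<close>
    have sm1: "2 powr (3 * real ?L / 2) / sqrt (real n) \<le> eta"
    proof -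
      have "2 powr (3 * real ?L / 2) \<le> 2 powr (real ?L * (\<alpha> + 1 / 2))"
        using alpha1 mult_left_mono[of 1 \<alpha> "real ?L"] by (intro powr_mono) (auto simp: algebra_simps)
      also have "\<dots> = sqrt (2 powr (real ?L * (2 * \<alpha> + 1)))"
        unfolding powr_half_sqrt[symmetric, OF powr_ge_zero] powr_powr by (simp add: algebra_simps)
      finally have "2 powr (3 * real ?L / 2) * sqrt (ln (real n))
          \<le> sqrt (2 powr (real ?L * (2 * \<alpha> + 1))) * sqrt (ln (real n))"
        using elim(1) by (intro mult_right_mono) auto
      also have "\<dots> \<le> sqrt (real n)" unfolding real_sqrt_mult[symmetric] using nL by simp
      finally have *: "2 powr (3 * real ?L / 2) * sqrt (ln (real n)) \<le> sqrt (real n)" .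
      have "0 < n" using elim(1) by (cases n) auto
      moreover have "0 < ln (real n)" using elim(1) by linarith
      ultimately have "2 powr (3 * real ?L / 2) / sqrt (real n) \<le> 1 / sqrt (ln (real n))"
        using * by (simp add: field_simps)
      then show ?thesis using elim(3) by linarith
    qed
    show ?case
      unfolding EP_def
    proof (rule integral_post_bound[OF elim(1,2) nL sm1 less_imp_le[OF elim(4)]])
      fix a assume Q: "supdist (F ?L a) f0 > R n"
      show "\<exists>x\<in>{0..1}. Cfin * 2 powr (- (real ?L * \<alpha>)) < \<bar>F ?L a x - exp (g0 x)\<bar>"
      proof (rule ccontr)
        assume "\<not> ?thesis"
        then have "supdist (F ?L a) f0 \<le> Cfin * 2 powr (- (real ?L * \<alpha>))"
          unfolding supdist_def by (intro cSUP_least) (auto simp: f0_eq not_less)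
        also have "\<dots> \<le> Cfin * (2 powr \<alpha> * eps_star \<alpha> n)"
          by (intro mult_left_mono Ln_eps_star[OF alpha1 elim(1)] Cf0)
        also have "\<dots> \<le> R n" by (rule elim)
        finally show False using Q by simp
      qed
    qed
  qed
  have "(\<lambda>l::nat. exp (- (2 ^ l)) :: real) \<longlonglongrightarrow> 0" by real_asymp
  then have e: "(\<lambda>n. exp (- (2 ^ Ln \<alpha> n)) :: real) \<longlonglongrightarrow> 0" by (rule filterlim_compose[OF _ fL])
  have "(\<lambda>n. 4 * exp (K + 1) / real n) \<longlonglongrightarrow> 0"
    by real_asymp
  then have ub: "(\<lambda>n. exp (- (2 ^ Ln \<alpha> n)) + 4 * exp (K + 1) / real n) \<longlonglongrightarrow> 0"
    using tendsto_add[OF e] by simp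
  show ?thesis
  proof (rule tendsto_sandwich[OF _ le tendsto_const ub])
    show "eventually (\<lambda>n. 0 \<le> EP \<psi> \<sigma> \<phi> \<alpha> f0 (\<lambda>f. supdist f f0 > R n) n) sequentially"
      unfolding EP_def by (intro always_eventually allI integral_nonneg_AE AE_I2 post_nonneg)
  qed
qed

section \<open>The two priors and the two radii\<close>

theorem theorem2:
  fixes \<psi> :: "nat \<Rightarrow> nat \<Rightarrow> real \<Rightarrow> real" and S \<alpha> :: real
    and \<sigma> :: "nat \<Rightarrow> real" and \<phi> f0 :: "real \<Rightarrow> real"
  assumes basis: "cdv_basis \<psi> S" and S: "\<alpha> \<le> S"
    and alpha: "1 \<le> \<alpha>"
    and f0_meas: "f0 \<in> borel_measurable lborel"
    and f0_pos: "\<forall>x\<in>{0..1}. f0 x > 0"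
    and f0_int: "(LINT x:{0..1}|lborel. f0 x) = 1"
    and f0_holder: "holder \<alpha> (\<lambda>x. ln (f0 x))"
    and phi_meas: "\<phi> \<in> borel_measurable lborel"
    and phi_nonneg: "\<forall>x. 0 \<le> \<phi> x"
    and phi_int: "(\<integral>\<^sup>+ x. ennreal (\<phi> x) \<partial>lborel) = 1"
    and sigma_pos: "\<forall>l. 0 < \<sigma> l"
    and cases:
      "((\<forall>x. 0 < \<phi> x) \<and> (\<exists>K. \<forall>x y. \<bar>ln (\<phi> x) - ln (\<phi> y)\<bar> \<le> K * \<bar>x - y\<bar>)
          \<and> (\<forall>l. \<sigma> l \<ge> 2 powr (- (real l * (\<alpha> + 1 / 2)))))
       \<or> ((\<forall>x. \<phi> x = exp (- (x\<^sup>2) / 2) / sqrt (2 * pi))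
          \<and> (\<exists>r. 0 < r \<and> r \<le> \<alpha> - 1 / 4 \<and> (\<forall>l. \<sigma> l = 2 powr (- (real l * (1 / 2 + r))))))"
    and contraction:
      "\<exists>\<nu>>0. (\<lambda>n. EP \<psi> \<sigma> \<phi> \<alpha> f0
                (\<lambda>f. hell f f0 > ln (real n) powr \<nu> * real n powr (- \<alpha> / (2 * \<alpha> + 1))) n)
              \<longlonglongrightarrow> 0"
  shows "(\<alpha> > 1 \<longrightarrow>
            (\<forall>M :: nat \<Rightarrow> real. filterlim M at_top sequentially \<longrightarrow>
               (\<lambda>n. EP \<psi> \<sigma> \<phi> \<alpha> f0 (\<lambda>f. supdist f f0 > M n * eps_star \<alpha> n) n) \<longlonglongrightarrow> 0))
       \<and> (\<alpha> = 1 \<longrightarrow>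
            (\<exists>\<eta>>0. \<forall>M :: nat \<Rightarrow> real. filterlim M at_top sequentially \<longrightarrow>
               (\<lambda>n. EP \<psi> \<sigma> \<phi> \<alpha> f0
                      (\<lambda>f. supdist f f0 > M n * (ln (real n) powr \<eta> * eps_star \<alpha> n)) n) \<longlonglongrightarrow> 0))"
proof -
  define g0 where "g0 x = ln (f0 x)" for x
  have g0: "f0 x = exp (g0 x)" if "x \<in> {0..1}" for x
    using f0_pos that unfolding g0_def by simp
  have "int01 (\<lambda>x. exp (g0 x)) = 1"
    using int01_cong[of f0 "\<lambda>x. exp (g0 x)"] g0 f0_int unfolding int01_def by simp
  moreover have "1 \<le> S" using S alpha by simp
  then obtain Cw J where "wavelet_basis \<psi> S Cw J"
    using cdv_basis_wavelet_basis[OF basis] by metis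
  ultimately obtain m0 M0 K0 Cb Ct where D: "wavelet_density \<psi> S Cw J g0 \<alpha> m0 M0 K0 Cb Ct"
    using wavelet_basis.holder_wavelet_density[of \<psi> S Cw J \<alpha> g0] f0_holder alpha S
    unfolding g0_def by metis
  obtain \<omega> K where "0 \<le> \<omega>" "\<omega> \<le> 1" "0 \<le> K"
    and shift: "\<And>x t. \<phi> x * exp (- (\<omega> * t * x) - K * \<bar>t\<bar> - \<omega> * t\<^sup>2 / 2) \<le> \<phi> (t + x)"
    and sK: "\<And>l. K / \<sigma> l \<le> K * 2 powr (real l * (\<alpha> + 1 / 2))"
    and so: "\<And>l. \<omega> / (\<sigma> l)\<^sup>2 \<le> \<omega> * 2 powr (real l * (2 * \<alpha> + 1 / 2))"
    and so': "\<And>l. \<omega> \<le> \<omega> / (\<sigma> l)\<^sup>2"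
    using cases
  proof (elim disjE exE conjE)
    fix K assume phi: "\<forall>x. 0 < \<phi> x" and K: "\<forall>x y. \<bar>ln (\<phi> x) - ln (\<phi> y)\<bar> \<le> K * \<bar>x - y\<bar>"
      and s: "\<forall>l. \<sigma> l \<ge> 2 powr (- (real l * (\<alpha> + 1 / 2)))"
    have K0: "0 \<le> K" using spec[OF spec[OF K, of 0], of 1] by simp
    show thesis
    proof (rule that[of 0 K])
      fix x t :: real
      have "ln (\<phi> x) - K * \<bar>t\<bar> \<le> ln (\<phi> (t + x))" using spec[OF spec[OF K, of x], of "t + x"] by simp
      then have "exp (ln (\<phi> x) - K * \<bar>t\<bar>) \<le> exp (ln (\<phi> (t + x)))" by simp
      then show "\<phi> x * exp (- (0 * t * x) - K * \<bar>t\<bar> - 0 * t\<^sup>2 / 2) \<le> \<phi> (t + x)"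
        using phi by (simp add: exp_diff exp_minus field_simps)
    next
      fix l
      have "K / \<sigma> l \<le> K / 2 powr (- (real l * (\<alpha> + 1 / 2)))"
        using s K0 sigma_pos by (intro divide_left_mono) auto
      then show "K / \<sigma> l \<le> K * 2 powr (real l * (\<alpha> + 1 / 2))" by (simp add: powr_minus_divide)
    qed (use K0 in auto)
  next
    fix r assume phi: "\<forall>x. \<phi> x = exp (- (x\<^sup>2) / 2) / sqrt (2 * pi)" and r: "0 < r" "r \<le> \<alpha> - 1 / 4"
      and s: "\<forall>l. \<sigma> l = 2 powr (- (real l * (1 / 2 + r)))"
    have inv: "1 / (\<sigma> l)\<^sup>2 = 2 powr (real l * (1 + 2 * r))" for l
    proof -
      have "(\<sigma> l)\<^sup>2 = 2 powr (- (real l * (1 + 2 * r)))"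
        unfolding power2_eq_square spec[OF s] powr_add[symmetric]
        by (intro arg_cong[where f = "(powr) 2"]) (simp add: algebra_simps)
      then show ?thesis by (simp add: powr_minus_divide)
    qed
    show thesis
    proof (rule that[of 1 0])
      fix x t :: real
      \<comment> \<open>Completing the square: for the Gaussian density the shift inequality is an
        equality.\<close>
      have "- (x\<^sup>2) / 2 + (- (1 * t * x) - 0 * \<bar>t\<bar> - 1 * t\<^sup>2 / 2) = - ((t + x)\<^sup>2) / 2"
        by (simp add: power2_eq_square field_simps)
      then have "exp (- (x\<^sup>2) / 2) * exp (- (1 * t * x) - 0 * \<bar>t\<bar> - 1 * t\<^sup>2 / 2) = exp (- ((t + x)\<^sup>2) / 2)"
        unfolding exp_add[symmetric] by (simp only:)
      then have "\<phi> x * exp (- (1 * t * x) - 0 * \<bar>t\<bar> - 1 * t\<^sup>2 / 2) = \<phi> (t + x)"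
        unfolding spec[OF phi, of x] spec[OF phi, of "t + x"] times_divide_eq_left by (simp only:)
      then show "\<phi> x * exp (- (1 * t * x) - 0 * \<bar>t\<bar> - 1 * t\<^sup>2 / 2) \<le> \<phi> (t + x)" by (rule eq_refl)
    next
      fix l
      \<comment> \<open>The comparison of exponents is
        \<open>1 + 2 * r \<le> 2 * \<alpha> + 1 / 2\<close>, that is
        \<open>r \<le> \<alpha> - 1 / 4\<close>.\<close>
      show "1 / (\<sigma> l)\<^sup>2 \<le> 1 * 2 powr (real l * (2 * \<alpha> + 1 / 2))"
        unfolding inv mult_1 using r by (intro powr_mono mult_left_mono) auto
      show "1 \<le> 1 / (\<sigma> l)\<^sup>2" unfolding inv using r by (intro ge_one_powr_ge_zero) auto
    qed auto
  qed
  then have "wavelet_posterior_scales \<psi> S Cw J g0 \<alpha> m0 M0 K0 Cb Ct \<sigma> \<phi> f0 \<omega> K"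
    using D sigma_pos phi_meas phi_nonneg phi_int f0_meas g0
    by (simp add: wavelet_posterior_scales_def wavelet_posterior_def wavelet_posterior_axioms_def
        wavelet_posterior_scales_axioms_def)
  then interpret wavelet_posterior_scales \<psi> S Cw J g0 \<alpha> m0 M0 K0 Cb Ct \<sigma> \<phi> f0 \<omega> K .
  have e0: "0 \<le> eps_star \<alpha> n" for n unfolding eps_star_def by simp
  have ev: "eventually (\<lambda>n. Cfin * (2 powr \<alpha> * eps_star \<alpha> n) \<le> M n * eps_star \<alpha> n) sequentially"
    if "filterlim M at_top sequentially" for M :: "nat \<Rightarrow> real"
  proof -
    have "eventually (\<lambda>n. Cfin * 2 powr \<alpha> \<le> M n) sequentially"
      using that unfolding filterlim_at_top by blast
    then show ?thesis
    proof eventually_elim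
      case (elim n)
      then show ?case using mult_right_mono[OF elim e0[of n]] by (simp add: mult.assoc)
    qed
  qed
  have n1: "eventually (\<lambda>n. 1 \<le> ln (real n)) sequentially" by real_asymp
  \<comment> \<open>With \<open>\<eta> = 1\<close> the logarithmic factor is eventually at least 1,
    so this radius eventually exceeds the one in \<open>ev\<close>.\<close>
  have ev': "eventually (\<lambda>n. Cfin * (2 powr \<alpha> * eps_star \<alpha> n) \<le> M n * (ln (real n) powr 1 * eps_star \<alpha> n)) sequentially"
    if M: "filterlim M at_top sequentially" for M :: "nat \<Rightarrow> real"
  proof -
    have "eventually (\<lambda>n. 0 \<le> M n) sequentially" using M unfolding filterlim_at_top by blast
    with ev[OF M] n1 show ?thesis
    proof eventually_elim
      case (elim n)
      have "M n * (1 * eps_star \<alpha> n) \<le> M n * (ln (real n) powr 1 * eps_star \<alpha> n)"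
        using elim e0[of n] by (intro mult_left_mono mult_right_mono) auto
      then show ?case using elim(1) by simp
    qed
  qed
  show ?thesis
    using EP_supdist_tendsto[OF ev] EP_supdist_tendsto[OF ev'] by (auto intro!: exI[of _ 1])
qed

end
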